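(* Let $\sigma:\mathbb{R}^d\to\mathbb{R}^{d\times m}$ and $b:\mathbb{R}^d\to\mathbb{R}^d$ be bounded continuous functions and assume there exist constants $C>0$ and $\mu>0$ such that for every integer $N>e$ and all $x,y\in\mathbb{R}^d$ with $|x|,|y|\le N$, $$\|\sigma(x)-\sigma(y)\|\le C\sqrt{\log N}\,|x-y|+C\frac{\log N}{N^{\mu}},\qquad |b(x)-b(y)|\le C\log N\,|x-y|+C\frac{\log N}{N^{\mu}}.$$ Fix $x\in\mathbb{R}^d$. For $n\in\mathbb{N}^*$ define $X_n(0)=x$ and, for $k\ge0$ and $t\in[k2^{-n},(k+1)2^{-n})$, $$X_n(t)=X_n(k2^{-n})+\sigma(X_n(k2^{-n}))\big(W(t)-W(k2^{-n})\big)+b(X_n(k2^{-n}))(t-k2^{-n}).$$ Let $X$ be the unique solution of $X(t)=x+\int_0^t b(X(s))\,ds+\int_0^t\sigma(X(s))\,dW(s)$. Then for any $T>0$, $$\lim_{n\to+\infty}\mathbb{E}\sup_{t\le T}|X(t)-X_n(t)|^2=0.$$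
   Context: $(\Omega,\mathcal{F},(\mathcal{F}_t),\mathbb{P})$ is a complete filtered probability space with right-continuous filtration containing the null sets, and $(W_t)$ is an $\mathbb{R}^m$-valued standard Brownian motion. $|\cdot|$ is the Euclidean norm and $\|\sigma\|^2=\sum_{i,j}\sigma_{ij}^2$. *)

theory Defs
  imports "HOL-Probability.Probability"
begin

definition usual_filtration :: "'a measure \<Rightarrow> (real \<Rightarrow> 'a measure) \<Rightarrow> bool" where
  "usual_filtration M F \<longleftrightarrow>
     prob_space M \<and>
     (\<forall>A B. B \<in> null_sets M \<longrightarrow> A \<subseteq> B \<longrightarrow> A \<in> sets M) \<and>
     (\<forall>t. space (F t) = space M \<and> sets (F t) \<subseteq> sets M) \<and>
     (\<forall>s t. s \<le> t \<longrightarrow> sets (F s) \<subseteq> sets (F t)) \<and>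
     (\<forall>t. sets (F t) = (\<Inter>s\<in>{t<..}. sets (F s))) \<and>
     (\<forall>t. null_sets M \<subseteq> sets (F t))"

definition std_brownian_motion ::
  "'a measure \<Rightarrow> (real \<Rightarrow> 'a measure) \<Rightarrow> (real \<Rightarrow> 'a \<Rightarrow> real ^ 'm) \<Rightarrow> bool" where
  "std_brownian_motion M F W \<longleftrightarrow>
     (\<forall>\<omega>\<in>space M. W 0 \<omega> = 0) \<and>
     (\<forall>\<omega>\<in>space M. continuous_on {0..} (\<lambda>t. W t \<omega>)) \<and>
     (\<forall>t\<ge>0. W t \<in> borel_measurable (F t)) \<and>
     (\<forall>s t. 0 \<le> s \<longrightarrow> s < t \<longrightarrow>
        prob_space.indep_set M (sets (F s))
          (sets (vimage_algebra (space M) (\<lambda>\<omega>. W t \<omega> - W s \<omega>) borel)) \<and>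
        distributed M lborel (\<lambda>\<omega>. W t \<omega> - W s \<omega>)
          (\<lambda>z. ennreal (\<Prod>i\<in>UNIV. normal_density 0 (sqrt (t - s)) (z $ i))))"

definition ito_sum ::
  "(real \<Rightarrow> 'a \<Rightarrow> real ^ 'm ^ 'd) \<Rightarrow> (real \<Rightarrow> 'a \<Rightarrow> real ^ 'm) \<Rightarrow> real \<Rightarrow> nat \<Rightarrow> 'a \<Rightarrow> real ^ 'd"
  where
  "ito_sum H W t j \<omega> =
     (\<Sum>k<j. H (real k * t / real j) \<omega> *v
              (W (real (Suc k) * t / real j) \<omega> - W (real k * t / real j) \<omega>))"

text \<open>X is a (strong) solution of X(t) = x + int_0^t b(X s) ds + int_0^t sigma(X s) dW(s):
  adapted, continuous paths, and for every t >= 0, X t - x - int_0^t b(X s) ds is the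
  (in-probability) limit of the Ito sums of sigma(X) against W, i.e. the Ito integral
  of the continuous adapted integrand sigma(X).\<close>
definition sde_solution ::
  "'a measure \<Rightarrow> (real \<Rightarrow> 'a measure) \<Rightarrow> (real \<Rightarrow> 'a \<Rightarrow> real ^ 'm) \<Rightarrow>
   (real ^ 'd \<Rightarrow> real ^ 'm ^ 'd) \<Rightarrow> (real ^ 'd \<Rightarrow> real ^ 'd) \<Rightarrow> real ^ 'd \<Rightarrow>
   (real \<Rightarrow> 'a \<Rightarrow> real ^ 'd) \<Rightarrow> bool" where
  "sde_solution M F W \<sigma> b x X \<longleftrightarrow>
     (\<forall>t\<ge>0. X t \<in> borel_measurable (F t)) \<and>
     (\<forall>\<omega>\<in>space M. continuous_on {0..} (\<lambda>t. X t \<omega>)) \<and>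
     (\<forall>t\<ge>0. \<forall>e>0.
        (\<lambda>j. measure M {\<omega>\<in>space M.
            norm (ito_sum (\<lambda>s \<omega>. \<sigma> (X s \<omega>)) W t j \<omega>
                  - (X t \<omega> - x - integral {0..t} (\<lambda>s. b (X s \<omega>)))) > e})
        \<longlonglongrightarrow> 0)"

primrec euler_grid ::
  "(real ^ 'd \<Rightarrow> real ^ 'm ^ 'd) \<Rightarrow> (real ^ 'd \<Rightarrow> real ^ 'd) \<Rightarrow> (real \<Rightarrow> 'a \<Rightarrow> real ^ 'm) \<Rightarrow>
   real ^ 'd \<Rightarrow> nat \<Rightarrow> nat \<Rightarrow> 'a \<Rightarrow> real ^ 'd" where
  "euler_grid \<sigma> b W x n 0 \<omega> = x"
| "euler_grid \<sigma> b W x n (Suc k) \<omega> =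
     euler_grid \<sigma> b W x n k \<omega>
     + \<sigma> (euler_grid \<sigma> b W x n k \<omega>) *v
         (W (real (Suc k) / 2 ^ n) \<omega> - W (real k / 2 ^ n) \<omega>)
     + (1 / 2 ^ n) *\<^sub>R b (euler_grid \<sigma> b W x n k \<omega>)"

definition euler ::
  "(real ^ 'd \<Rightarrow> real ^ 'm ^ 'd) \<Rightarrow> (real ^ 'd \<Rightarrow> real ^ 'd) \<Rightarrow> (real \<Rightarrow> 'a \<Rightarrow> real ^ 'm) \<Rightarrow>
   real ^ 'd \<Rightarrow> nat \<Rightarrow> real \<Rightarrow> 'a \<Rightarrow> real ^ 'd" where
  "euler \<sigma> b W x n t \<omega> =
     (let k = nat \<lfloor>t * 2 ^ n\<rfloor>; y = euler_grid \<sigma> b W x n k \<omega> in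
        y + \<sigma> y *v (W t \<omega> - W (real k / 2 ^ n) \<omega>) + (t - real k / 2 ^ n) *\<^sub>R b y)"

end

theory Submission
  imports Defs "HOL-Real_Asymp.Real_Asymp"
begin

text \<open>
  Only second moments on dyadic times enter, and neither stopping times nor exponential tail
  estimates are needed. On dyadic grids the solution, the Euler scheme and their difference \<open>D\<close> are
  limits in probability of sums \<open>\<Sum> H \<Delta>W + \<beta> \<Delta>t\<close>, so Doob's inequality for such sums and Fatou's lemma
  bound \<open>E sup |D(u) - D(s)|\<^sup>2\<close> over an interval of length \<open>h\<close> by the second moments of the differences of
  the coefficients. On the ball of radius \<open>N\<close> these are controlled by the assumed moduli, outside by
  Chebyshev's inequality, at a cost of order \<open>(ln N / N\<^sup>\<mu>)\<^sup>2 + 1 / N\<^sup>2\<close>.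

  If \<open>h ln N\<close> is small enough, the terms proportional to \<open>|D|\<^sup>2\<close> can be absorbed, and one step of length
  \<open>h\<close> multiplies the error by at most a constant. Crossing a block of fixed length \<open>\<delta>\<close> takes a multiple
  of \<open>\<delta> ln N\<close> steps and so amplifies the cost by a power of \<open>N\<close> with exponent proportional to \<open>\<delta>\<close>, which
  is harmless for small \<open>\<delta>\<close>: let first \<open>n\<close> and then \<open>N\<close> tend to infinity. Finitely many such blocks
  cover \<open>[0, T]\<close>.
\<close>

section \<open>A pathwise form of Doob's inequality\<close>

text \<open>The obstacle is the drift: its squared modulus is of order \<open>(ln N)^2\<close>, so a
  direct Gronwall argument for the maximal inequality on a fixed interval would amplify errors by
  the exponential of a multiple of \<open>(ln N)^2\<close>, which no power of \<open>N\<close>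
  outweighs. On an interval of length \<open>h\<close>, however, the martingale part contributes
  \<open>h * ln N\<close> and the drift \<open>(h * ln N)^2\<close>. Both depend on the product
  only, so steps with \<open>h * ln N\<close> below a constant tame both at once, and the total
  amplification is polynomial in \<open>N\<close>. The exponents of different blocks never add up:
  the error at the start of a block vanishes as \<open>n\<close> grows with \<open>N\<close> fixed,
  so amplifying it is harmless. Dyadic times are imposed by the notion of solution, which gives the
  stochastic integral only as a limit in probability of sums over equal partitions. The partitions
  of \<open>[0, k / 2^q]\<close> into \<open>k * 2^N\<close> parts all belong to one grid, whatever
  \<open>k\<close> is, so increments between dyadic times are limits of such sums too.\<close>

primrec running_max :: "(nat \<Rightarrow> real) \<Rightarrow> nat \<Rightarrow> real" where
  "running_max s 0 = 0"
| "running_max s (Suc n) = max (running_max s n) (s (Suc n))"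

lemma running_max_nonneg: "0 \<le> running_max s n"
  by (induction n) auto

lemma running_max_ge:
  assumes "s 0 = 0" "k \<le> n"
  shows "s k \<le> running_max s n"
  using assms(2)
proof (induction n)
  case (Suc n)
  then show ?case by (cases "k = Suc n") (auto simp: le_max_iff_disj)
qed (use assms in simp)

text \<open>A crude domination that serves to make the running maximum integrable.\<close>

lemma running_max_le_sum_abs: "running_max s n \<le> (\<Sum>i\<le>n. \<bar>s i\<bar>)"
  by (induction n) (auto simp: sum_nonneg intro: order_trans[OF abs_ge_self])

text \<open>From \<open>n\<close> to \<open>Suc n\<close> the right-hand side grows by
  \<open>2 * s (Suc n) * (m' - m)\<close>, where \<open>m\<close> and \<open>m'\<close> are the old
  and the new maximum. This vanishes unless a new maximum is reached; then
  \<open>m' = s (Suc n)\<close>, and the growth exceeds \<open>m'^2 - m^2\<close> by the square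
  \<open>(m' - m)^2\<close>.\<close>

lemma pathwise_doob_aux:
  assumes "s 0 = 0"
  shows "(running_max s n)\<^sup>2 \<le> 2 * running_max s n * s n
           - 2 * (\<Sum>i<n. running_max s i * (s (Suc i) - s i))"
proof (induction n)
  case (Suc n)
  let ?m = "running_max s n"
  show ?case
  proof (cases "s (Suc n) \<le> ?m")
    case True
    then show ?thesis using Suc by (simp add: max_absorb1 algebra_simps)
  next
    case False
    have "0 \<le> (s (Suc n) - ?m)\<^sup>2" by simp
    with False Suc show ?thesis
      by (simp add: max_absorb2 algebra_simps power2_eq_square)
  qed
qed (use assms in simp)

text \<open>For a martingale \<open>s\<close> the last sum is a martingale transform and hence has expectation zero.\<close>

lemma pathwise_doob:
  assumes "s 0 = 0"
  shows "(running_max s n)\<^sup>2 \<le> 4 * (s n)\<^sup>2 - 4 * (\<Sum>i<n. running_max s i * (s (Suc i) - s i))"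
proof -
  let ?m = "running_max s n"
  \<comment> \<open>Young's inequality, weighted so that half of the squared maximum can be
    absorbed; doubling what remains produces the 4 of Doob's inequality in L2.\<close>
  have "0 \<le> (?m - 2 * s n)\<^sup>2" by simp
  then have "2 * ?m * s n \<le> ?m\<^sup>2 / 2 + 2 * (s n)\<^sup>2"
    by (simp add: power2_eq_square algebra_simps)
  with pathwise_doob_aux[of s n, OF assms] show ?thesis by linarith
qed

section \<open>Brownian increments\<close>

text \<open>Brings the density, a product over coordinates, into the basis form in which Lebesgue
  measure factorizes.\<close>

lemma prod_UNIV_eq_prod_Basis:
  fixes f :: "real ^ 'm \<Rightarrow> real"
  shows "(\<Prod>i\<in>UNIV. f (axis i 1)) = (\<Prod>b\<in>Basis. f b)"
proof -
  have "Basis = range (\<lambda>i. axis i (1::real) :: real ^ 'm)" by (auto simp: Basis_vec_def)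
  moreover have "inj (\<lambda>i. axis i (1::real) :: real ^ 'm)" by (auto simp: inj_on_def axis_eq_axis)
  ultimately show ?thesis using prod.reindex[of "\<lambda>i. axis i (1::real) :: real ^ 'm" UNIV f] by simp
qed

abbreviation gauss_density :: "real \<Rightarrow> real ^ 'm \<Rightarrow> real" where
  "gauss_density v z \<equiv> \<Prod>i\<in>UNIV. normal_density 0 (sqrt v) (z $ i)"

lemma nn_integral_gauss_square:
  assumes "0 < v"
  shows "(\<integral>\<^sup>+z. ennreal (gauss_density v z) * ennreal ((z $ a)\<^sup>2) \<partial>(lborel :: (real ^ 'm) measure)) = ennreal v"
proof -
  let ?e = "axis a (1::real) :: real ^ 'm"
  have e: "?e \<in> Basis" by (auto simp: Basis_vec_def)
  \<comment> \<open>The square is attached to a single basis vector, so the integrand is a product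
    of functions of one coordinate each. Tonelli then leaves one variance and otherwise total masses
    1.\<close>
  let ?f = "\<lambda>b t. normal_density 0 (sqrt v) t * (if b = ?e then t\<^sup>2 else 1)"
  have eq: "ennreal (gauss_density v z) * ennreal ((z $ a)\<^sup>2) = ennreal (\<Prod>b\<in>Basis. ?f b (z \<bullet> b))" for z
  proof -
    have "(\<Prod>b\<in>Basis. ?f b (z \<bullet> b)) = (\<Prod>b\<in>Basis. normal_density 0 (sqrt v) (z \<bullet> b)) * (z \<bullet> ?e)\<^sup>2"
      using e by (simp only: prod.distrib) simp
    also have "\<dots> = gauss_density v z * (z $ a)\<^sup>2"
      by (simp add: prod_UNIV_eq_prod_Basis[symmetric] inner_axis)
    finally show ?thesis by (simp add: ennreal_mult' prod_nonneg)
  qed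
  have one: "(\<integral>\<^sup>+t. ennreal (normal_density 0 (sqrt v) t) \<partial>lborel) = 1"
    using assms by (subst nn_integral_eq_integral) auto
  have two: "(\<integral>\<^sup>+t. ennreal (normal_density 0 (sqrt v) t * t\<^sup>2) \<partial>lborel) = ennreal v"
  proof -
    have "has_bochner_integral lborel (\<lambda>t. normal_density 0 (sqrt v) t * t\<^sup>2) v"
      using normal_moment_even[of "sqrt v" 0 1] assms by simp
    then show ?thesis
      by (subst nn_integral_eq_integral) (auto simp: has_bochner_integral_iff)
  qed
  have "(\<integral>\<^sup>+z. ennreal (\<Prod>b\<in>Basis. ?f b (z \<bullet> b)) \<partial>(lborel :: (real ^ 'm) measure))
      = (\<integral>\<^sup>+z. (\<Prod>b\<in>Basis. ennreal (?f b (z \<bullet> b))) \<partial>(lborel :: (real ^ 'm) measure))"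
    by (simp add: prod_ennreal)
  also have "\<dots> = (\<Prod>b\<in>(Basis :: (real ^ 'm) set). \<integral>\<^sup>+t. ennreal (?f b t) \<partial>lborel)"
    by (rule nn_integral_lborel_prod) auto
  also have "\<dots> = (\<Prod>b\<in>(Basis :: (real ^ 'm) set). if b = ?e then ennreal v else 1)"
    by (intro prod.cong) (auto simp: one two)
  also have "\<dots> = ennreal v" using e by simp
  finally show ?thesis by (simp only: eq)
qed

text \<open>The integrand is odd and Lebesgue measure is invariant under reflection, so the integral
  equals its own negative.\<close>

lemma integral_gauss_coordinate:
  "(\<integral>z. gauss_density v z * z $ a \<partial>(lborel :: (real ^ 'm) measure)) = 0"
proof -
  let ?g = "\<lambda>z :: real ^ 'm. gauss_density v z * z $ a"
  have m: "?g \<in> borel_measurable borel" by measurable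
  have "(\<integral>z. ?g z \<partial>lborel) = (\<integral>z. ?g (- z) \<partial>lborel)"
    using m by (subst lborel_affine[of "- 1" 0]) (simp_all add: density_1 integral_distr)
  also have "\<dots> = - (\<integral>z. ?g z \<partial>lborel)"
    by (simp add: normal_density_def)
  finally show ?thesis by simp
qed

locale brownian_filtration =
  fixes M :: "'a measure" and F :: "real \<Rightarrow> 'a measure" and W :: "real \<Rightarrow> 'a \<Rightarrow> real ^ 'm"
  assumes filt: "usual_filtration M F"
    and BM: "std_brownian_motion M F W"
begin

sublocale prob_space M
  by (rule conjunct1[OF filt[unfolded usual_filtration_def]])

lemma sets_F_subset: "sets (F t) \<subseteq> sets M" and space_F: "space (F t) = space M"
  and sets_F_mono: "s \<le> t \<Longrightarrow> sets (F s) \<subseteq> sets (F t)"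
proof -
  note rest = conjunct2[OF conjunct2[OF filt[unfolded usual_filtration_def]]]
  show "sets (F t) \<subseteq> sets M" "space (F t) = space M"
    using spec[OF conjunct1[OF rest], of t] by simp_all
  show "s \<le> t \<Longrightarrow> sets (F s) \<subseteq> sets (F t)"
    using spec[OF spec[OF conjunct1[OF conjunct2[OF rest]], of s], of t] by simp
qed

lemma measurable_F_mono: "f \<in> measurable (F s) N \<Longrightarrow> s \<le> t \<Longrightarrow> f \<in> measurable (F t) N"
  using sets_F_mono[of s t] by (auto simp: measurable_def space_F)

lemma measurable_F: "f \<in> measurable (F s) N \<Longrightarrow> f \<in> measurable M N"
  using sets_F_subset[of s] by (auto simp: measurable_def space_F)

lemma W_measurable: "0 \<le> t \<Longrightarrow> W t \<in> borel_measurable (F t)"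
  using BM by (simp add: std_brownian_motion_def)

lemma W_distributed:
  "0 \<le> s \<Longrightarrow> s < t \<Longrightarrow>
    distributed M lborel (\<lambda>\<omega>. W t \<omega> - W s \<omega>) (\<lambda>z. ennreal (gauss_density (t - s) z))"
  using BM by (simp add: std_brownian_motion_def)

lemma increment_measurable:
  "0 \<le> s \<Longrightarrow> 0 \<le> t \<Longrightarrow> (\<lambda>\<omega>. W t \<omega> - W s \<omega>) \<in> borel_measurable M"
  using W_measurable[THEN measurable_F] by (intro borel_measurable_diff)

text \<open>Independence passes to smaller sigma-algebras: the one generated by \<open>Y\<close>
  lies in \<open>F s\<close>, and the one generated by \<open>g\<close> of the increment lies in
  that of the increment.\<close>

lemma increment_indep:
  assumes "0 \<le> s" "s < t"
    and Y: "Y \<in> borel_measurable (F s)" and g: "g \<in> borel_measurable borel"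
  shows "indep_var borel Y borel (\<lambda>\<omega>. g (W t \<omega> - W s \<omega>))"
proof -
  let ?V = "\<lambda>\<omega>. W t \<omega> - W s \<omega>"
  have ind: "indep_set (sets (F s)) (sets (vimage_algebra (space M) ?V borel))"
    using BM assms(1,2) by (simp add: std_brownian_motion_def)
  have V: "?V \<in> borel_measurable M" using assms by (intro increment_measurable) auto
  have a: "sigma_sets (space M) {Y -` A \<inter> space M |A. A \<in> sets borel} \<subseteq> sets (F s)"
    using measurable_sets[OF Y]
    by (intro sets.sigma_sets_subset[of _ "F s", unfolded space_F]) (auto simp: space_F)
  have "(\<lambda>\<omega>. g (?V \<omega>)) \<in> borel_measurable (vimage_algebra (space M) ?V borel)"
    using g by (intro measurable_compose[OF measurable_vimage_algebra1]) auto
  from measurable_sets[OF this]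
  have b: "sigma_sets (space M) {(\<lambda>\<omega>. g (?V \<omega>)) -` A \<inter> space M |A. A \<in> sets borel}
      \<subseteq> sets (vimage_algebra (space M) ?V borel)"
    by (intro sets.sigma_sets_subset[of _ "vimage_algebra (space M) ?V borel", unfolded space_vimage_algebra])
       auto
  have "indep_set (sigma_sets (space M) {Y -` A \<inter> space M |A. A \<in> sets borel})
     (sigma_sets (space M) {(\<lambda>\<omega>. g (?V \<omega>)) -` A \<inter> space M |A. A \<in> sets borel})"
    using ind a b unfolding indep_sets2_eq by blast
  then show ?thesis
    using measurable_F[OF Y] measurable_compose[OF V g] by (simp add: indep_var_eq)
qed

lemma increment_square:
  assumes "0 \<le> s" "s < t"
  shows "integrable M (\<lambda>\<omega>. ((W t \<omega> - W s \<omega>) $ a)\<^sup>2)" "expectation (\<lambda>\<omega>. ((W t \<omega> - W s \<omega>) $ a)\<^sup>2) = t - s"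
proof -
  have "(\<integral>\<^sup>+\<omega>. ennreal (((W t \<omega> - W s \<omega>) $ a)\<^sup>2) \<partial>M)
      = (\<integral>\<^sup>+z. ennreal (gauss_density (t - s) z) * ennreal ((z $ a)\<^sup>2) \<partial>(lborel :: (real ^ 'm) measure))"
    by (rule distributed_nn_integral[symmetric, OF W_distributed[OF assms]]) measurable
  also have "\<dots> = ennreal (t - s)"
    using assms by (intro nn_integral_gauss_square) auto
  finally have *: "(\<integral>\<^sup>+\<omega>. ennreal (((W t \<omega> - W s \<omega>) $ a)\<^sup>2) \<partial>M) = ennreal (t - s)" .
  have V: "(\<lambda>\<omega>. W t \<omega> - W s \<omega>) \<in> borel_measurable M" 
    using assms by (intro increment_measurable) auto
  have m: "(\<lambda>\<omega>. ((W t \<omega> - W s \<omega>) $ a)\<^sup>2) \<in> borel_measurable M" 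
    by (rule measurable_compose[OF V]) measurable
  show "integrable M (\<lambda>\<omega>. ((W t \<omega> - W s \<omega>) $ a)\<^sup>2)"
    using m * by (intro integrableI_nn_integral_finite[where x = "t - s"]) (use assms in auto)
  show "expectation (\<lambda>\<omega>. ((W t \<omega> - W s \<omega>) $ a)\<^sup>2) = t - s"
    using m * assms by (intro integral_eq_nn_integral[THEN trans]) auto
qed

lemma increment_norm_square:
  assumes "0 \<le> s" "s < t"
  shows "integrable M (\<lambda>\<omega>. (norm (W t \<omega> - W s \<omega>))\<^sup>2)"
    "expectation (\<lambda>\<omega>. (norm (W t \<omega> - W s \<omega>))\<^sup>2) = real CARD('m) * (t - s)"
proof -
  have eq: "(norm (z::real^'m))\<^sup>2 = (\<Sum>a\<in>UNIV. (z $ a)\<^sup>2)" for z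
    by (simp add: norm_vec_def L2_set_def sum_nonneg)
  show "integrable M (\<lambda>\<omega>. (norm (W t \<omega> - W s \<omega>))\<^sup>2)"
    unfolding eq
    by (rule Bochner_Integration.integrable_sum) (rule increment_square(1)[OF assms])
  show "expectation (\<lambda>\<omega>. (norm (W t \<omega> - W s \<omega>))\<^sup>2) = real CARD('m) * (t - s)"
    unfolding eq
    by (simp only: Bochner_Integration.integral_sum[OF increment_square(1)[OF assms]]
        increment_square(2)[OF assms]) simp
qed

lemma increment_mean:
  assumes "0 \<le> s" "s < t"
  shows "integrable M (\<lambda>\<omega>. (W t \<omega> - W s \<omega>) $ a)" "expectation (\<lambda>\<omega>. (W t \<omega> - W s \<omega>) $ a) = 0"
proof -
  have V: "(\<lambda>\<omega>. W t \<omega> - W s \<omega>) \<in> borel_measurable M" 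
    using assms by (intro increment_measurable) auto
  have m: "(\<lambda>\<omega>. (W t \<omega> - W s \<omega>) $ a) \<in> borel_measurable M" 
    by (rule measurable_compose[OF V]) measurable
  show "integrable M (\<lambda>\<omega>. (W t \<omega> - W s \<omega>) $ a)"
    using m increment_square(1)[OF assms] by (rule square_integrable_imp_integrable)
  show "expectation (\<lambda>\<omega>. (W t \<omega> - W s \<omega>) $ a) = 0"
    by (subst distributed_integral[OF W_distributed[OF assms], of "\<lambda>z. z $ a", symmetric])
       (simp_all add: prod_nonneg integral_gauss_coordinate del: vector_minus_component)
qed

text \<open>The martingale property without conditional expectations: an increment is orthogonal to
  every integrable variable of the past.\<close>

lemma expectation_mult_increment:
  assumes "0 \<le> s" "s < t" and Y: "Y \<in> borel_measurable (F s)" "integrable M Y"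
  shows "integrable M (\<lambda>\<omega>. Y \<omega> * (W t \<omega> - W s \<omega>) $ a)" "expectation (\<lambda>\<omega>. Y \<omega> * (W t \<omega> - W s \<omega>) $ a) = 0"
proof -
  have ind: "indep_var borel Y borel (\<lambda>\<omega>. (W t \<omega> - W s \<omega>) $ a)"
    using increment_indep[OF assms(1-3), of "\<lambda>z. z $ a"] by (simp del: vector_minus_component)
  show "integrable M (\<lambda>\<omega>. Y \<omega> * (W t \<omega> - W s \<omega>) $ a)"
    by (rule indep_var_integrable[OF ind Y(2) increment_mean(1)[OF assms(1,2)]])
  show "expectation (\<lambda>\<omega>. Y \<omega> * (W t \<omega> - W s \<omega>) $ a) = 0"
    using indep_var_lebesgue_integral[OF ind Y(2) increment_mean(1)[OF assms(1,2)]]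
    by (simp only: increment_mean(2)[OF assms(1,2)] mult_zero_right)
qed

lemma expectation_mult_increment_norm_square:
  assumes "0 \<le> s" "s < t" and Y: "Y \<in> borel_measurable (F s)" "integrable M Y"
  shows "integrable M (\<lambda>\<omega>. Y \<omega> * (norm (W t \<omega> - W s \<omega>))\<^sup>2)"
    "expectation (\<lambda>\<omega>. Y \<omega> * (norm (W t \<omega> - W s \<omega>))\<^sup>2) = expectation Y * (real CARD('m) * (t - s))"
proof -
  have ind: "indep_var borel Y borel (\<lambda>\<omega>. (norm (W t \<omega> - W s \<omega>))\<^sup>2)"
    using increment_indep[OF assms(1-3), of "\<lambda>z. (norm z)\<^sup>2"] by simp
  show "integrable M (\<lambda>\<omega>. Y \<omega> * (norm (W t \<omega> - W s \<omega>))\<^sup>2)"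
    by (rule indep_var_integrable[OF ind Y(2) increment_norm_square(1)[OF assms(1,2)]])
  show "expectation (\<lambda>\<omega>. Y \<omega> * (norm (W t \<omega> - W s \<omega>))\<^sup>2) = expectation Y * (real CARD('m) * (t - s))"
    using indep_var_lebesgue_integral[OF ind Y(2) increment_norm_square(1)[OF assms(1,2)]]
    by (simp only: increment_norm_square(2)[OF assms(1,2)])
qed

section \<open>Maximal inequalities for discrete stochastic integrals\<close>

text \<open>One component of a vector-valued stochastic sum; \<open>h\<close> will be a row of the
  matrix integrand.\<close>

definition scalar_sum :: "(nat \<Rightarrow> real) \<Rightarrow> (nat \<Rightarrow> 'a \<Rightarrow> real ^ 'm) \<Rightarrow> nat \<Rightarrow> 'a \<Rightarrow> real" where
  "scalar_sum t h k \<omega> = (\<Sum>i<k. h i \<omega> \<bullet> (W (t (Suc i)) \<omega> - W (t i) \<omega>))"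

context
  fixes t :: "nat \<Rightarrow> real" and h :: "nat \<Rightarrow> 'a \<Rightarrow> real ^ 'm" and K :: real
  assumes t0: "0 \<le> t 0" and tS: "\<And>i. t i < t (Suc i)"
    and h_adapted: "\<And>i. h i \<in> borel_measurable (F (t i))"
    and h_bound: "\<And>i \<omega>. norm (h i \<omega>) \<le> K"
begin

lemma t_nonneg: "0 \<le> t i"
  using t0 lift_Suc_mono_le[of t 0 i, OF less_imp_le[OF tS]] by simp

lemma scalar_sum_adapted: "scalar_sum t h k \<in> borel_measurable (F (t k))"
proof (induction k)
  case 0
  then show ?case by (simp add: scalar_sum_def[abs_def])
next
  case (Suc k)
  have "h k \<in> borel_measurable (F (t (Suc k)))" "W (t k) \<in> borel_measurable (F (t (Suc k)))"
    "W (t (Suc k)) \<in> borel_measurable (F (t (Suc k)))"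
    "scalar_sum t h k \<in> borel_measurable (F (t (Suc k)))"
    using tS[of k] h_adapted Suc t_nonneg W_measurable by (auto intro: measurable_F_mono[OF _ less_imp_le])
  then have "(\<lambda>\<omega>. scalar_sum t h k \<omega> + h k \<omega> \<bullet> (W (t (Suc k)) \<omega> - W (t k) \<omega>))
      \<in> borel_measurable (F (t (Suc k)))"
    by measurable
  then show ?case by (simp add: scalar_sum_def[abs_def])
qed

text \<open>The bound \<open>K\<close> keeps \<open>Y * h\<close> integrable for any integrable
  \<open>Y\<close>. This allows \<open>Y\<close> to be a partial sum (for orthogonality) as well as
  its running maximum (for Doob's inequality).\<close>

lemma expectation_mult_step:
  assumes Y: "Y \<in> borel_measurable (F (t k))" "integrable M Y"
  shows "integrable M (\<lambda>\<omega>. Y \<omega> * (h k \<omega> \<bullet> (W (t (Suc k)) \<omega> - W (t k) \<omega>)))" (is ?int)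
    and "expectation (\<lambda>\<omega>. Y \<omega> * (h k \<omega> \<bullet> (W (t (Suc k)) \<omega> - W (t k) \<omega>))) = 0" (is ?exp)
proof -
  have eq: "Y \<omega> * (h k \<omega> \<bullet> (W (t (Suc k)) \<omega> - W (t k) \<omega>))
      = (\<Sum>a\<in>UNIV. (Y \<omega> * h k \<omega> $ a) * (W (t (Suc k)) \<omega> - W (t k) \<omega>) $ a)" for \<omega>
    by (simp add: inner_vec_def sum_distrib_left mult.assoc)
  have m: "(\<lambda>\<omega>. Y \<omega> * h k \<omega> $ a) \<in> borel_measurable (F (t k))" for a
    by (intro borel_measurable_times Y(1) measurable_compose[OF h_adapted]) measurable
  have "integrable M (\<lambda>\<omega>. Y \<omega> * h k \<omega> $ a)" for a
  proof (rule Bochner_Integration.integrable_bound)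
    show "integrable M (\<lambda>\<omega>. K * Y \<omega>)" using Y by simp
    show "AE \<omega> in M. norm (Y \<omega> * h k \<omega> $ a) \<le> norm (K * Y \<omega>)"
    proof (rule AE_I2)
      fix \<omega>
      have "\<bar>h k \<omega> $ a\<bar> \<le> \<bar>K\<bar>"
        using component_le_norm_cart[of "h k \<omega>" a] h_bound[of k \<omega>] by linarith
      then show "norm (Y \<omega> * h k \<omega> $ a) \<le> norm (K * Y \<omega>)"
        by (simp add: abs_mult mult.commute[of "\<bar>K\<bar>"] mult_left_mono)
    qed
  qed (rule measurable_F[OF m])
  note * = expectation_mult_increment[OF t_nonneg tS m this]
  show ?int unfolding eq
    by (rule Bochner_Integration.integrable_sum) (rule *(1))
  show ?exp unfolding eq
    by (simp only: Bochner_Integration.integral_sum[OF *(1)] *(2)) simp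
qed

lemma bounded_square_integrable: "integrable M (\<lambda>\<omega>. (norm (h k \<omega>))\<^sup>2)"
proof (rule integrable_const_bound)
  show "AE \<omega> in M. norm ((norm (h k \<omega>))\<^sup>2) \<le> K\<^sup>2"
    using h_bound by (auto intro!: power_mono)
  show "(\<lambda>\<omega>. (norm (h k \<omega>))\<^sup>2) \<in> borel_measurable M"
    using measurable_F[OF h_adapted[of k]] by measurable
qed

text \<open>Cauchy-Schwarz replaces the exact isometry: it costs the factor \<open>CARD('m)\<close>
  but avoids the correlations between components of the increment.\<close>

lemma expectation_step_square:
  defines "d \<equiv> \<lambda>k \<omega>. h k \<omega> \<bullet> (W (t (Suc k)) \<omega> - W (t k) \<omega>)"
  shows "integrable M (\<lambda>\<omega>. (d k \<omega>)\<^sup>2)"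
    and "expectation (\<lambda>\<omega>. (d k \<omega>)\<^sup>2)
      \<le> real CARD('m) * (t (Suc k) - t k) * expectation (\<lambda>\<omega>. (norm (h k \<omega>))\<^sup>2)"
proof -
  have m: "(\<lambda>\<omega>. (norm (h k \<omega>))\<^sup>2) \<in> borel_measurable (F (t k))"
    using h_adapted[of k] by measurable
  note * = expectation_mult_increment_norm_square[OF t_nonneg tS m bounded_square_integrable]
  have V: "(\<lambda>\<omega>. W (t (Suc k)) \<omega> - W (t k) \<omega>) \<in> borel_measurable M"
    by (intro increment_measurable t_nonneg)
  have md: "(\<lambda>\<omega>. (d k \<omega>)\<^sup>2) \<in> borel_measurable M"
    unfolding d_def using V measurable_F[OF h_adapted[of k]] by measurable
  have le: "(d k \<omega>)\<^sup>2 \<le> (norm (h k \<omega>))\<^sup>2 * (norm (W (t (Suc k)) \<omega> - W (t k) \<omega>))\<^sup>2" for \<omega>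
    using Cauchy_Schwarz_ineq[of "h k \<omega>" "W (t (Suc k)) \<omega> - W (t k) \<omega>"]
    by (simp add: d_def power2_norm_eq_inner)
  show int: "integrable M (\<lambda>\<omega>. (d k \<omega>)\<^sup>2)"
    by (rule Bochner_Integration.integrable_bound[OF *(1) md]) (use le in auto)
  have "expectation (\<lambda>\<omega>. (d k \<omega>)\<^sup>2)
      \<le> expectation (\<lambda>\<omega>. (norm (h k \<omega>))\<^sup>2 * (norm (W (t (Suc k)) \<omega> - W (t k) \<omega>))\<^sup>2)"
    by (rule integral_mono[OF int *(1) le])
  then show "expectation (\<lambda>\<omega>. (d k \<omega>)\<^sup>2)
      \<le> real CARD('m) * (t (Suc k) - t k) * expectation (\<lambda>\<omega>. (norm (h k \<omega>))\<^sup>2)"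
    unfolding *(2) by (simp only: ac_simps)
qed

text \<open>The cross term has mean zero because the next step is orthogonal to the past.
  Integrability runs along in the induction since that orthogonality presupposes an integrable
  partial sum.\<close>

lemma scalar_sum_square:
  shows "integrable M (\<lambda>\<omega>. (scalar_sum t h k \<omega>)\<^sup>2)"
    and "expectation (\<lambda>\<omega>. (scalar_sum t h k \<omega>)\<^sup>2)
      \<le> (\<Sum>i<k. real CARD('m) * (t (Suc i) - t i) * expectation (\<lambda>\<omega>. (norm (h i \<omega>))\<^sup>2))"
proof (induction k)
  case 0
  { case 1 show ?case by (simp add: scalar_sum_def) }
  { case 2 show ?case by (simp add: scalar_sum_def) }
next
  case (Suc k)
  let ?d = "\<lambda>\<omega>. h k \<omega> \<bullet> (W (t (Suc k)) \<omega> - W (t k) \<omega>)"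
  let ?S = "scalar_sum t h k"
  have eq: "(scalar_sum t h (Suc k) \<omega>)\<^sup>2 = (?S \<omega>)\<^sup>2 + 2 * (?S \<omega> * ?d \<omega>) + (?d \<omega>)\<^sup>2" for \<omega>
    by (simp add: scalar_sum_def power2_sum)
  have "integrable M ?S"
    by (rule square_integrable_imp_integrable[OF measurable_F[OF scalar_sum_adapted] Suc(1)])
  note step = expectation_mult_step[OF scalar_sum_adapted this]
  note sq = expectation_step_square[of k]
  have i2: "integrable M (\<lambda>\<omega>. 2 * (?S \<omega> * ?d \<omega>))"
    by (rule integrable_mult_right) (rule step(1))
  note i12 = Bochner_Integration.integrable_add[OF Suc(1) i2]
  { case 1 show ?case unfolding eq by (rule Bochner_Integration.integrable_add[OF i12 sq(1)]) }
  { case 2 show ?case unfolding eq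
      Bochner_Integration.integral_add[OF i12 sq(1)] Bochner_Integration.integral_add[OF Suc(1) i2]
      integral_mult_right_zero step(2) sum.lessThan_Suc
      using Suc(2) sq(2) by linarith }
qed

lemma scalar_sum_integrable: "integrable M (scalar_sum t h k)"
  by (rule square_integrable_imp_integrable[OF measurable_F[OF scalar_sum_adapted] scalar_sum_square(1)])

lemma running_max_adapted:
  "(\<lambda>\<omega>. running_max (\<lambda>j. scalar_sum t h j \<omega>) k) \<in> borel_measurable (F (t k))"
proof (induction k)
  case (Suc k)
  then have "(\<lambda>\<omega>. running_max (\<lambda>j. scalar_sum t h j \<omega>) k) \<in> borel_measurable (F (t (Suc k)))"
    using tS[of k] by (auto intro: measurable_F_mono)
  with scalar_sum_adapted[of "Suc k"] show ?case by simp
qed simp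

text \<open>Integrate \<open>pathwise_doob\<close>: the running maximum up to \<open>i\<close> is
  known at time \<open>t i\<close>, so the transform has mean zero and only the final square
  survives. The same pathwise bound gives integrability of the squared maximum.\<close>

lemma doob_scalar:
  defines "R \<equiv> \<lambda>k \<omega>. running_max (\<lambda>j. scalar_sum t h j \<omega>) k"
  shows "integrable M (\<lambda>\<omega>. (R n \<omega>)\<^sup>2)"
    and "expectation (\<lambda>\<omega>. (R n \<omega>)\<^sup>2)
      \<le> 4 * (\<Sum>i<n. real CARD('m) * (t (Suc i) - t i) * expectation (\<lambda>\<omega>. (norm (h i \<omega>))\<^sup>2))"
proof -
  let ?S = "scalar_sum t h"
  let ?d = "\<lambda>k \<omega>. h k \<omega> \<bullet> (W (t (Suc k)) \<omega> - W (t k) \<omega>)"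
  have R_int: "integrable M (R k)" for k
  proof (rule Bochner_Integration.integrable_bound)
    show "integrable M (\<lambda>\<omega>. \<Sum>i\<le>k. \<bar>?S i \<omega>\<bar>)"
      by (intro Bochner_Integration.integrable_sum integrable_abs scalar_sum_integrable)
    show "R k \<in> borel_measurable M" unfolding R_def by (rule measurable_F[OF running_max_adapted])
    show "AE \<omega> in M. norm (R k \<omega>) \<le> norm (\<Sum>i\<le>k. \<bar>?S i \<omega>\<bar>)"
      unfolding R_def using running_max_le_sum_abs running_max_nonneg
      by (intro AE_I2) (simp add: sum_nonneg)
  qed
  note step = expectation_mult_step[OF running_max_adapted R_int[unfolded R_def]]
  have diff: "?S (Suc i) \<omega> - ?S i \<omega> = ?d i \<omega>" for i \<omega>
    by (simp add: scalar_sum_def)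
  have le: "(R n \<omega>)\<^sup>2 \<le> 4 * (?S n \<omega>)\<^sup>2 - 4 * (\<Sum>i<n. R i \<omega> * ?d i \<omega>)" for \<omega>
    using pathwise_doob[of "\<lambda>j. ?S j \<omega>" n] unfolding R_def diff by (simp add: scalar_sum_def)
  have i1: "integrable M (\<lambda>\<omega>. 4 * (?S n \<omega>)\<^sup>2)"
    by (rule integrable_mult_right) (rule scalar_sum_square(1))
  have i2: "integrable M (\<lambda>\<omega>. \<Sum>i<n. R i \<omega> * ?d i \<omega>)"
    unfolding R_def by (rule Bochner_Integration.integrable_sum) (rule step(1))
  have e2: "expectation (\<lambda>\<omega>. \<Sum>i<n. R i \<omega> * ?d i \<omega>) = 0"
    unfolding R_def by (simp only: Bochner_Integration.integral_sum[OF step(1)] step(2)) simp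
  have i3: "integrable M (\<lambda>\<omega>. 4 * (\<Sum>i<n. R i \<omega> * ?d i \<omega>))"
    by (rule integrable_mult_right) (rule i2)
  note i = Bochner_Integration.integrable_diff[OF i1 i3]
  have m: "(\<lambda>\<omega>. (R n \<omega>)\<^sup>2) \<in> borel_measurable M"
    using R_int by (auto dest: borel_measurable_integrable)
  show int: "integrable M (\<lambda>\<omega>. (R n \<omega>)\<^sup>2)"
    by (rule Bochner_Integration.integrable_bound[OF i m])
       (use le in \<open>auto intro: order_trans[OF _ abs_ge_self]\<close>)
  have "expectation (\<lambda>\<omega>. (R n \<omega>)\<^sup>2)
      \<le> expectation (\<lambda>\<omega>. 4 * (?S n \<omega>)\<^sup>2 - 4 * (\<Sum>i<n. R i \<omega> * ?d i \<omega>))"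
    by (rule integral_mono[OF int i le])
  also have "\<dots> = 4 * expectation (\<lambda>\<omega>. (?S n \<omega>)\<^sup>2)"
    unfolding Bochner_Integration.integral_diff[OF i1 i3] integral_mult_right_zero e2 by simp
  finally show "expectation (\<lambda>\<omega>. (R n \<omega>)\<^sup>2)
      \<le> 4 * (\<Sum>i<n. real CARD('m) * (t (Suc i) - t i) * expectation (\<lambda>\<omega>. (norm (h i \<omega>))\<^sup>2))"
    using scalar_sum_square(2)[of n] by linarith
qed

end

end

section \<open>Maximal inequality for vector-valued sums with drift\<close>

lemma matrix_vector_mult_nth: "(H *v w) $ c = H $ c \<bullet> (w :: real ^ 'm)"
  by (simp add: matrix_vector_mult_def inner_vec_def)

lemma norm_square_vec: "(norm (v :: 'b::real_normed_vector ^ 'd))\<^sup>2 = (\<Sum>c\<in>UNIV. (norm (v $ c))\<^sup>2)"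
  by (simp add: norm_vec_def L2_set_def sum_nonneg)

lemma borel_measurable_vec_nth_row:
  "(\<lambda>H :: real ^ 'm ^ 'd. H $ c) \<in> borel_measurable borel"
  by (intro borel_measurable_continuous_onI continuous_intros)

lemma borel_measurable_matrix_vector_mult [measurable (raw)]:
  fixes H :: "'a \<Rightarrow> real ^ 'm ^ 'd" and w :: "'a \<Rightarrow> real ^ 'm"
  assumes "H \<in> borel_measurable M" "w \<in> borel_measurable M"
  shows "(\<lambda>\<omega>. H \<omega> *v w \<omega>) \<in> borel_measurable M"
proof -
  have "continuous_on UNIV (\<lambda>p :: (real ^ 'm ^ 'd) \<times> (real ^ 'm). fst p *v snd p)"
    unfolding matrix_vector_mult_def by (intro continuous_intros)
  from borel_measurable_continuous_on[OF this, of "\<lambda>\<omega>. (H \<omega>, w \<omega>)"] show ?thesis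
    using assms by (simp add: borel_measurable_Pair)
qed

lemma expectation_le_if_nn_integral_le:
  assumes "integrable M f" "\<And>\<omega>. 0 \<le> f \<omega>" "0 \<le> A" "(\<integral>\<^sup>+\<omega>. ennreal (f \<omega>) \<partial>M) \<le> ennreal A"
  shows "integral\<^sup>L M f \<le> A"
  using nn_integral_eq_integral[OF assms(1)] assms(2-4) by (simp add: integral_nonneg_AE)

context brownian_filtration
begin

text \<open>The running maximum is one-sided, so every row is used with both signs, which turns
  Doob's 4 into 8. Summing over the rows rebuilds the norm of \<open>H\<close>, which is the
  Euclidean norm of all its entries.\<close>

lemma doob_vector:
  fixes t :: "nat \<Rightarrow> real" and H :: "nat \<Rightarrow> 'a \<Rightarrow> real ^ 'm ^ 'd"
  assumes t0: "0 \<le> t 0" and tS: "\<And>i. t i < t (Suc i)"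
    and H_adapted: "\<And>i. H i \<in> borel_measurable (F (t i))"
    and H_bound: "\<And>i \<omega>. norm (H i \<omega>) \<le> K"
    and A: "0 \<le> A" "\<And>i. i < n \<Longrightarrow> (\<integral>\<^sup>+\<omega>. ennreal ((norm (H i \<omega>))\<^sup>2) \<partial>M) \<le> ennreal A"
  shows "(\<integral>\<^sup>+\<omega>. (\<Squnion>k\<in>{..n}. ennreal ((norm (\<Sum>i<k. H i \<omega> *v (W (t (Suc i)) \<omega> - W (t i) \<omega>)))\<^sup>2)) \<partial>M)
    \<le> ennreal (8 * real CARD('m) * A * (t n - t 0))"
proof -
  let ?m = "real CARD('m)"
  let ?S = "\<lambda>k \<omega>. \<Sum>i<k. H i \<omega> *v (W (t (Suc i)) \<omega> - W (t i) \<omega>)"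
  define h where "h c i \<omega> = H i \<omega> $ c" for c i \<omega>
  have h_ad: "h c i \<in> borel_measurable (F (t i))" "(\<lambda>\<omega>. - h c i \<omega>) \<in> borel_measurable (F (t i))" for c i
    unfolding h_def using measurable_compose[OF H_adapted borel_measurable_vec_nth_row] by auto
  have h_bd: "norm (h c i \<omega>) \<le> K" "norm (- h c i \<omega>) \<le> K" for c i \<omega>
    using H_bound[of i \<omega>] Finite_Cartesian_Product.norm_nth_le[of "H i \<omega>" c] unfolding h_def by (auto intro: order_trans)
  define R where "R c \<omega> = running_max (\<lambda>j. scalar_sum t (h c) j \<omega>) n" for c \<omega>
  define R' where "R' c \<omega> = running_max (\<lambda>j. scalar_sum t (\<lambda>i \<omega>. - h c i \<omega>) j \<omega>) n" for c \<omega>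
  note RI = doob_scalar[of t "h _", OF t0 tS h_ad(1) h_bd(1), of _ n, folded R_def]
  note RI' = doob_scalar[of t "\<lambda>i \<omega>. - h _ i \<omega>", OF t0 tS h_ad(2) h_bd(2), of _ n, folded R'_def, unfolded norm_minus_cancel]
  define q where "q \<omega> = (\<Sum>c\<in>UNIV. (R c \<omega>)\<^sup>2 + (R' c \<omega>)\<^sup>2)" for \<omega>
  have q_nonneg: "0 \<le> q \<omega>" for \<omega>
    by (auto simp: q_def intro: sum_nonneg)
  note i2 = Bochner_Integration.integrable_add[OF RI(1) RI'(1)]
  have q_int: "integrable M q"
    unfolding q_def[abs_def] by (rule Bochner_Integration.integrable_sum) (rule i2)
  have h_int: "integrable M (\<lambda>\<omega>. (norm (h c i \<omega>))\<^sup>2)" for c i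
    by (rule bounded_square_integrable[of t "h c" K, OF t0 tS h_ad(1) h_bd(1)])
  have EH: "(\<Sum>c\<in>UNIV. expectation (\<lambda>\<omega>. (norm (h c i \<omega>))\<^sup>2)) \<le> A" if "i < n" for i
  proof -
    have eq: "(\<Sum>c\<in>UNIV. (norm (h c i \<omega>))\<^sup>2) = (norm (H i \<omega>))\<^sup>2" for \<omega>
      by (simp add: norm_square_vec h_def)
    have "(\<Sum>c\<in>UNIV. expectation (\<lambda>\<omega>. (norm (h c i \<omega>))\<^sup>2)) = expectation (\<lambda>\<omega>. (norm (H i \<omega>))\<^sup>2)"
      by (simp only: Bochner_Integration.integral_sum[OF h_int, symmetric] eq)
    also have "\<dots> \<le> A"
    proof (rule expectation_le_if_nn_integral_le)
      show "integrable M (\<lambda>\<omega>. (norm (H i \<omega>))\<^sup>2)"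
        unfolding eq[symmetric] by (rule Bochner_Integration.integrable_sum) (rule h_int)
    qed (use A that in auto)
    finally show ?thesis .
  qed
  have tel: "(\<Sum>i<n. t (Suc i) - t i) = t n - t 0"
    by (rule sum_lessThan_telescope)
  have "expectation q = (\<Sum>c\<in>UNIV. expectation (\<lambda>\<omega>. (R c \<omega>)\<^sup>2) + expectation (\<lambda>\<omega>. (R' c \<omega>)\<^sup>2))"
    unfolding q_def[abs_def]
    by (simp only: Bochner_Integration.integral_sum[OF i2] Bochner_Integration.integral_add[OF RI(1) RI'(1)])
  also have "\<dots> \<le> (\<Sum>c\<in>UNIV. 8 * (\<Sum>i<n. ?m * (t (Suc i) - t i) * expectation (\<lambda>\<omega>. (norm (h c i \<omega>))\<^sup>2)))"
    by (rule sum_mono) (use RI(2) RI'(2) in \<open>smt (verit)\<close>)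
  also have "\<dots> = 8 * (\<Sum>i<n. ?m * (t (Suc i) - t i) * (\<Sum>c\<in>UNIV. expectation (\<lambda>\<omega>. (norm (h c i \<omega>))\<^sup>2)))"
    unfolding sum_distrib_left by (subst sum.swap) simp
  also have "\<dots> \<le> 8 * (\<Sum>i<n. ?m * (t (Suc i) - t i) * A)"
    using EH tS by (intro mult_left_mono sum_mono mult_nonneg_nonneg) (auto intro: less_imp_le)
  also have "\<dots> = 8 * ?m * A * (t n - t 0)"
    unfolding tel[symmetric] by (simp add: sum_distrib_left mult_ac)
  finally have Eq: "expectation q \<le> 8 * ?m * A * (t n - t 0)" .
  have "(norm (?S k \<omega>))\<^sup>2 \<le> q \<omega>" if "k \<le> n" for k \<omega>
  proof -
    have nth: "?S k \<omega> $ c = scalar_sum t (h c) k \<omega>" for c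
      by (simp add: scalar_sum_def h_def matrix_vector_mult_nth del: vector_minus_component)
    have neg: "scalar_sum t (\<lambda>i \<omega>. - h c i \<omega>) k \<omega> = - scalar_sum t (h c) k \<omega>" for c
      by (simp add: scalar_sum_def sum_negf)
    have 1: "scalar_sum t (h c) k \<omega> \<le> R c \<omega>" for c
      unfolding R_def by (rule running_max_ge[OF _ that]) (simp add: scalar_sum_def)
    have 2: "- scalar_sum t (h c) k \<omega> \<le> R' c \<omega>" for c
      unfolding R'_def neg[symmetric] by (rule running_max_ge[OF _ that]) (simp add: scalar_sum_def)
    have "(scalar_sum t (h c) k \<omega>)\<^sup>2 \<le> (R c \<omega>)\<^sup>2 + (R' c \<omega>)\<^sup>2" for c
    proof (cases "0 \<le> scalar_sum t (h c) k \<omega>")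
      case True
      then show ?thesis using power_mono[OF 1[of c] True, of 2] by (simp add: add_increasing2)
    next
      case False
      then show ?thesis using power_mono[OF 2[of c], of 2] by (simp add: add_increasing)
    qed
    then show ?thesis
      unfolding q_def norm_square_vec nth by (intro sum_mono) simp
  qed
  then have "(\<integral>\<^sup>+\<omega>. (\<Squnion>k\<in>{..n}. ennreal ((norm (?S k \<omega>))\<^sup>2)) \<partial>M) \<le> (\<integral>\<^sup>+\<omega>. ennreal (q \<omega>) \<partial>M)"
    by (intro nn_integral_mono SUP_least ennreal_leI) auto
  also have "\<dots> = ennreal (expectation q)"
    using q_int q_nonneg by (intro nn_integral_eq_integral) auto
  also have "\<dots> \<le> ennreal (8 * ?m * A * (t n - t 0))"
    using Eq by (rule ennreal_leI)
  finally show ?thesis .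
qed

text \<open>The stochastic part is linear in the length \<open>real n * \<eta>\<close> by Doob's
  inequality; the drift is estimated pathwise by Cauchy-Schwarz and is quadratic in it. These
  different orders are what later balances \<open>ln N\<close> against \<open>(ln N)^2\<close>.
  Splitting the square of the sum doubles the constants to 16 and 2.\<close>

lemma grid_maximal_inequality:
  fixes H :: "nat \<Rightarrow> 'a \<Rightarrow> real ^ 'm ^ 'd" and \<beta> :: "nat \<Rightarrow> 'a \<Rightarrow> real ^ 'd"
  assumes s: "0 \<le> s" and \<eta>: "0 < \<eta>"
    and H_adapted: "\<And>i. H i \<in> borel_measurable (F (s + real i * \<eta>))"
    and H_bound: "\<And>i \<omega>. norm (H i \<omega>) \<le> K"
    and A: "0 \<le> A" "\<And>i. i < n \<Longrightarrow> (\<integral>\<^sup>+\<omega>. ennreal ((norm (H i \<omega>))\<^sup>2) \<partial>M) \<le> ennreal A"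
    and \<beta>_measurable: "\<And>i. \<beta> i \<in> borel_measurable M"
    and B: "0 \<le> B" "\<And>i. i < n \<Longrightarrow> (\<integral>\<^sup>+\<omega>. ennreal ((norm (\<beta> i \<omega>))\<^sup>2) \<partial>M) \<le> ennreal B"
  shows "(\<integral>\<^sup>+\<omega>. (\<Squnion>k\<in>{..n}. ennreal ((norm (\<Sum>i<k. H i \<omega> *v (W (s + real (Suc i) * \<eta>) \<omega> - W (s + real i * \<eta>) \<omega>)
        + \<eta> *\<^sub>R \<beta> i \<omega>))\<^sup>2)) \<partial>M)
    \<le> ennreal (16 * real CARD('m) * A * (real n * \<eta>) + 2 * B * (real n * \<eta>)\<^sup>2)"
proof -
  let ?S = "\<lambda>k \<omega>. \<Sum>i<k. H i \<omega> *v (W (s + real (Suc i) * \<eta>) \<omega> - W (s + real i * \<eta>) \<omega>)"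
  let ?D = "\<lambda>k \<omega>. \<Sum>i<k. \<eta> *\<^sub>R \<beta> i \<omega>"
  let ?q = "\<lambda>\<omega>. \<eta>\<^sup>2 * real n * (\<Sum>i<n. (norm (\<beta> i \<omega>))\<^sup>2)"
  have adapted_M: "H i \<in> borel_measurable M" for i by (rule measurable_F[OF H_adapted])
  have W_M: "W (s + real i * \<eta>) \<in> borel_measurable M" for i
    by (rule measurable_F[OF W_measurable]) (use s \<eta> in simp)
  have S_M: "?S k \<in> borel_measurable M" for k
    by (intro borel_measurable_sum borel_measurable_matrix_vector_mult borel_measurable_diff adapted_M W_M)
  have D: "(norm (?D k \<omega>))\<^sup>2 \<le> ?q \<omega>" if "k \<le> n" for k \<omega>
  proof -
    have "norm (?D k \<omega>) \<le> (\<Sum>i<k. \<eta> * norm (\<beta> i \<omega>))"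
      using \<eta> by (intro sum_norm_le) simp
    also have "\<dots> \<le> (\<Sum>i<n. \<eta> * norm (\<beta> i \<omega>))"
      using \<eta> that by (intro sum_mono2) auto
    finally have "(norm (?D k \<omega>))\<^sup>2 \<le> (\<Sum>i<n. \<eta> * norm (\<beta> i \<omega>))\<^sup>2"
      by (intro power_mono) auto
    also have "\<dots> \<le> (\<Sum>i<n. (\<eta> * norm (\<beta> i \<omega>))\<^sup>2) * real (card {..<n})"
      by (rule sum_squared_le_sum_of_squares)
    also have "\<dots> = ?q \<omega>"
      by (simp add: power_mult_distrib sum_distrib_left mult_ac)
    finally show ?thesis .
  qed
  have SD: "(norm (\<Sum>i<k. H i \<omega> *v (W (s + real (Suc i) * \<eta>) \<omega> - W (s + real i * \<eta>) \<omega>) + \<eta> *\<^sub>R \<beta> i \<omega>))\<^sup>2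
      \<le> 2 * (norm (?S k \<omega>))\<^sup>2 + 2 * ?q \<omega>" if "k \<le> n" for k \<omega>
  proof -
    have "(norm (?S k \<omega> + ?D k \<omega>))\<^sup>2 \<le> (norm (?S k \<omega>) + norm (?D k \<omega>))\<^sup>2"
      by (intro power_mono norm_triangle_ineq) auto
    also have "\<dots> \<le> 2 * (norm (?S k \<omega>))\<^sup>2 + 2 * (norm (?D k \<omega>))\<^sup>2"
      using sum_squares_bound[of "norm (?S k \<omega>)" "norm (?D k \<omega>)"] by (simp add: power2_sum)
    finally show ?thesis using D[OF that, of \<omega>] unfolding sum.distrib by linarith
  qed
  have "(\<integral>\<^sup>+\<omega>. (\<Squnion>k\<in>{..n}. ennreal ((norm (\<Sum>i<k. H i \<omega> *v (W (s + real (Suc i) * \<eta>) \<omega> - W (s + real i * \<eta>) \<omega>)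
        + \<eta> *\<^sub>R \<beta> i \<omega>))\<^sup>2)) \<partial>M)
     \<le> (\<integral>\<^sup>+\<omega>. 2 * (\<Squnion>k\<in>{..n}. ennreal ((norm (?S k \<omega>))\<^sup>2)) + ennreal (2 * \<eta>\<^sup>2 * real n) * (\<Sum>i<n. ennreal ((norm (\<beta> i \<omega>))\<^sup>2)) \<partial>M)"
  proof (intro nn_integral_mono SUP_least)
    fix \<omega> k assume k: "k \<in> {..n}"
    have "ennreal ((norm (\<Sum>i<k. H i \<omega> *v (W (s + real (Suc i) * \<eta>) \<omega> - W (s + real i * \<eta>) \<omega>) + \<eta> *\<^sub>R \<beta> i \<omega>))\<^sup>2)
      \<le> ennreal (2 * (norm (?S k \<omega>))\<^sup>2 + 2 * ?q \<omega>)"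
      using SD k by (intro ennreal_leI) auto
    also have "\<dots> = 2 * ennreal ((norm (?S k \<omega>))\<^sup>2) + ennreal (2 * \<eta>\<^sup>2 * real n) * (\<Sum>i<n. ennreal ((norm (\<beta> i \<omega>))\<^sup>2))"
      by (simp add: ennreal_mult sum_nonneg mult_ac flip: sum_ennreal)
    also have "\<dots> \<le> 2 * (\<Squnion>k\<in>{..n}. ennreal ((norm (?S k \<omega>))\<^sup>2)) + ennreal (2 * \<eta>\<^sup>2 * real n) * (\<Sum>i<n. ennreal ((norm (\<beta> i \<omega>))\<^sup>2))"
      using k by (intro add_right_mono mult_left_mono SUP_upper) auto
    finally show "ennreal ((norm (\<Sum>i<k. H i \<omega> *v (W (s + real (Suc i) * \<eta>) \<omega> - W (s + real i * \<eta>) \<omega>) + \<eta> *\<^sub>R \<beta> i \<omega>))\<^sup>2) \<le> \<dots>" .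
  qed
  also have "\<dots> = 2 * (\<integral>\<^sup>+\<omega>. (\<Squnion>k\<in>{..n}. ennreal ((norm (?S k \<omega>))\<^sup>2)) \<partial>M)
      + ennreal (2 * \<eta>\<^sup>2 * real n) * (\<Sum>i<n. \<integral>\<^sup>+\<omega>. ennreal ((norm (\<beta> i \<omega>))\<^sup>2) \<partial>M)"
  proof -
    have sq: "(\<lambda>z :: real ^ 'd. ennreal ((norm z)\<^sup>2)) \<in> borel_measurable borel" by measurable
    have 1: "(\<lambda>\<omega>. \<Squnion>k\<in>{..n}. ennreal ((norm (?S k \<omega>))\<^sup>2)) \<in> borel_measurable M"
      by (intro borel_measurable_SUP measurable_compose[OF S_M sq]) auto
    have 2: "(\<lambda>\<omega>. ennreal ((norm (\<beta> i \<omega>))\<^sup>2)) \<in> borel_measurable M" for i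
      by (rule measurable_compose[OF \<beta>_measurable sq])
    note 3 = borel_measurable_sum[of "{..<n}", OF 2]
    show ?thesis
      by (simp only: nn_integral_add[OF borel_measurable_times_ennreal[OF borel_measurable_const 1]
            borel_measurable_times_ennreal[OF borel_measurable_const 3]]
          nn_integral_cmult[OF 1] nn_integral_cmult[OF 3] nn_integral_sum[OF 2])
  qed
  also have "\<dots> \<le> 2 * ennreal (8 * real CARD('m) * A * (real n * \<eta>)) + ennreal (2 * \<eta>\<^sup>2 * real n) * (\<Sum>i<n. ennreal B)"
  proof (intro add_mono mult_left_mono sum_mono)
    show "(\<integral>\<^sup>+\<omega>. (\<Squnion>k\<in>{..n}. ennreal ((norm (?S k \<omega>))\<^sup>2)) \<partial>M) \<le> ennreal (8 * real CARD('m) * A * (real n * \<eta>))"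
      using doob_vector[of "\<lambda>i. s + real i * \<eta>" H K A n] assms by simp
  qed (use B in auto)
  also have "\<dots> = ennreal (16 * real CARD('m) * A * (real n * \<eta>) + 2 * B * (real n * \<eta>)\<^sup>2)"
  proof -
    have "2 * ennreal (8 * real CARD('m) * A * (real n * \<eta>)) = ennreal (16 * real CARD('m) * A * (real n * \<eta>))"
      using A(1) \<eta> by (subst ennreal_numeral[symmetric], subst ennreal_mult[symmetric]) auto
    moreover have "ennreal (2 * \<eta>\<^sup>2 * real n) * (\<Sum>i<n. ennreal B) = ennreal (2 * B * (real n * \<eta>)\<^sup>2)"
    proof -
      have "(\<Sum>i<n. ennreal B) = ennreal (real n * B)"
        using B(1) by (simp add: ennreal_of_nat_eq_real_of_nat ennreal_mult)
      then have "ennreal (2 * \<eta>\<^sup>2 * real n) * (\<Sum>i<n. ennreal B) = ennreal ((2 * \<eta>\<^sup>2 * real n) * (real n * B))"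
        using B(1) by (simp only:) (rule ennreal_mult[symmetric], simp_all)
      also have "(2 * \<eta>\<^sup>2 * real n) * (real n * B) = 2 * B * (real n * \<eta>)\<^sup>2"
        by (simp add: power2_eq_square)
      finally show ?thesis .
    qed
    ultimately show ?thesis
      using A(1) B(1) \<eta> by (simp only:) (subst ennreal_plus[symmetric]; simp)
  qed
  finally show ?thesis .
qed

end

section \<open>Limits in probability\<close>

context prob_space
begin

definition tends_in_prob :: "(nat \<Rightarrow> 'a \<Rightarrow> 'b::{second_countable_topology,banach}) \<Rightarrow> ('a \<Rightarrow> 'b) \<Rightarrow> bool" where
  "tends_in_prob Z L \<longleftrightarrow>
    (\<forall>e>0. (\<lambda>N. prob {\<omega>\<in>space M. norm (Z N \<omega> - L \<omega>) > e}) \<longlonglongrightarrow> 0)"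

lemma tends_in_prob_diff:
  assumes [measurable]: "\<And>N. Z N \<in> borel_measurable M" "\<And>N. Z' N \<in> borel_measurable M"
      "L \<in> borel_measurable M" "L' \<in> borel_measurable M"
    and Z: "tends_in_prob Z L" and Z': "tends_in_prob Z' L'"
  shows "tends_in_prob (\<lambda>N \<omega>. Z N \<omega> - Z' N \<omega>) (\<lambda>\<omega>. L \<omega> - L' \<omega>)"
  unfolding tends_in_prob_def
proof (intro allI impI)
  fix e :: real assume e: "e > 0"
  let ?p = "\<lambda>N. prob {\<omega>\<in>space M. norm (Z N \<omega> - L \<omega>) > e / 2}"
  let ?p' = "\<lambda>N. prob {\<omega>\<in>space M. norm (Z' N \<omega> - L' \<omega>) > e / 2}"
  have lim: "(\<lambda>N. ?p N + ?p' N) \<longlonglongrightarrow> 0"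
    using tendsto_add[OF Z[unfolded tends_in_prob_def, rule_format, of "e / 2"]
        Z'[unfolded tends_in_prob_def, rule_format, of "e / 2"]] e by simp
  have le: "prob {\<omega>\<in>space M. norm ((Z N \<omega> - Z' N \<omega>) - (L \<omega> - L' \<omega>)) > e} \<le> ?p N + ?p' N" for N
  proof -
    have "{\<omega>\<in>space M. norm ((Z N \<omega> - Z' N \<omega>) - (L \<omega> - L' \<omega>)) > e}
      \<subseteq> {\<omega>\<in>space M. norm (Z N \<omega> - L \<omega>) > e / 2} \<union> {\<omega>\<in>space M. norm (Z' N \<omega> - L' \<omega>) > e / 2}"
    proof safe
      fix \<omega> assume h: "e < norm ((Z N \<omega> - Z' N \<omega>) - (L \<omega> - L' \<omega>))" "\<not> e / 2 < norm (Z' N \<omega> - L' \<omega>)"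
      have "norm ((Z N \<omega> - Z' N \<omega>) - (L \<omega> - L' \<omega>)) \<le> norm (Z N \<omega> - L \<omega>) + norm (Z' N \<omega> - L' \<omega>)"
        using norm_triangle_ineq4[of "Z N \<omega> - L \<omega>" "Z' N \<omega> - L' \<omega>"] by (simp add: algebra_simps)
      with h show "e / 2 < norm (Z N \<omega> - L \<omega>)" by linarith
    qed
    then have "prob {\<omega>\<in>space M. norm ((Z N \<omega> - Z' N \<omega>) - (L \<omega> - L' \<omega>)) > e}
      \<le> prob ({\<omega>\<in>space M. norm (Z N \<omega> - L \<omega>) > e / 2} \<union> {\<omega>\<in>space M. norm (Z' N \<omega> - L' \<omega>) > e / 2})"
      by (rule finite_measure_mono) measurable
    also have "\<dots> \<le> ?p N + ?p' N" by (rule measure_Un_le) measurable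
    finally show ?thesis .
  qed
  show "(\<lambda>N. prob {\<omega>\<in>space M. norm ((Z N \<omega> - Z' N \<omega>) - (L \<omega> - L' \<omega>)) > e}) \<longlonglongrightarrow> 0"
    by (rule tendsto_sandwich[OF _ _ tendsto_const lim]) (use le in auto)
qed

text \<open>Truncation at 1 makes the distances uniformly bounded, so convergence in probability
  becomes convergence in L1, from which almost surely convergent subsequences can be
  extracted.\<close>

lemma tends_in_prob_min_L1:
  assumes [measurable]: "\<And>N. Z N \<in> borel_measurable M" "L \<in> borel_measurable M"
    and Z: "tends_in_prob Z L"
  shows "(\<lambda>N. expectation (\<lambda>\<omega>. min 1 (norm (Z N \<omega> - L \<omega>)))) \<longlonglongrightarrow> 0"
proof (rule LIMSEQ_I)
  fix r :: real assume r: "r > 0"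
  let ?p = "\<lambda>N. prob {\<omega>\<in>space M. norm (Z N \<omega> - L \<omega>) > r / 2}"
  have "?p \<longlonglongrightarrow> 0" using Z[unfolded tends_in_prob_def, rule_format, of "r / 2"] r by simp
  then obtain N0 where N0: "\<And>N. N \<ge> N0 \<Longrightarrow> ?p N < r / 2"
    using LIMSEQ_D[of ?p 0 "r / 2"] r by auto
  have int: "integrable M (\<lambda>\<omega>. min 1 (norm (Z N \<omega> - L \<omega>)))" for N
    by (rule integrable_const_bound[of _ 1]) auto
  show "\<exists>no. \<forall>n\<ge>no. norm (expectation (\<lambda>\<omega>. min 1 (norm (Z n \<omega> - L \<omega>))) - 0) < r"
  proof (intro exI[of _ N0] allI impI)
    fix N assume "N \<ge> N0"
    let ?A = "{\<omega>\<in>space M. norm (Z N \<omega> - L \<omega>) > r / 2}"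
    have int2: "integrable M (\<lambda>\<omega>. r / 2 + indicator ?A \<omega> :: real)"
      by (intro Bochner_Integration.integrable_add integrable_const integrable_real_indicator)
         (auto simp: emeasure_eq_measure)
    have "expectation (\<lambda>\<omega>. min 1 (norm (Z N \<omega> - L \<omega>))) \<le> expectation (\<lambda>\<omega>. r / 2 + indicator ?A \<omega>)"
      by (rule integral_mono[OF int int2]) (use r in \<open>auto simp: indicator_def min_def\<close>)
    also have "\<dots> = r / 2 + ?p N"
      by (subst Bochner_Integration.integral_add) (auto simp: emeasure_eq_measure prob_space)
    also have "\<dots> < r" using N0[OF \<open>N \<ge> N0\<close>] by simp
    finally show "norm (expectation (\<lambda>\<omega>. min 1 (norm (Z N \<omega> - L \<omega>))) - 0) < r"
      by (simp add: integral_nonneg_AE)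
  qed
qed

text \<open>Dominated convergence for the indicators of the exceptional sets.\<close>

lemma pointwise_imp_tends_in_prob:
  assumes [measurable]: "\<And>N. Z N \<in> borel_measurable M" "L \<in> borel_measurable M"
    and lim: "\<And>\<omega>. \<omega> \<in> space M \<Longrightarrow> (\<lambda>N. Z N \<omega>) \<longlonglongrightarrow> L \<omega>"
  shows "tends_in_prob Z L"
  unfolding tends_in_prob_def
proof (intro allI impI)
  fix e :: real assume e: "e > 0"
  let ?A = "\<lambda>N. {\<omega>\<in>space M. norm (Z N \<omega> - L \<omega>) > e}"
  have "(\<lambda>N. expectation (indicator (?A N) :: _ \<Rightarrow> real)) \<longlonglongrightarrow> expectation (\<lambda>_. 0)"
  proof (rule integral_dominated_convergence[where w = "\<lambda>_. 1"])
    show "AE \<omega> in M. (\<lambda>N. indicator (?A N) \<omega> :: real) \<longlonglongrightarrow> 0"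
    proof (rule AE_I2)
      fix \<omega> assume "\<omega> \<in> space M"
      from LIMSEQ_D[OF lim[OF this] e]
      have "eventually (\<lambda>N. indicator (?A N) \<omega> = (0::real)) sequentially"
        unfolding eventually_sequentially by (fastforce simp: indicator_def)
      then show "(\<lambda>N. indicator (?A N) \<omega> :: real) \<longlonglongrightarrow> 0"
        by (rule tendsto_eventually)
    qed
  qed (auto simp: indicator_def)
  then show "(\<lambda>N. prob (?A N)) \<longlonglongrightarrow> 0"
    by simp
qed

text \<open>Fatou's lemma wants almost sure convergence, along one subsequence for all
  \<open>k\<close> at once. Summing the truncated distances over the finite set \<open>I\<close>
  provides it; once a truncated distance is below 1, it is the distance itself.\<close>

lemma fatou_in_prob:
  assumes I: "finite I"
    and Z_M [measurable]: "\<And>k N. Z k N \<in> borel_measurable M" and L_M [measurable]: "\<And>k. L k \<in> borel_measurable M"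
    and Z: "\<And>k. k \<in> I \<Longrightarrow> tends_in_prob (Z k) (L k)"
    and Q: "\<And>N. (\<integral>\<^sup>+\<omega>. (\<Squnion>k\<in>I. ennreal ((norm (Z k N \<omega>))\<^sup>2)) \<partial>M) \<le> Q"
  shows "(\<integral>\<^sup>+\<omega>. (\<Squnion>k\<in>I. ennreal ((norm (L k \<omega>))\<^sup>2)) \<partial>M) \<le> Q"
proof -
  let ?e = "\<lambda>N \<omega>. \<Sum>k\<in>I. min 1 (norm (Z k N \<omega> - L k \<omega>))"
  have int: "integrable M (\<lambda>\<omega>. min 1 (norm (Z k N \<omega> - L k \<omega>)))" for k N
    by (rule integrable_const_bound[of _ 1]) auto
  have "(\<lambda>N. \<Sum>k\<in>I. expectation (\<lambda>\<omega>. min 1 (norm (Z k N \<omega> - L k \<omega>)))) \<longlonglongrightarrow> (\<Sum>k\<in>I. 0)"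
    by (intro tendsto_sum tends_in_prob_min_L1 Z) auto
  then have "(\<lambda>N. expectation (\<lambda>\<omega>. norm (?e N \<omega>))) \<longlonglongrightarrow> 0"
    by (simp add: sum_nonneg Bochner_Integration.integral_sum[OF int])
  then obtain r where r: "strict_mono r" "AE \<omega> in M. (\<lambda>N. ?e (r N) \<omega>) \<longlonglongrightarrow> 0"
    using tendsto_L1_AE_subseq[of M ?e] int by auto
  have "AE \<omega> in M. (\<Squnion>k\<in>I. ennreal ((norm (L k \<omega>))\<^sup>2))
      \<le> liminf (\<lambda>N. \<Squnion>k\<in>I. ennreal ((norm (Z k (r N) \<omega>))\<^sup>2))"
    using r(2)
  proof eventually_elim
    fix \<omega> assume e: "(\<lambda>N. ?e (r N) \<omega>) \<longlonglongrightarrow> 0"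
    show "(\<Squnion>k\<in>I. ennreal ((norm (L k \<omega>))\<^sup>2)) \<le> liminf (\<lambda>N. \<Squnion>k\<in>I. ennreal ((norm (Z k (r N) \<omega>))\<^sup>2))"
    proof (rule SUP_least)
      fix k assume k: "k \<in> I"
      have "(\<lambda>N. min 1 (norm (Z k (r N) \<omega> - L k \<omega>))) \<longlonglongrightarrow> 0"
      proof (rule tendsto_sandwich[OF _ _ tendsto_const e])
        show "\<forall>\<^sub>F N in sequentially. min 1 (norm (Z k (r N) \<omega> - L k \<omega>)) \<le> ?e (r N) \<omega>"
          using k I by (intro always_eventually allI member_le_sum) auto
      qed auto
      then have "\<forall>\<^sub>F N in sequentially. min 1 (norm (Z k (r N) \<omega> - L k \<omega>)) < 1"
        by (rule order_tendstoD) simp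
      then have "\<forall>\<^sub>F N in sequentially. min 1 (norm (Z k (r N) \<omega> - L k \<omega>)) = norm (Z k (r N) \<omega> - L k \<omega>)"
        by eventually_elim (auto simp: min_def split: if_splits)
      from tendsto_cong[THEN iffD1, OF this \<open>(\<lambda>N. min 1 (norm (Z k (r N) \<omega> - L k \<omega>))) \<longlonglongrightarrow> 0\<close>]
      have "(\<lambda>N. Z k (r N) \<omega>) \<longlonglongrightarrow> L k \<omega>"
        by (subst LIM_zero_iff[symmetric]) (rule tendsto_norm_zero_cancel)
      then have "(\<lambda>N. ennreal ((norm (Z k (r N) \<omega>))\<^sup>2)) \<longlonglongrightarrow> ennreal ((norm (L k \<omega>))\<^sup>2)"
        by (intro tendsto_ennrealI tendsto_intros)
      then have "ennreal ((norm (L k \<omega>))\<^sup>2) = liminf (\<lambda>N. ennreal ((norm (Z k (r N) \<omega>))\<^sup>2))"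
        by (intro lim_imp_Liminf[symmetric]) simp
      also have "\<dots> \<le> liminf (\<lambda>N. \<Squnion>k\<in>I. ennreal ((norm (Z k (r N) \<omega>))\<^sup>2))"
        using k by (intro Liminf_mono always_eventually allI SUP_upper)
      finally show "ennreal ((norm (L k \<omega>))\<^sup>2) \<le> \<dots>" .
    qed
  qed
  then have "(\<integral>\<^sup>+\<omega>. (\<Squnion>k\<in>I. ennreal ((norm (L k \<omega>))\<^sup>2)) \<partial>M)
      \<le> (\<integral>\<^sup>+\<omega>. liminf (\<lambda>N. \<Squnion>k\<in>I. ennreal ((norm (Z k (r N) \<omega>))\<^sup>2)) \<partial>M)"
    by (rule nn_integral_mono_AE)
  also have "\<dots> \<le> liminf (\<lambda>N. \<integral>\<^sup>+\<omega>. (\<Squnion>k\<in>I. ennreal ((norm (Z k (r N) \<omega>))\<^sup>2)) \<partial>M)"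
    using I by (intro nn_integral_liminf borel_measurable_SUP) (auto simp: countable_finite)
  also have "\<dots> \<le> liminf (\<lambda>_. Q)"
    using Q by (intro Liminf_mono) auto
  finally show ?thesis by (simp add: Liminf_const)
qed

end

section \<open>Ito processes on dyadic times\<close>

definition dyadics :: "real set" where
  "dyadics = {real k / 2 ^ N |k N. True}"

lemma dyadicsI: "real k / 2 ^ N \<in> dyadics"
  by (auto simp: dyadics_def)

lemma dyadics_nonneg: "u \<in> dyadics \<Longrightarrow> 0 \<le> u"
  by (auto simp: dyadics_def)

text \<open>Keeps suprema over dyadic times measurable.\<close>

lemma countable_dyadics: "countable dyadics"
proof -
  have "dyadics = (\<lambda>(k, N). real k / 2 ^ N) ` (UNIV :: (nat \<times> nat) set)"
    by (auto simp: dyadics_def)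
  then show ?thesis by (metis countable_image countableI_type)
qed

context brownian_filtration
begin

definition dyadic_sum :: "(real \<Rightarrow> 'a \<Rightarrow> real ^ 'm ^ 'd) \<Rightarrow> (real \<Rightarrow> 'a \<Rightarrow> real ^ 'd) \<Rightarrow> nat \<Rightarrow> nat \<Rightarrow> 'a \<Rightarrow> real ^ 'd" where
  "dyadic_sum H \<beta> N k \<omega> = (\<Sum>i<k. H (real i / 2 ^ N) \<omega> *v (W (real (Suc i) / 2 ^ N) \<omega> - W (real i / 2 ^ N) \<omega>)
      + (1 / 2 ^ N) *\<^sub>R \<beta> (real i / 2 ^ N) \<omega>)"

text \<open>Stands for \<open>dU = H dW + \<beta> dt\<close>, reduced to what the estimates consume.
  The grid of mesh \<open>1 / 2 ^ (q + N)\<close> has \<open>k * 2 ^ N\<close> cells in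
  \<open>[0, k / 2 ^ q]\<close>, so all times of level \<open>q\<close> share their grids and
  differences of two such limits are again limits of sums.\<close>

definition ito_process :: "(real \<Rightarrow> 'a \<Rightarrow> real ^ 'd) \<Rightarrow> (real \<Rightarrow> 'a \<Rightarrow> real ^ 'm ^ 'd) \<Rightarrow> (real \<Rightarrow> 'a \<Rightarrow> real ^ 'd) \<Rightarrow> bool" where
  "ito_process U H \<beta> \<longleftrightarrow>
    (\<forall>t\<ge>0. U t \<in> borel_measurable M \<and> H t \<in> borel_measurable (F t) \<and> \<beta> t \<in> borel_measurable M) \<and>
    (\<exists>K. \<forall>t \<omega>. norm (H t \<omega>) \<le> K) \<and>
    (\<forall>q k. tends_in_prob (\<lambda>N. dyadic_sum H \<beta> (q + N) (k * 2 ^ N)) (\<lambda>\<omega>. U (real k / 2 ^ q) \<omega> - U 0 \<omega>))"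

lemma dyadic_sum_measurable:
  assumes "\<And>t. 0 \<le> t \<Longrightarrow> H t \<in> borel_measurable M" "\<And>t. 0 \<le> t \<Longrightarrow> \<beta> t \<in> borel_measurable M"
  shows "dyadic_sum H \<beta> N k \<in> borel_measurable M"
  unfolding dyadic_sum_def[abs_def]
  by (intro borel_measurable_sum borel_measurable_add borel_measurable_matrix_vector_mult
      increment_measurable borel_measurable_scaleR borel_measurable_const assms) auto

text \<open>Puts an increment into the shape of \<open>grid_maximal_inequality\<close>, with start
  \<open>real j / 2 ^ N\<close> and mesh \<open>1 / 2 ^ N\<close>.\<close>

lemma dyadic_sum_shift:
  "dyadic_sum H \<beta> N (j + k) \<omega> - dyadic_sum H \<beta> N j \<omega> =
    (\<Sum>i<k. H (real j / 2 ^ N + real i * (1 / 2 ^ N)) \<omega>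
        *v (W (real j / 2 ^ N + real (Suc i) * (1 / 2 ^ N)) \<omega> - W (real j / 2 ^ N + real i * (1 / 2 ^ N)) \<omega>)
      + (1 / 2 ^ N) *\<^sub>R \<beta> (real j / 2 ^ N + real i * (1 / 2 ^ N)) \<omega>)"
proof (induction k)
  case (Suc k)
  have eq: "real j / 2 ^ N + real i * (1 / 2 ^ N) = real (j + i) / 2 ^ N" for i
    by (simp add: add_divide_distrib)
  have "dyadic_sum H \<beta> N (j + Suc k) \<omega> - dyadic_sum H \<beta> N j \<omega>
      = (dyadic_sum H \<beta> N (j + k) \<omega> - dyadic_sum H \<beta> N j \<omega>)
        + (H (real (j + k) / 2 ^ N) \<omega> *v (W (real (j + Suc k) / 2 ^ N) \<omega> - W (real (j + k) / 2 ^ N) \<omega>)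
          + (1 / 2 ^ N) *\<^sub>R \<beta> (real (j + k) / 2 ^ N) \<omega>)"
    by (simp add: dyadic_sum_def)
  then show ?case unfolding Suc eq sum.lessThan_Suc .
qed simp

text \<open>Linearity is what makes the error of the scheme an Ito process whose coefficients are
  differences of \<open>\<sigma>\<close> and of \<open>b\<close>.\<close>

lemma ito_process_diff:
  assumes "ito_process U H \<beta>" "ito_process U' H' \<beta>'"
  shows "ito_process (\<lambda>t \<omega>. U t \<omega> - U' t \<omega>) (\<lambda>t \<omega>. H t \<omega> - H' t \<omega>) (\<lambda>t \<omega>. \<beta> t \<omega> - \<beta>' t \<omega>)"
proof -
  have HM: "0 \<le> t \<Longrightarrow> H t \<in> borel_measurable M" "0 \<le> t \<Longrightarrow> H' t \<in> borel_measurable M" for t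
    using assms by (auto simp: ito_process_def intro: measurable_F)
  note M = assms(1)[unfolded ito_process_def, THEN conjunct1, rule_format]
    assms(2)[unfolded ito_process_def, THEN conjunct1, rule_format]
  from assms obtain K K' where K: "\<And>t \<omega>. norm (H t \<omega>) \<le> K" "\<And>t \<omega>. norm (H' t \<omega>) \<le> K'"
    unfolding ito_process_def by blast
  have eq: "dyadic_sum (\<lambda>t \<omega>. H t \<omega> - H' t \<omega>) (\<lambda>t \<omega>. \<beta> t \<omega> - \<beta>' t \<omega>) N k \<omega>
      = dyadic_sum H \<beta> N k \<omega> - dyadic_sum H' \<beta>' N k \<omega>" for N k \<omega>
    unfolding dyadic_sum_def sum_subtractf[symmetric]
    by (intro sum.cong) (simp_all add: matrix_vector_mult_diff_rdistrib algebra_simps)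
  show ?thesis unfolding ito_process_def
  proof (intro conjI allI impI)
    show "\<exists>K. \<forall>t \<omega>. norm (H t \<omega> - H' t \<omega>) \<le> K"
      using K by (intro exI[of _ "K + K'"] allI) (meson add_mono norm_triangle_le_diff)
    fix q k
    have "tends_in_prob (\<lambda>N \<omega>. dyadic_sum H \<beta> (q + N) (k * 2 ^ N) \<omega> - dyadic_sum H' \<beta>' (q + N) (k * 2 ^ N) \<omega>)
        (\<lambda>\<omega>. (U (real k / 2 ^ q) \<omega> - U 0 \<omega>) - (U' (real k / 2 ^ q) \<omega> - U' 0 \<omega>))"
      using assms by (intro tends_in_prob_diff dyadic_sum_measurable borel_measurable_diff HM)
        (auto simp: ito_process_def)
    then show "tends_in_prob (\<lambda>N. dyadic_sum (\<lambda>t \<omega>. H t \<omega> - H' t \<omega>) (\<lambda>t \<omega>. \<beta> t \<omega> - \<beta>' t \<omega>) (q + N) (k * 2 ^ N))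
        (\<lambda>\<omega>. U (real k / 2 ^ q) \<omega> - U' (real k / 2 ^ q) \<omega> - (U 0 \<omega> - U' 0 \<omega>))"
      unfolding eq by (simp add: algebra_simps)
  qed (use M in \<open>auto intro!: borel_measurable_diff\<close>)
qed

text \<open>Two limits are taken. At a fixed level \<open>p\<close> only finitely many times occur,
  and Fatou's lemma in probability passes from the sums on ever finer grids to \<open>U\<close>.
  Then \<open>p\<close> increases: the nested grids exhaust the dyadic times, and monotone
  convergence applies. The coefficients are bounded only before the right end point because the sums
  sample left end points of cells.\<close>

lemma ito_process_maximal_inequality:
  fixes U :: "real \<Rightarrow> 'a \<Rightarrow> real ^ 'd"
  assumes U: "ito_process U H \<beta>" and ac: "a \<le> c" and AB: "0 \<le> A" "0 \<le> B"
    and HA: "\<And>v. v \<in> dyadics \<Longrightarrow> real a / 2 ^ q \<le> v \<Longrightarrow> v < real c / 2 ^ q \<Longrightarrow>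
      (\<integral>\<^sup>+\<omega>. ennreal ((norm (H v \<omega>))\<^sup>2) \<partial>M) \<le> ennreal A"
    and \<beta>B: "\<And>v. v \<in> dyadics \<Longrightarrow> real a / 2 ^ q \<le> v \<Longrightarrow> v < real c / 2 ^ q \<Longrightarrow>
      (\<integral>\<^sup>+\<omega>. ennreal ((norm (\<beta> v \<omega>))\<^sup>2) \<partial>M) \<le> ennreal B"
  defines "\<tau> \<equiv> (real c - real a) / 2 ^ q"
  shows "(\<integral>\<^sup>+\<omega>. (\<Squnion>u\<in>dyadics \<inter> {real a / 2 ^ q..real c / 2 ^ q}.
      ennreal ((norm (U u \<omega> - U (real a / 2 ^ q) \<omega>))\<^sup>2)) \<partial>M)
    \<le> ennreal (16 * real CARD('m) * A * \<tau> + 2 * B * \<tau>\<^sup>2)" (is "_ \<le> ?Q")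
proof -
  have UM: "0 \<le> t \<Longrightarrow> U t \<in> borel_measurable M" and HF: "0 \<le> t \<Longrightarrow> H t \<in> borel_measurable (F t)"
    and \<beta>M: "0 \<le> t \<Longrightarrow> \<beta> t \<in> borel_measurable M" for t
    using U by (auto simp: ito_process_def)
  have HM: "0 \<le> t \<Longrightarrow> H t \<in> borel_measurable M" for t
    using HF by (rule measurable_F)
  have lim: "tends_in_prob (\<lambda>N. dyadic_sum H \<beta> (q + N) (k * 2 ^ N)) (\<lambda>\<omega>. U (real k / 2 ^ q) \<omega> - U 0 \<omega>)" for q k
    using U by (auto simp: ito_process_def)
  obtain K where K: "\<And>t \<omega>. norm (H t \<omega>) \<le> K"
    using U by (auto simp: ito_process_def)
  let ?s = "real a / 2 ^ q"
  let ?I = "\<lambda>p. {a * 2 ^ p..c * 2 ^ p}"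
  let ?f = "\<lambda>p \<omega>. \<Squnion>k\<in>?I p. ennreal ((norm (U (real k / 2 ^ (q + p)) \<omega> - U ?s \<omega>))\<^sup>2)"
  have level: "(\<integral>\<^sup>+\<omega>. ?f p \<omega> \<partial>M) \<le> ?Q" for p
  proof (rule fatou_in_prob[where Z = "\<lambda>k N \<omega>. dyadic_sum H \<beta> (q + p + N) (k * 2 ^ N) \<omega>
        - dyadic_sum H \<beta> (q + p + N) (a * 2 ^ p * 2 ^ N) \<omega>"])
    fix k
    have s: "real (a * 2 ^ p) / 2 ^ (q + p) = ?s" by (simp add: power_add)
    have "tends_in_prob (\<lambda>N \<omega>. dyadic_sum H \<beta> (q + p + N) (k * 2 ^ N) \<omega> - dyadic_sum H \<beta> (q + p + N) (a * 2 ^ p * 2 ^ N) \<omega>)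
       (\<lambda>\<omega>. (U (real k / 2 ^ (q + p)) \<omega> - U 0 \<omega>) - (U ?s \<omega> - U 0 \<omega>))"
      using lim[of "q + p" "a * 2 ^ p", unfolded s]
      by (intro tends_in_prob_diff dyadic_sum_measurable HM \<beta>M borel_measurable_diff UM lim) auto
    then show "tends_in_prob (\<lambda>N \<omega>. dyadic_sum H \<beta> (q + p + N) (k * 2 ^ N) \<omega> - dyadic_sum H \<beta> (q + p + N) (a * 2 ^ p * 2 ^ N) \<omega>)
       (\<lambda>\<omega>. U (real k / 2 ^ (q + p)) \<omega> - U ?s \<omega>)"
      by simp
  next
    fix N
    let ?\<eta> = "1 / 2 ^ (q + p + N) :: real"
    let ?n = "(c - a) * 2 ^ (p + N)"
    have n\<eta>: "real ?n * ?\<eta> = \<tau>" using ac by (simp add: \<tau>_def power_add of_nat_diff)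
    let ?g = "\<lambda>j \<omega>. \<Sum>i<j. H (?s + real i * ?\<eta>) \<omega> *v (W (?s + real (Suc i) * ?\<eta>) \<omega> - W (?s + real i * ?\<eta>) \<omega>)
        + ?\<eta> *\<^sub>R \<beta> (?s + real i * ?\<eta>) \<omega>"
    have s: "real (a * 2 ^ p * 2 ^ N) / 2 ^ (q + p + N) = ?s" by (simp add: power_add)
    have "(\<integral>\<^sup>+\<omega>. (\<Squnion>j\<in>{..?n}. ennreal ((norm (?g j \<omega>))\<^sup>2)) \<partial>M)
        \<le> ennreal (16 * real CARD('m) * A * (real ?n * ?\<eta>) + 2 * B * (real ?n * ?\<eta>)\<^sup>2)"
    proof (rule grid_maximal_inequality)
      fix i assume i: "i < ?n"
      have "?s + real i * ?\<eta> = real (a * 2 ^ p * 2 ^ N + i) / 2 ^ (q + p + N)"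
        by (simp add: s[symmetric] add_divide_distrib)
      then have d: "?s + real i * ?\<eta> \<in> dyadics" by (simp only: dyadicsI)
      have "real i * ?\<eta> < real ?n * ?\<eta>" using i by (intro mult_strict_right_mono) (simp_all only: of_nat_less_iff, simp)
      then have le: "?s + real i * ?\<eta> < real c / 2 ^ q"
        unfolding n\<eta> by (simp add: \<tau>_def diff_divide_distrib)
      show "(\<integral>\<^sup>+\<omega>. ennreal ((norm (H (?s + real i * ?\<eta>) \<omega>))\<^sup>2) \<partial>M) \<le> ennreal A"
        by (rule HA[OF d _ le]) simp
      show "(\<integral>\<^sup>+\<omega>. ennreal ((norm (\<beta> (?s + real i * ?\<eta>) \<omega>))\<^sup>2) \<partial>M) \<le> ennreal B"
        by (rule \<beta>B[OF d _ le]) simp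
    qed (use AB K HF \<beta>M in auto)
    also have "\<dots> = ?Q" unfolding n\<eta> ..
    finally have grid: "(\<integral>\<^sup>+\<omega>. (\<Squnion>j\<in>{..?n}. ennreal ((norm (?g j \<omega>))\<^sup>2)) \<partial>M) \<le> ?Q" .
    have "(\<Squnion>k\<in>?I p. ennreal ((norm (dyadic_sum H \<beta> (q + p + N) (k * 2 ^ N) \<omega> - dyadic_sum H \<beta> (q + p + N) (a * 2 ^ p * 2 ^ N) \<omega>))\<^sup>2))
        \<le> (\<Squnion>j\<in>{..?n}. ennreal ((norm (?g j \<omega>))\<^sup>2))" for \<omega>
    proof (rule SUP_least)
      fix k assume k: "k \<in> ?I p"
      define j where "j = (k - a * 2 ^ p) * 2 ^ N"
      have kj: "k * 2 ^ N = a * 2 ^ p * 2 ^ N + j"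
        using k by (simp add: j_def flip: add_mult_distrib)
      have jn: "j \<in> {..?n}"
        using k by (simp add: j_def power_add diff_mult_distrib mult.assoc) (simp add: diff_le_mono mult.assoc[symmetric])
      have "dyadic_sum H \<beta> (q + p + N) (k * 2 ^ N) \<omega> - dyadic_sum H \<beta> (q + p + N) (a * 2 ^ p * 2 ^ N) \<omega> = ?g j \<omega>"
        unfolding kj dyadic_sum_shift s ..
      then show "ennreal ((norm (dyadic_sum H \<beta> (q + p + N) (k * 2 ^ N) \<omega> - dyadic_sum H \<beta> (q + p + N) (a * 2 ^ p * 2 ^ N) \<omega>))\<^sup>2)
        \<le> (\<Squnion>j\<in>{..?n}. ennreal ((norm (?g j \<omega>))\<^sup>2))"
        using jn by (simp only:) (rule SUP_upper)
    qed
    then show "(\<integral>\<^sup>+\<omega>. (\<Squnion>k\<in>?I p. ennreal ((norm (dyadic_sum H \<beta> (q + p + N) (k * 2 ^ N) \<omega> - dyadic_sum H \<beta> (q + p + N) (a * 2 ^ p * 2 ^ N) \<omega>))\<^sup>2)) \<partial>M) \<le> ?Q"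
      by (intro order_trans[OF nn_integral_mono grid])
  qed (auto intro!: borel_measurable_diff dyadic_sum_measurable HM \<beta>M UM)
  have inc: "incseq ?f"
  proof (intro incseq_SucI le_funI SUP_mono)
    fix p \<omega> k assume k: "k \<in> ?I p"
    have "real (2 * k) / 2 ^ (q + Suc p) = real k / 2 ^ (q + p)" by simp
    with k show "\<exists>k'\<in>?I (Suc p). ennreal ((norm (U (real k / 2 ^ (q + p)) \<omega> - U ?s \<omega>))\<^sup>2)
        \<le> ennreal ((norm (U (real k' / 2 ^ (q + Suc p)) \<omega> - U ?s \<omega>))\<^sup>2)"
      by (intro bexI[of _ "2 * k"]) auto
  qed
  have "(\<Squnion>u\<in>dyadics \<inter> {?s..real c / 2 ^ q}. ennreal ((norm (U u \<omega> - U ?s \<omega>))\<^sup>2)) \<le> (\<Squnion>p. ?f p \<omega>)" for \<omega>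
  proof (rule SUP_least)
    fix u assume u: "u \<in> dyadics \<inter> {?s..real c / 2 ^ q}"
    then obtain k p where kp: "u = real k / 2 ^ p" by (auto simp: dyadics_def)
    have eq: "u = real (k * 2 ^ q) / 2 ^ (q + p)" by (simp add: kp power_add)
    have "real (a * 2 ^ p) \<le> real (k * 2 ^ q)" "real (k * 2 ^ q) \<le> real (c * 2 ^ p)"
      using u by (auto simp: kp field_simps)
    then have "k * 2 ^ q \<in> ?I p" by (simp only: of_nat_le_iff atLeastAtMost_iff)
    then have "ennreal ((norm (U u \<omega> - U ?s \<omega>))\<^sup>2) \<le> ?f p \<omega>"
      unfolding eq by (rule SUP_upper)
    also have "\<dots> \<le> (\<Squnion>p. ?f p \<omega>)" by (rule SUP_upper) simp
    finally show "ennreal ((norm (U u \<omega> - U ?s \<omega>))\<^sup>2) \<le> (\<Squnion>p. ?f p \<omega>)" .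
  qed
  then have "(\<integral>\<^sup>+\<omega>. (\<Squnion>u\<in>dyadics \<inter> {?s..real c / 2 ^ q}. ennreal ((norm (U u \<omega> - U ?s \<omega>))\<^sup>2)) \<partial>M)
      \<le> (\<integral>\<^sup>+\<omega>. (\<Squnion>p. ?f p \<omega>) \<partial>M)"
    by (rule nn_integral_mono)
  also have "\<dots> = (\<Squnion>p. \<integral>\<^sup>+\<omega>. ?f p \<omega> \<partial>M)"
  proof (rule nn_integral_monotone_convergence_SUP[OF inc])
    have sq: "(\<lambda>z :: real ^ 'd. ennreal ((norm z)\<^sup>2)) \<in> borel_measurable borel" by measurable
    have "(\<lambda>\<omega>. ennreal ((norm (U (real k / 2 ^ (q + p)) \<omega> - U ?s \<omega>))\<^sup>2)) \<in> borel_measurable M" for k p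
      by (rule measurable_compose[OF borel_measurable_diff[OF UM UM] sq]) simp_all
    then show "?f p \<in> borel_measurable M" for p
      by (intro borel_measurable_SUP) auto
  qed
  also have "\<dots> \<le> ?Q" using level by (rule SUP_least)
  finally show ?thesis .
qed

end

section \<open>The solution and the Euler scheme as Ito processes\<close>

lemma left_riemann_sum_error:
  fixes f :: "real \<Rightarrow> 'b::banach"
  assumes "0 < \<eta>" "continuous_on {0..real n * \<eta>} f"
    and osc: "\<And>u v. u \<in> {0..real n * \<eta>} \<Longrightarrow> v \<in> {0..real n * \<eta>} \<Longrightarrow> \<bar>u - v\<bar> \<le> \<eta> \<Longrightarrow> norm (f u - f v) \<le> e"
  shows "norm ((\<Sum>i<n. \<eta> *\<^sub>R f (real i * \<eta>)) - integral {0..real n * \<eta>} f) \<le> e * (real n * \<eta>)"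
  using assms(2,3)
proof (induction n)
  case (Suc n)
  let ?a = "real n * \<eta>" and ?b = "real (Suc n) * \<eta>"
  have ab: "0 \<le> ?a" "?a \<le> ?b" "?b - ?a = \<eta>" using assms(1) by (auto simp: algebra_simps)
  have sub: "{0..?a} \<subseteq> {0..?b}" "{?a..?b} \<subseteq> {0..?b}" using ab by auto
  have IH: "norm ((\<Sum>i<n. \<eta> *\<^sub>R f (real i * \<eta>)) - integral {0..?a} f) \<le> e * ?a"
    using Suc.prems sub(1) by (intro Suc.IH continuous_on_subset[OF Suc.prems(1)]) auto
  have cont: "continuous_on {?a..?b} f" by (rule continuous_on_subset[OF Suc.prems(1) sub(2)])
  have "integral {?a..?b} (\<lambda>t. f ?a - f t) = \<eta> *\<^sub>R f ?a - integral {?a..?b} f"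
    using integrable_continuous_real[OF cont] ab by (subst integral_diff) auto
  moreover have "norm (integral {?a..?b} (\<lambda>t. f ?a - f t)) \<le> e * (?b - ?a)"
  proof (rule integral_bound)
    show "norm (f ?a - f t) \<le> e" if "t \<in> {?a..?b}" for t
    proof (rule Suc.prems(2))
      have "?a \<le> t" "t \<le> ?b" using that by auto
      then have "0 \<le> t" "t \<le> ?b" "\<bar>?a - t\<bar> \<le> \<eta>" using ab by linarith+
      then show "?a \<in> {0..?b}" "t \<in> {0..?b}" "\<bar>?a - t\<bar> \<le> \<eta>"
        using ab by (simp_all only: atLeastAtMost_iff simp_thms)
    qed
  qed (use ab cont in \<open>auto intro!: continuous_on_diff continuous_on_const\<close>)
  ultimately have "norm (\<eta> *\<^sub>R f ?a - integral {?a..?b} f) \<le> e * \<eta>" using ab by simp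
  moreover have "integral {0..?b} f = integral {0..?a} f + integral {?a..?b} f"
    by (rule Henstock_Kurzweil_Integration.integral_combine[OF ab(1,2)
        integrable_continuous_real[OF Suc.prems(1)], symmetric])
  ultimately have "norm (((\<Sum>i<n. \<eta> *\<^sub>R f (real i * \<eta>)) - integral {0..?a} f) + (\<eta> *\<^sub>R f ?a - integral {?a..?b} f)) \<le> e * ?a + e * \<eta>"
    using IH by (intro norm_triangle_mono)
  with \<open>integral {0..?b} f = _\<close> show ?case by (simp add: algebra_simps)
qed simp

lemma left_riemann_sum_tendsto:
  fixes f :: "real \<Rightarrow> 'b::banach"
  assumes "continuous_on {0..real k / 2 ^ q} f"
  shows "(\<lambda>N. \<Sum>i<k * 2 ^ N. (1 / 2 ^ (q + N)) *\<^sub>R f (real i / 2 ^ (q + N))) \<longlonglongrightarrow> integral {0..real k / 2 ^ q} f"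
proof (rule LIMSEQ_I)
  fix r :: real assume r: "r > 0"
  let ?t = "real k / 2 ^ q"
  \<comment> \<open>The \<open>+ 1\<close> in the witness covers an interval of length zero.\<close>
  have "\<exists>e>0. e * s < r" if "0 \<le> s" for s
    using that r mult_nonneg_nonneg[of r s]
    by (intro exI[of _ "r / (2 * (s + 1))"]) (simp add: field_simps add_pos_nonneg add_nonneg_pos)
  from this[of ?t] obtain e where e: "e > 0" "e * ?t < r" by auto
  have "uniformly_continuous_on {0..?t} f" by (rule compact_uniformly_continuous[OF assms]) simp
  then obtain d where d: "d > 0" "\<And>u v. u \<in> {0..?t} \<Longrightarrow> v \<in> {0..?t} \<Longrightarrow> dist v u < d \<Longrightarrow> dist (f v) (f u) < e"
    using e by (auto simp: uniformly_continuous_on_def)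
  obtain N0 where N0: "(1 / 2) ^ N0 < d" using real_arch_pow_inv[OF d(1), of "1 / 2"] by auto
  show "\<exists>no. \<forall>N\<ge>no. norm ((\<Sum>i<k * 2 ^ N. (1 / 2 ^ (q + N)) *\<^sub>R f (real i / 2 ^ (q + N))) - integral {0..?t} f) < r"
  proof (intro exI[of _ N0] allI impI)
    fix N assume "N \<ge> N0"
    let ?\<eta> = "1 / 2 ^ (q + N) :: real"
    have "?\<eta> = (1 / 2) ^ (q + N)" by (simp add: power_divide)
    also have "\<dots> \<le> (1 / 2) ^ N0" using \<open>N \<ge> N0\<close> by (intro power_decreasing) auto
    finally have small: "?\<eta> < d" using N0 by simp
    have t_eq: "real (k * 2 ^ N) * ?\<eta> = ?t" by (simp add: power_add)
    have "norm ((\<Sum>i<k * 2 ^ N. ?\<eta> *\<^sub>R f (real i * ?\<eta>)) - integral {0..real (k * 2 ^ N) * ?\<eta>} f) \<le> e * (real (k * 2 ^ N) * ?\<eta>)"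
    proof (rule left_riemann_sum_error)
      show "continuous_on {0..real (k * 2 ^ N) * ?\<eta>} f" using assms unfolding t_eq .
      show "norm (f u - f v) \<le> e" if "u \<in> {0..real (k * 2 ^ N) * ?\<eta>}" "v \<in> {0..real (k * 2 ^ N) * ?\<eta>}" "\<bar>u - v\<bar> \<le> ?\<eta>" for u v
        using d(2)[of v u] that small unfolding t_eq dist_norm by simp
    qed simp
    then show "norm ((\<Sum>i<k * 2 ^ N. ?\<eta> *\<^sub>R f (real i / 2 ^ (q + N))) - integral {0..?t} f) < r"
      unfolding t_eq using e by simp
  qed
qed

context prob_space
begin

lemma tends_in_prob_cong_AE:
  assumes "tends_in_prob Z L" "AE \<omega> in M. L \<omega> = L' \<omega>"
    and [measurable]: "\<And>N. Z N \<in> borel_measurable M" "L \<in> borel_measurable M" "L' \<in> borel_measurable M"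
  shows "tends_in_prob Z L'"
proof -
  have "prob {\<omega>\<in>space M. norm (Z N \<omega> - L \<omega>) > e} = prob {\<omega>\<in>space M. norm (Z N \<omega> - L' \<omega>) > e}" for N e
    by (rule measure_eq_AE) (use assms(2) in auto)
  then show ?thesis using assms(1) by (simp add: tends_in_prob_def)
qed

end

lemma nn_integral_norm_square_diff_le:
  fixes f g :: "'a \<Rightarrow> 'b::{second_countable_topology,real_normed_vector}"
  assumes [measurable]: "f \<in> borel_measurable M" "g \<in> borel_measurable M"
    and "(\<integral>\<^sup>+\<omega>. ennreal ((norm (f \<omega>))\<^sup>2) \<partial>M) \<le> ennreal a" "(\<integral>\<^sup>+\<omega>. ennreal ((norm (g \<omega>))\<^sup>2) \<partial>M) \<le> ennreal b"
    and "0 \<le> a" "0 \<le> b"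
  shows "(\<integral>\<^sup>+\<omega>. ennreal ((norm (f \<omega> - g \<omega>))\<^sup>2) \<partial>M) \<le> ennreal (2 * a + 2 * b)"
proof -
  have le: "(norm (f \<omega> - g \<omega>))\<^sup>2 \<le> 2 * (norm (f \<omega>))\<^sup>2 + 2 * (norm (g \<omega>))\<^sup>2" for \<omega>
  proof -
    have "(norm (f \<omega> - g \<omega>))\<^sup>2 \<le> (norm (f \<omega>) + norm (g \<omega>))\<^sup>2"
      by (intro power_mono norm_triangle_ineq4) auto
    then show ?thesis
      using sum_squares_bound[of "norm (f \<omega>)" "norm (g \<omega>)"] by (simp add: power2_sum)
  qed
  have "(\<integral>\<^sup>+\<omega>. ennreal ((norm (f \<omega> - g \<omega>))\<^sup>2) \<partial>M)
      \<le> (\<integral>\<^sup>+\<omega>. ennreal 2 * ennreal ((norm (f \<omega>))\<^sup>2) + ennreal 2 * ennreal ((norm (g \<omega>))\<^sup>2) \<partial>M)"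
    by (rule nn_integral_mono) (simp only: ennreal_mult[symmetric] ennreal_plus[symmetric] zero_le_power2
        mult_nonneg_nonneg zero_le_numeral ennreal_leI[OF le])
  also have "\<dots> = ennreal 2 * (\<integral>\<^sup>+\<omega>. ennreal ((norm (f \<omega>))\<^sup>2) \<partial>M) + ennreal 2 * (\<integral>\<^sup>+\<omega>. ennreal ((norm (g \<omega>))\<^sup>2) \<partial>M)"
    by (subst nn_integral_add) (simp_all add: nn_integral_cmult)
  also have "\<dots> \<le> ennreal 2 * ennreal a + ennreal 2 * ennreal b"
    by (intro add_mono mult_left_mono assms) auto
  also have "\<dots> = ennreal (2 * a + 2 * b)"
    by (simp only: ennreal_mult[symmetric] ennreal_plus[symmetric] assms(5,6) mult_nonneg_nonneg zero_le_numeral)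
  finally show ?thesis .
qed

definition euler_node ::
  "(real ^ 'd \<Rightarrow> real ^ 'm ^ 'd) \<Rightarrow> (real ^ 'd \<Rightarrow> real ^ 'd) \<Rightarrow> (real \<Rightarrow> 'a \<Rightarrow> real ^ 'm) \<Rightarrow>
   real ^ 'd \<Rightarrow> nat \<Rightarrow> real \<Rightarrow> 'a \<Rightarrow> real ^ 'd" where
  "euler_node \<sigma> b W x n t \<omega> = euler_grid \<sigma> b W x n (nat \<lfloor>t * 2 ^ n\<rfloor>) \<omega>"

lemma nat_floor_cell:
  assumes "real j / 2 ^ n \<le> t" "t < real (Suc j) / 2 ^ n"
  shows "nat \<lfloor>t * 2 ^ n\<rfloor> = j"
proof -
  have "\<lfloor>t * 2 ^ n\<rfloor> = int j"
    using assms by (intro floor_unique) (auto simp: field_simps)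
  then show ?thesis by simp
qed

lemma euler_at_grid: "euler \<sigma> b W x n (real j / 2 ^ n) \<omega> = euler_grid \<sigma> b W x n j \<omega>"
  by (simp add: euler_def Let_def)

text \<open>At the right end point \<open>euler\<close> already switches to the next cell, but the
  recursion for the grid values reproduces the old formula there. Including this point lets a finer
  step end on a node.\<close>

lemma euler_cell:
  fixes W :: "real \<Rightarrow> 'a \<Rightarrow> real ^ 'm" and \<sigma> :: "real ^ 'd \<Rightarrow> real ^ 'm ^ 'd" and \<omega> :: 'a
  assumes "real j / 2 ^ n \<le> t" "t \<le> real (Suc j) / 2 ^ n"
  shows "euler \<sigma> b W x n t \<omega> = euler_grid \<sigma> b W x n j \<omega>
    + \<sigma> (euler_grid \<sigma> b W x n j \<omega>) *v (W t \<omega> - W (real j / 2 ^ n) \<omega>)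
    + (t - real j / 2 ^ n) *\<^sub>R b (euler_grid \<sigma> b W x n j \<omega>)"
proof (cases "t = real (Suc j) / 2 ^ n")
  case True
  have "euler \<sigma> b W x n t \<omega> = euler_grid \<sigma> b W x n (Suc j) \<omega>"
    unfolding True by (rule euler_at_grid)
  then show ?thesis
    by (simp add: True add_divide_distrib)
next
  case False
  with assms have "nat \<lfloor>t * 2 ^ n\<rfloor> = j" by (intro nat_floor_cell) auto
  then show ?thesis by (simp add: euler_def Let_def)
qed

text \<open>A grid at least as fine as that of the scheme has no step across a node, so the
  coefficients are constant during each of its steps.\<close>

lemma euler_dyadic_step:
  fixes W :: "real \<Rightarrow> 'a \<Rightarrow> real ^ 'm" and \<sigma> :: "real ^ 'd \<Rightarrow> real ^ 'm ^ 'd" and b :: "real ^ 'd \<Rightarrow> real ^ 'd"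
    and x :: "real ^ 'd" and \<omega> :: 'a and k p n :: nat
  defines "t \<equiv> real k / 2 ^ (n + p)" and "t' \<equiv> real (Suc k) / 2 ^ (n + p)"
  defines "y \<equiv> euler_node \<sigma> b W x n t \<omega>"
  shows "euler \<sigma> b W x n t' \<omega> - euler \<sigma> b W x n t \<omega> = \<sigma> y *v (W t' \<omega> - W t \<omega>) + (1 / 2 ^ (n + p)) *\<^sub>R b y"
proof -
  \<comment> \<open>The cell of the scheme that contains the whole fine step from \<open>k\<close>
    to \<open>Suc k\<close>.\<close>
  define j where "j = k div 2 ^ p"
  have l: "j * 2 ^ p \<le> k" by (simp add: j_def)
  have u: "Suc k \<le> Suc j * 2 ^ p"
    unfolding j_def by (metis Suc_leI dividend_less_times_div mult.commute mult_Suc_right zero_less_numeral zero_less_power)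
  have "real (j * 2 ^ p) \<le> real k" "real (Suc k) \<le> real (Suc j * 2 ^ p)"
    using l u by (simp_all only: of_nat_le_iff)
  then have "real (j * 2 ^ p) / 2 ^ (n + p) \<le> t" "t' \<le> real (Suc j * 2 ^ p) / 2 ^ (n + p)"
    unfolding t_def t'_def by (intro divide_right_mono; simp)+
  moreover have "real (c * 2 ^ p) / 2 ^ (n + p) = real c / 2 ^ n" for c
    by (simp add: power_add)
  ultimately have jt: "real j / 2 ^ n \<le> t" "t' \<le> real (Suc j) / 2 ^ n"
    by (simp_all only:)
  have diff: "t' - t = 1 / 2 ^ (n + p)"
    unfolding t_def t'_def by (simp add: diff_divide_distrib[symmetric])
  then have tt: "t < t'" "t \<le> t'" by (smt (verit) zero_less_divide_1_iff zero_less_numeral zero_less_power)+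
  have "nat \<lfloor>t * 2 ^ n\<rfloor> = j" using jt tt by (intro nat_floor_cell) auto
  then have y: "y = euler_grid \<sigma> b W x n j \<omega>" by (simp add: y_def euler_node_def)
  have "euler \<sigma> b W x n t' \<omega> - euler \<sigma> b W x n t \<omega>
      = (y + \<sigma> y *v (W t' \<omega> - W (real j / 2 ^ n) \<omega>) + (t' - real j / 2 ^ n) *\<^sub>R b y)
        - (y + \<sigma> y *v (W t \<omega> - W (real j / 2 ^ n) \<omega>) + (t - real j / 2 ^ n) *\<^sub>R b y)"
    unfolding y using jt tt by (intro arg_cong2[where f = minus] euler_cell) auto
  also have "\<dots> = \<sigma> y *v (W t' \<omega> - W t \<omega>) + (t' - t) *\<^sub>R b y"
    by (simp add: matrix_vector_mult_diff_distrib algebra_simps)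
  finally show ?thesis unfolding diff .
qed

context brownian_filtration
begin

lemma euler_grid_adapted:
  assumes \<sigma>: "continuous_on UNIV \<sigma>" and b: "continuous_on UNIV b"
  shows "euler_grid \<sigma> b W x n k \<in> borel_measurable (F (real k / 2 ^ n))"
proof (induction k)
  case 0
  have "euler_grid \<sigma> b W x n 0 = (\<lambda>\<omega>. x)" by (simp add: fun_eq_iff)
  then show ?case by simp
next
  case (Suc k)
  let ?F = "F (real (Suc k) / 2 ^ n)"
  note [measurable] = borel_measurable_continuous_onI[OF \<sigma>] borel_measurable_continuous_onI[OF b]
  have le: "real k / 2 ^ n \<le> real (Suc k) / 2 ^ n" by (simp add: divide_right_mono)
  have G [measurable]: "euler_grid \<sigma> b W x n k \<in> borel_measurable ?F"
    by (rule measurable_F_mono[OF Suc le])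
  have [measurable]: "W (real k / 2 ^ n) \<in> borel_measurable ?F" "W (real (Suc k) / 2 ^ n) \<in> borel_measurable ?F"
    by (rule measurable_F_mono[OF W_measurable le], simp) (rule W_measurable, simp)
  have "euler_grid \<sigma> b W x n (Suc k) = (\<lambda>\<omega>. euler_grid \<sigma> b W x n k \<omega>
     + \<sigma> (euler_grid \<sigma> b W x n k \<omega>) *v (W (real (Suc k) / 2 ^ n) \<omega> - W (real k / 2 ^ n) \<omega>)
     + (1 / 2 ^ n) *\<^sub>R b (euler_grid \<sigma> b W x n k \<omega>))"
    by (simp add: fun_eq_iff)
  also have "\<dots> \<in> borel_measurable ?F"
    by measurable
  finally show ?case .
qed

lemma euler_node_adapted:
  assumes "continuous_on UNIV \<sigma>" "continuous_on UNIV b" "0 \<le> t"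
  shows "euler_node \<sigma> b W x n t \<in> borel_measurable (F t)"
proof -
  have "real (nat \<lfloor>t * 2 ^ n\<rfloor>) \<le> t * 2 ^ n" using assms(3) by simp
  then have "real (nat \<lfloor>t * 2 ^ n\<rfloor>) / 2 ^ n \<le> t" by (simp add: field_simps)
  from measurable_F_mono[OF euler_grid_adapted[OF assms(1,2)] this] show ?thesis
    by (simp add: euler_node_def[abs_def])
qed

lemma euler_measurable:
  assumes \<sigma>: "continuous_on UNIV \<sigma>" and b: "continuous_on UNIV b" and t: "0 \<le> t"
  shows "euler \<sigma> b W x n t \<in> borel_measurable M"
proof -
  note [measurable] = borel_measurable_continuous_onI[OF \<sigma>] borel_measurable_continuous_onI[OF b]
    measurable_F[OF euler_grid_adapted[OF \<sigma> b]]
  have [measurable]: "(\<lambda>\<omega>. W t \<omega> - W (real (nat \<lfloor>t * 2 ^ n\<rfloor>) / 2 ^ n) \<omega>) \<in> borel_measurable M"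
    using t by (intro increment_measurable) auto
  show ?thesis unfolding euler_def[abs_def] Let_def by measurable
qed

text \<open>No genuine limit is involved: as soon as the grid refines that of the scheme, the sums
  telescope to the exact increment.\<close>

lemma euler_ito_process:
  assumes \<sigma>: "continuous_on UNIV \<sigma>" "\<And>y. norm (\<sigma> y) \<le> S" and b: "continuous_on UNIV b"
  shows "ito_process (euler \<sigma> b W x n) (\<lambda>t \<omega>. \<sigma> (euler_node \<sigma> b W x n t \<omega>)) (\<lambda>t \<omega>. b (euler_node \<sigma> b W x n t \<omega>))"
    (is "ito_process ?U ?H ?\<beta>")
proof -
  have H: "0 \<le> t \<Longrightarrow> ?H t \<in> borel_measurable (F t)" and \<beta>: "0 \<le> t \<Longrightarrow> ?\<beta> t \<in> borel_measurable (F t)" for t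
    using measurable_compose[OF euler_node_adapted[OF \<sigma>(1) b] borel_measurable_continuous_onI[OF \<sigma>(1)]]
      measurable_compose[OF euler_node_adapted[OF \<sigma>(1) b] borel_measurable_continuous_onI[OF b]] by auto
  have exact: "dyadic_sum ?H ?\<beta> (n + p) k \<omega> = ?U (real k / 2 ^ (n + p)) \<omega> - ?U 0 \<omega>" for p k \<omega>
  proof (induction k)
    case (Suc k)
    have "dyadic_sum ?H ?\<beta> (n + p) (Suc k) \<omega> = dyadic_sum ?H ?\<beta> (n + p) k \<omega>
        + (?U (real (Suc k) / 2 ^ (n + p)) \<omega> - ?U (real k / 2 ^ (n + p)) \<omega>)"
      unfolding euler_dyadic_step by (simp add: dyadic_sum_def)
    then show ?case using Suc by simp
  qed (simp add: dyadic_sum_def)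
  have lim: "(\<lambda>N. dyadic_sum ?H ?\<beta> (q + N) (k * 2 ^ N) \<omega>) \<longlonglongrightarrow> ?U (real k / 2 ^ q) \<omega> - ?U 0 \<omega>" for q k \<omega>
  proof (rule tendsto_eventually)
    have "dyadic_sum ?H ?\<beta> (q + N) (k * 2 ^ N) \<omega> = ?U (real k / 2 ^ q) \<omega> - ?U 0 \<omega>" if "n \<le> N" for N
    proof -
      have "q + N = n + (q + N - n)" using that by simp
      then have "dyadic_sum ?H ?\<beta> (q + N) (k * 2 ^ N) \<omega> = ?U (real (k * 2 ^ N) / 2 ^ (q + N)) \<omega> - ?U 0 \<omega>"
        using exact[of "q + N - n" "k * 2 ^ N" \<omega>] by (simp only:)
      also have "real (k * 2 ^ N) / 2 ^ (q + N) = real k / 2 ^ q" by (simp add: power_add)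
      finally show ?thesis .
    qed
    then show "\<forall>\<^sub>F N in sequentially. dyadic_sum ?H ?\<beta> (q + N) (k * 2 ^ N) \<omega> = ?U (real k / 2 ^ q) \<omega> - ?U 0 \<omega>"
      by (auto simp: eventually_sequentially)
  qed
  note HM = measurable_F[OF H] and \<beta>M = measurable_F[OF \<beta>]
    and UM = euler_measurable[OF \<sigma>(1) b]
  have "tends_in_prob (\<lambda>N. dyadic_sum ?H ?\<beta> (q + N) (k * 2 ^ N)) (\<lambda>\<omega>. ?U (real k / 2 ^ q) \<omega> - ?U 0 \<omega>)" for q k
    by (intro pointwise_imp_tends_in_prob dyadic_sum_measurable HM \<beta>M borel_measurable_diff UM lim) auto
  then show ?thesis unfolding ito_process_def
    by (intro conjI allI impI exI[of _ S] UM H \<beta>M \<sigma>(2)) assumption+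
qed

text \<open>The initial value is encoded in the solution property at time 0. There the Ito sums and
  the integral vanish, so the probabilities do not depend on \<open>j\<close>, and a constant
  sequence tending to 0 is 0.\<close>

lemma sde_solution_start:
  assumes "sde_solution M F W \<sigma> b x X"
  shows "AE \<omega> in M. X 0 \<omega> = x"
proof -
  have XM [measurable]: "X 0 \<in> borel_measurable M"
    using assms by (auto simp: sde_solution_def intro: measurable_F)
  have zero: "prob {\<omega>\<in>space M. norm (x - X 0 \<omega>) > e} = 0" if "e > 0" for e
  proof -
    have "ito_sum (\<lambda>s \<omega>. \<sigma> (X s \<omega>)) W 0 j \<omega> = 0" for j \<omega>
      by (simp add: ito_sum_def)
    moreover have "(\<lambda>j. prob {\<omega>\<in>space M. norm (ito_sum (\<lambda>s \<omega>. \<sigma> (X s \<omega>)) W 0 j \<omega>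
        - (X 0 \<omega> - x - integral {0..0} (\<lambda>s. b (X s \<omega>)))) > e}) \<longlonglongrightarrow> 0"
      using assms that unfolding sde_solution_def by blast
    ultimately have "(\<lambda>j::nat. prob {\<omega>\<in>space M. norm (x - X 0 \<omega>) > e}) \<longlonglongrightarrow> 0"
      by simp
    then show ?thesis by (simp add: LIMSEQ_const_iff)
  qed
  have "AE \<omega> in M. \<forall>i::nat. \<not> norm (x - X 0 \<omega>) > 1 / real (Suc i)"
    unfolding AE_all_countable
  proof
    fix i
    have "emeasure M {\<omega>\<in>space M. norm (x - X 0 \<omega>) > 1 / real (Suc i)} = 0"
      by (simp add: emeasure_eq_measure zero del: of_nat_Suc)
    then show "AE \<omega> in M. \<not> norm (x - X 0 \<omega>) > 1 / real (Suc i)"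
      by (subst AE_iff_measurable[OF _ refl]) (auto simp del: of_nat_Suc)
  qed
  then show ?thesis
  proof eventually_elim
    fix \<omega> assume a: "\<forall>i::nat. \<not> norm (x - X 0 \<omega>) > 1 / real (Suc i)"
    have "\<not> 0 < norm (x - X 0 \<omega>)"
    proof
      assume "0 < norm (x - X 0 \<omega>)"
      from reals_Archimedean[OF this] a show False by (auto simp: inverse_eq_divide)
    qed
    then show "X 0 \<omega> = x" by simp
  qed
qed

text \<open>The definition of a solution allows any number of equal parts; taking
  \<open>k * 2 ^ N\<close> parts of \<open>[0, k / 2 ^ q]\<close> yields precisely the dyadic grids.
  The drift sums converge pathwise. Time 0 is separate because the numbers of parts would not tend
  to infinity.\<close>

lemma sde_solution_ito_process:
  assumes X: "sde_solution M F W \<sigma> b x X"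
    and \<sigma>: "continuous_on UNIV \<sigma>" "\<And>y. norm (\<sigma> y) \<le> S" and b: "continuous_on UNIV b"
  shows "ito_process X (\<lambda>t \<omega>. \<sigma> (X t \<omega>)) (\<lambda>t \<omega>. b (X t \<omega>))" (is "ito_process X ?H ?\<beta>")
proof -
  have XF: "0 \<le> t \<Longrightarrow> X t \<in> borel_measurable (F t)" for t
    using X by (auto simp: sde_solution_def)
  have XM: "0 \<le> t \<Longrightarrow> X t \<in> borel_measurable M" for t
    by (rule measurable_F[OF XF])
  have H: "0 \<le> t \<Longrightarrow> ?H t \<in> borel_measurable (F t)" and \<beta>: "0 \<le> t \<Longrightarrow> ?\<beta> t \<in> borel_measurable (F t)" for t
    using measurable_compose[OF XF borel_measurable_continuous_onI[OF \<sigma>(1)]]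
      measurable_compose[OF XF borel_measurable_continuous_onI[OF b]] by auto
  note HM = measurable_F[OF H] and \<beta>M = measurable_F[OF \<beta>]
  have cont: "continuous_on {0..t} (\<lambda>s. b (X s \<omega>))" if "\<omega> \<in> space M" for \<omega> t
  proof -
    have "continuous_on {0..} (\<lambda>s. X s \<omega>)" using X that by (auto simp: sde_solution_def)
    then have "continuous_on {0..t} (\<lambda>s. X s \<omega>)" by (rule continuous_on_subset) auto
    from continuous_on_compose2[OF b this] show ?thesis by simp
  qed
  have "tends_in_prob (\<lambda>N. dyadic_sum ?H ?\<beta> (q + N) (k * 2 ^ N)) (\<lambda>\<omega>. X (real k / 2 ^ q) \<omega> - X 0 \<omega>)" for q k
  proof (cases "k = 0")
    case True
    then show ?thesis by (simp add: tends_in_prob_def dyadic_sum_def)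
  next
    case False
    let ?t = "real k / 2 ^ q"
    let ?R = "\<lambda>N \<omega>. \<Sum>i<k * 2 ^ N. (1 / 2 ^ (q + N)) *\<^sub>R ?\<beta> (real i / 2 ^ (q + N)) \<omega>"
    let ?I = "\<lambda>\<omega>. integral {0..?t} (\<lambda>s. b (X s \<omega>))"
    let ?J = "\<lambda>N \<omega>. ito_sum ?H W ?t (k * 2 ^ N) \<omega>"
    \<comment> \<open>The double minus prepares for \<open>tends_in_prob_diff\<close>, which treats
      differences.\<close>
    have split: "dyadic_sum ?H ?\<beta> (q + N) (k * 2 ^ N) \<omega> = ?J N \<omega> - - ?R N \<omega>" for N \<omega>
    proof -
      have "real i * ?t / real (k * 2 ^ N) = real i / 2 ^ (q + N)" for i
        using False by (simp add: power_add)
      then show ?thesis by (simp only: ito_sum_def dyadic_sum_def sum.distrib) simp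
    qed
    have RM: "?R N \<in> borel_measurable M" for N
      by (intro borel_measurable_sum borel_measurable_scaleR borel_measurable_const \<beta>M) simp
    have Rlim: "(\<lambda>N. ?R N \<omega>) \<longlonglongrightarrow> ?I \<omega>" if "\<omega> \<in> space M" for \<omega>
      by (rule left_riemann_sum_tendsto[OF cont[OF that]])
    \<comment> \<open>Measurability of the pathwise integral is inherited from its Riemann
      sums.\<close>
    have IM: "?I \<in> borel_measurable M"
      by (rule borel_measurable_LIMSEQ_metric[OF RM Rlim])
    have JM: "?J N \<in> borel_measurable M" for N
      unfolding ito_sum_def[abs_def]
      by (intro borel_measurable_sum borel_measurable_matrix_vector_mult increment_measurable HM) auto
    have R: "tends_in_prob (\<lambda>N \<omega>. - ?R N \<omega>) (\<lambda>\<omega>. - ?I \<omega>)"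
      by (intro pointwise_imp_tends_in_prob borel_measurable_uminus RM IM tendsto_minus Rlim)
    have J: "tends_in_prob ?J (\<lambda>\<omega>. X ?t \<omega> - x - ?I \<omega>)"
      unfolding tends_in_prob_def
    proof (intro allI impI)
      fix e :: real assume "e > 0"
      then have "(\<lambda>j. prob {\<omega>\<in>space M. norm (ito_sum ?H W ?t j \<omega> - (X ?t \<omega> - x - ?I \<omega>)) > e}) \<longlonglongrightarrow> 0"
        using X unfolding sde_solution_def by auto
      moreover have "filterlim (\<lambda>N. k * 2 ^ N) at_top sequentially"
      proof (rule filterlim_subseq)
        show "strict_mono (\<lambda>N. k * 2 ^ N)" using False by (intro strict_monoI) simp
      qed
      ultimately show "(\<lambda>N. prob {\<omega>\<in>space M. norm (?J N \<omega> - (X ?t \<omega> - x - ?I \<omega>)) > e}) \<longlonglongrightarrow> 0"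
        by (rule filterlim_compose)
    qed
    have tM: "X ?t \<in> borel_measurable M" "X 0 \<in> borel_measurable M" by (intro XM; simp)+
    have "tends_in_prob (\<lambda>N \<omega>. ?J N \<omega> - - ?R N \<omega>) (\<lambda>\<omega>. (X ?t \<omega> - x - ?I \<omega>) - - ?I \<omega>)"
      by (intro tends_in_prob_diff J R JM borel_measurable_uminus RM IM borel_measurable_diff tM borel_measurable_const)
    then have "tends_in_prob (\<lambda>N \<omega>. dyadic_sum ?H ?\<beta> (q + N) (k * 2 ^ N) \<omega>) (\<lambda>\<omega>. X ?t \<omega> - x)"
      unfolding split by simp
    then show ?thesis
    proof (rule tends_in_prob_cong_AE)
      show "AE \<omega> in M. X ?t \<omega> - x = X ?t \<omega> - X 0 \<omega>"
        using sde_solution_start[OF X] by eventually_elim simp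
    qed (intro dyadic_sum_measurable HM \<beta>M borel_measurable_diff tM borel_measurable_const; assumption)+
  qed
  then show ?thesis unfolding ito_process_def
    by (intro conjI allI impI exI[of _ S] XM H \<beta>M \<sigma>(2)) assumption+
qed

end

section \<open>Error propagation over one step\<close>

text \<open>The last term takes care of points outside the ball of radius \<open>R\<close>, where the modulus gives nothing.\<close>

lemma modulus_square:
  fixes g :: "'b::real_normed_vector \<Rightarrow> 'c::real_normed_vector"
  assumes S: "\<And>y. norm (g y) \<le> S" and R: "0 < R" and \<alpha>: "0 \<le> \<alpha>" and \<gamma>: "0 \<le> \<gamma>"
    and reg: "\<And>y z. norm y \<le> R \<Longrightarrow> norm z \<le> R \<Longrightarrow> norm (g y - g z) \<le> \<alpha> * norm (y - z) + \<gamma>"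
  shows "(norm (g y - g z))\<^sup>2 \<le> 2 * \<alpha>\<^sup>2 * (norm (y - z))\<^sup>2 + 2 * \<gamma>\<^sup>2 + 4 * S\<^sup>2 / R\<^sup>2 * ((norm y)\<^sup>2 + (norm z)\<^sup>2)"
proof (cases "norm y \<le> R \<and> norm z \<le> R")
  case True
  then have "(norm (g y - g z))\<^sup>2 \<le> (\<alpha> * norm (y - z) + \<gamma>)\<^sup>2"
    using reg by (intro power_mono) auto
  also have "\<dots> \<le> 2 * (\<alpha> * norm (y - z))\<^sup>2 + 2 * \<gamma>\<^sup>2"
    using sum_squares_bound[of "\<alpha> * norm (y - z)" \<gamma>] by (simp add: power2_sum)
  finally have "(norm (g y - g z))\<^sup>2 \<le> 2 * \<alpha>\<^sup>2 * (norm (y - z))\<^sup>2 + 2 * \<gamma>\<^sup>2"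
    by (simp add: power_mult_distrib)
  moreover have "0 \<le> 4 * S\<^sup>2 / R\<^sup>2 * ((norm y)\<^sup>2 + (norm z)\<^sup>2)" by simp
  ultimately show ?thesis by linarith
next
  case False
  \<comment> \<open>Chebyshev's inequality in pointwise form: one of the points has norm at least
    \<open>R\<close>, so the last term alone dominates the square of the trivial bound
    \<open>2 * S\<close>.\<close>
  then have "R \<le> norm y \<or> R \<le> norm z" by auto
  then have "R\<^sup>2 \<le> (norm y)\<^sup>2 \<or> R\<^sup>2 \<le> (norm z)\<^sup>2"
    using R by (auto intro: power_mono)
  then have "R\<^sup>2 \<le> (norm y)\<^sup>2 + (norm z)\<^sup>2"
    by (auto intro: add_increasing add_increasing2)
  then have "4 * S\<^sup>2 / R\<^sup>2 * R\<^sup>2 \<le> 4 * S\<^sup>2 / R\<^sup>2 * ((norm y)\<^sup>2 + (norm z)\<^sup>2)"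
    by (rule mult_left_mono) simp
  then have 1: "4 * S\<^sup>2 \<le> 4 * S\<^sup>2 / R\<^sup>2 * ((norm y)\<^sup>2 + (norm z)\<^sup>2)"
    using R by simp
  have "norm (g y - g z) \<le> 2 * S"
    using S[of y] S[of z] norm_triangle_ineq4[of "g y" "g z"] by linarith
  then have "(norm (g y - g z))\<^sup>2 \<le> (2 * S)\<^sup>2" by (rule power_mono) simp
  then have 2: "(norm (g y - g z))\<^sup>2 \<le> 4 * S\<^sup>2" by (simp add: power_mult_distrib)
  have "0 \<le> 2 * \<alpha>\<^sup>2 * (norm (y - z))\<^sup>2 + 2 * \<gamma>\<^sup>2" by simp
  with 1 2 show ?thesis by linarith
qed

text \<open>The 8 arises from the 4 of the pointwise bound because two second moments, each at most
  \<open>c\<close>, enter.\<close>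

lemma (in prob_space) modulus_expectation:
  fixes g :: "'b::{second_countable_topology,real_normed_vector} \<Rightarrow> 'c::{second_countable_topology,real_normed_vector}"
  assumes S: "\<And>y. norm (g y) \<le> S" and R: "0 < R" and \<alpha>: "0 \<le> \<alpha>" and \<gamma>: "0 \<le> \<gamma>"
    and reg: "\<And>y z. norm y \<le> R \<Longrightarrow> norm z \<le> R \<Longrightarrow> norm (g y - g z) \<le> \<alpha> * norm (y - z) + \<gamma>"
    and [measurable]: "f \<in> borel_measurable M" "h \<in> borel_measurable M"
    and d: "0 \<le> d" "(\<integral>\<^sup>+\<omega>. ennreal ((norm (f \<omega> - h \<omega>))\<^sup>2) \<partial>M) \<le> ennreal d"
    and c: "0 \<le> c" "(\<integral>\<^sup>+\<omega>. ennreal ((norm (f \<omega>))\<^sup>2) \<partial>M) \<le> ennreal c" "(\<integral>\<^sup>+\<omega>. ennreal ((norm (h \<omega>))\<^sup>2) \<partial>M) \<le> ennreal c"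
  shows "(\<integral>\<^sup>+\<omega>. ennreal ((norm (g (f \<omega>) - g (h \<omega>)))\<^sup>2) \<partial>M) \<le> ennreal (2 * \<alpha>\<^sup>2 * d + (2 * \<gamma>\<^sup>2 + 8 * S\<^sup>2 * c / R\<^sup>2))"
proof -
  have "(\<integral>\<^sup>+\<omega>. ennreal ((norm (g (f \<omega>) - g (h \<omega>)))\<^sup>2) \<partial>M)
      \<le> (\<integral>\<^sup>+\<omega>. ennreal (2 * \<alpha>\<^sup>2 * (norm (f \<omega> - h \<omega>))\<^sup>2 + 2 * \<gamma>\<^sup>2
          + 4 * S\<^sup>2 / R\<^sup>2 * ((norm (f \<omega>))\<^sup>2 + (norm (h \<omega>))\<^sup>2)) \<partial>M)"
    by (intro nn_integral_mono ennreal_leI modulus_square[OF S R \<alpha> \<gamma> reg])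
  also have "\<dots> = (\<integral>\<^sup>+\<omega>. ennreal (2 * \<alpha>\<^sup>2) * ennreal ((norm (f \<omega> - h \<omega>))\<^sup>2) + ennreal (2 * \<gamma>\<^sup>2)
          + ennreal (4 * S\<^sup>2 / R\<^sup>2) * (ennreal ((norm (f \<omega>))\<^sup>2) + ennreal ((norm (h \<omega>))\<^sup>2)) \<partial>M)"
    by (intro nn_integral_cong) (simp only: ennreal_mult[symmetric] ennreal_plus[symmetric] zero_le_power2
        mult_nonneg_nonneg add_nonneg_nonneg zero_le_numeral zero_le_divide_iff simp_thms)
  also have "\<dots> = ennreal (2 * \<alpha>\<^sup>2) * (\<integral>\<^sup>+\<omega>. ennreal ((norm (f \<omega> - h \<omega>))\<^sup>2) \<partial>M) + ennreal (2 * \<gamma>\<^sup>2)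
          + ennreal (4 * S\<^sup>2 / R\<^sup>2) * ((\<integral>\<^sup>+\<omega>. ennreal ((norm (f \<omega>))\<^sup>2) \<partial>M) + (\<integral>\<^sup>+\<omega>. ennreal ((norm (h \<omega>))\<^sup>2) \<partial>M))"
    by (simp add: nn_integral_add nn_integral_cmult emeasure_space_1 del: ennreal_plus)
  also have "\<dots> \<le> ennreal (2 * \<alpha>\<^sup>2) * ennreal d + ennreal (2 * \<gamma>\<^sup>2) + ennreal (4 * S\<^sup>2 / R\<^sup>2) * (ennreal c + ennreal c)"
    by (intro add_mono mult_left_mono d c order_refl) auto
  also have "\<dots> = ennreal (2 * \<alpha>\<^sup>2 * d + (2 * \<gamma>\<^sup>2 + 8 * S\<^sup>2 * c / R\<^sup>2))"
  proof -
    have "ennreal (2 * \<alpha>\<^sup>2) * ennreal d + ennreal (2 * \<gamma>\<^sup>2) + ennreal (4 * S\<^sup>2 / R\<^sup>2) * (ennreal c + ennreal c)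
      = ennreal (2 * \<alpha>\<^sup>2 * d + 2 * \<gamma>\<^sup>2 + 4 * S\<^sup>2 / R\<^sup>2 * (c + c))"
      by (simp only: ennreal_mult[symmetric] ennreal_plus[symmetric] zero_le_power2 c(1) d(1)
        mult_nonneg_nonneg add_nonneg_nonneg zero_le_numeral zero_le_divide_iff simp_thms)
    also have "2 * \<alpha>\<^sup>2 * d + 2 * \<gamma>\<^sup>2 + 4 * S\<^sup>2 / R\<^sup>2 * (c + c) = 2 * \<alpha>\<^sup>2 * d + (2 * \<gamma>\<^sup>2 + 8 * S\<^sup>2 * c / R\<^sup>2)"
      by simp
    finally show ?thesis .
  qed
  finally show ?thesis .
qed

lemma nn_integral_SUP_Un_le:
  fixes f :: "real \<Rightarrow> 'a \<Rightarrow> ennreal"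
  assumes "countable A" "countable B" "\<And>u. u \<in> A \<union> B \<Longrightarrow> f u \<in> borel_measurable M"
  shows "(\<integral>\<^sup>+\<omega>. (\<Squnion>u\<in>A \<union> B. f u \<omega>) \<partial>M) \<le> (\<integral>\<^sup>+\<omega>. (\<Squnion>u\<in>A. f u \<omega>) \<partial>M) + (\<integral>\<^sup>+\<omega>. (\<Squnion>u\<in>B. f u \<omega>) \<partial>M)"
proof -
  have "(\<integral>\<^sup>+\<omega>. (\<Squnion>u\<in>A \<union> B. f u \<omega>) \<partial>M) \<le> (\<integral>\<^sup>+\<omega>. (\<Squnion>u\<in>A. f u \<omega>) + (\<Squnion>u\<in>B. f u \<omega>) \<partial>M)"
  proof (intro nn_integral_mono SUP_least)
    fix \<omega> u assume "u \<in> A \<union> B"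
    then show "f u \<omega> \<le> (\<Squnion>u\<in>A. f u \<omega>) + (\<Squnion>u\<in>B. f u \<omega>)"
      by (auto intro: add_increasing add_increasing2 SUP_upper)
  qed
  also have "\<dots> = (\<integral>\<^sup>+\<omega>. (\<Squnion>u\<in>A. f u \<omega>) \<partial>M) + (\<integral>\<^sup>+\<omega>. (\<Squnion>u\<in>B. f u \<omega>) \<partial>M)"
    using assms by (intro nn_integral_add borel_measurable_SUP) auto
  finally show ?thesis .
qed

text \<open>Taking the process as an argument keeps the type of its values, hence the dimension, visible
  in the constants defined below.\<close>

definition noise_dim :: "(real \<Rightarrow> 'a \<Rightarrow> real ^ 'm) \<Rightarrow> real" where
  "noise_dim W = real CARD('m)"

section \<open>Moments and differences of the coefficients\<close>

locale euler_scheme = brownian_filtration M F W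
  for M :: "'a measure" and F and W :: "real \<Rightarrow> 'a \<Rightarrow> real ^ 'm" +
  fixes \<sigma> :: "real ^ 'd \<Rightarrow> real ^ 'm ^ 'd" and b :: "real ^ 'd \<Rightarrow> real ^ 'd" and x :: "real ^ 'd"
    and X :: "real \<Rightarrow> 'a \<Rightarrow> real ^ 'd" and S C \<mu> :: real
  assumes \<sigma>_bound: "\<And>y. norm (\<sigma> y) \<le> S" and \<sigma>_cont: "continuous_on UNIV \<sigma>"
    and b_bound: "\<And>y. norm (b y) \<le> S" and b_cont: "continuous_on UNIV b"
    and C_pos: "0 < C" and \<mu>_pos: "0 < \<mu>"
    and \<sigma>_reg: "\<And>(N::nat) y z. real N > exp 1 \<Longrightarrow> norm y \<le> real N \<Longrightarrow> norm z \<le> real N \<Longrightarrow>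
        norm (\<sigma> y - \<sigma> z) \<le> C * sqrt (ln (real N)) * norm (y - z) + C * ln (real N) / real N powr \<mu>"
    and b_reg: "\<And>(N::nat) y z. real N > exp 1 \<Longrightarrow> norm y \<le> real N \<Longrightarrow> norm z \<le> real N \<Longrightarrow>
        norm (b y - b z) \<le> C * ln (real N) * norm (y - z) + C * ln (real N) / real N powr \<mu>"
    and sol: "sde_solution M F W \<sigma> b x X"
begin

abbreviation "Y \<equiv> euler \<sigma> b W x"
abbreviation "Z \<equiv> euler_node \<sigma> b W x"
abbreviation "D n t \<omega> \<equiv> X t \<omega> - Y n t \<omega>"

lemma X_measurable: "0 \<le> t \<Longrightarrow> X t \<in> borel_measurable M"
  using sol by (auto simp: sde_solution_def intro: measurable_F)

lemma Y_measurable: "0 \<le> t \<Longrightarrow> Y n t \<in> borel_measurable M"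
  by (rule euler_measurable[OF \<sigma>_cont b_cont])

lemma D_measurable: "0 \<le> t \<Longrightarrow> D n t \<in> borel_measurable M"
  by (intro borel_measurable_diff X_measurable Y_measurable)

lemma D_square_measurable: "0 \<le> t \<Longrightarrow> (\<lambda>\<omega>. ennreal ((norm (D n t \<omega>))\<^sup>2)) \<in> borel_measurable M"
  by (rule measurable_compose[OF D_measurable]) measurable

lemmas X_ito = sde_solution_ito_process[OF sol \<sigma>_cont \<sigma>_bound b_cont]
  and Y_ito = euler_ito_process[OF \<sigma>_cont \<sigma>_bound b_cont, of x]

lemma Z_eq_Y: "Z n t = Y n (real (nat \<lfloor>t * 2 ^ n\<rfloor>) / 2 ^ n)"
  by (rule ext) (simp only: euler_node_def euler_at_grid)

text \<open>A crude bound with three uses: second moments, the variation of the scheme inside a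
  cell, and finiteness of the error before it is absorbed.\<close>

lemma bounded_coefficients_increment:
  fixes U :: "real \<Rightarrow> 'a \<Rightarrow> real ^ 'd" and a c q :: nat
  assumes U: "ito_process U H \<beta>" and le: "a \<le> c"
    and H: "\<And>t \<omega>. norm (H t \<omega>) \<le> K" and \<beta>: "\<And>t \<omega>. norm (\<beta> t \<omega>) \<le> K"
  defines "\<tau> \<equiv> (real c - real a) / 2 ^ q"
  shows "(\<integral>\<^sup>+\<omega>. (\<Squnion>u\<in>dyadics \<inter> {real a / 2 ^ q..real c / 2 ^ q}.
      ennreal ((norm (U u \<omega> - U (real a / 2 ^ q) \<omega>))\<^sup>2)) \<partial>M)
    \<le> ennreal (16 * real CARD('m) * K\<^sup>2 * \<tau> + 2 * K\<^sup>2 * \<tau>\<^sup>2)"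
  unfolding \<tau>_def
proof (rule ito_process_maximal_inequality[OF U le])
  have const: "(\<integral>\<^sup>+\<omega>. ennreal ((norm (f \<omega>))\<^sup>2) \<partial>M) \<le> ennreal (K\<^sup>2)" if "\<And>\<omega>. norm (f \<omega>) \<le> K"
    for f :: "'a \<Rightarrow> 'c::real_normed_vector"
  proof -
    have "(\<integral>\<^sup>+\<omega>. ennreal ((norm (f \<omega>))\<^sup>2) \<partial>M) \<le> (\<integral>\<^sup>+\<omega>. ennreal (K\<^sup>2) \<partial>M)"
      using that by (intro nn_integral_mono ennreal_leI power_mono) auto
    then show ?thesis by (simp add: emeasure_space_1)
  qed
  fix v
  show "(\<integral>\<^sup>+\<omega>. ennreal ((norm (H v \<omega>))\<^sup>2) \<partial>M) \<le> ennreal (K\<^sup>2)"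
    "(\<integral>\<^sup>+\<omega>. ennreal ((norm (\<beta> v \<omega>))\<^sup>2) \<partial>M) \<le> ennreal (K\<^sup>2)"
    using H \<beta> by (auto intro!: const)
qed auto

text \<open>Comes from \<open>|U|^2 <= 2 |U - U 0|^2 + 2 |x|^2\<close> with the crude increment
  bound on \<open>[0, L]\<close>. It does not depend on \<open>n\<close>, so it serves the solution
  and all schemes alike.\<close>

definition moment_bound :: "nat \<Rightarrow> real" where
  "moment_bound L = 2 * (16 * noise_dim W * S\<^sup>2 * real L + 2 * S\<^sup>2 * (real L)\<^sup>2) + 2 * (norm x)\<^sup>2"

lemma moment_bound_nonneg: "0 \<le> moment_bound L"
  by (simp add: moment_bound_def noise_dim_def)

text \<open>\<open>U v\<close> is written as the increment minus \<open>- U 0\<close>, so that the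
  estimate for differences applies.\<close>

lemma second_moment:
  fixes U :: "real \<Rightarrow> 'a \<Rightarrow> real ^ 'd"
  assumes U: "ito_process U H \<beta>" and start: "AE \<omega> in M. U 0 \<omega> = x"
    and H: "\<And>t \<omega>. norm (H t \<omega>) \<le> S" and \<beta>: "\<And>t \<omega>. norm (\<beta> t \<omega>) \<le> S"
    and v: "v \<in> dyadics" "v \<le> real L"
  shows "(\<integral>\<^sup>+\<omega>. ennreal ((norm (U v \<omega>))\<^sup>2) \<partial>M) \<le> ennreal (moment_bound L)"
proof -
  have UM: "U t \<in> borel_measurable M" if "0 \<le> t" for t
    using U that by (auto simp: ito_process_def)
  have v0: "0 \<le> v" by (rule dyadics_nonneg[OF v(1)])
  have "(\<integral>\<^sup>+\<omega>. ennreal ((norm (U v \<omega> - U 0 \<omega>))\<^sup>2) \<partial>M)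
     \<le> (\<integral>\<^sup>+\<omega>. (\<Squnion>u\<in>dyadics \<inter> {real 0 / 2 ^ 0..real L / 2 ^ 0}.
      ennreal ((norm (U u \<omega> - U (real 0 / 2 ^ 0) \<omega>))\<^sup>2)) \<partial>M)"
    using v v0 by (intro nn_integral_mono SUP_upper2[of v]) auto
  also have "\<dots> \<le> ennreal (16 * real CARD('m) * S\<^sup>2 * ((real L - real 0) / 2 ^ 0) + 2 * S\<^sup>2 * ((real L - real 0) / 2 ^ 0)\<^sup>2)"
    by (rule bounded_coefficients_increment[OF U _ H \<beta>]) simp
  finally have inc: "(\<integral>\<^sup>+\<omega>. ennreal ((norm (U v \<omega> - U 0 \<omega>))\<^sup>2) \<partial>M) \<le> ennreal (16 * real CARD('m) * S\<^sup>2 * real L + 2 * S\<^sup>2 * (real L)\<^sup>2)"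
    by simp
  have "(\<integral>\<^sup>+\<omega>. ennreal ((norm (- U 0 \<omega>))\<^sup>2) \<partial>M) = (\<integral>\<^sup>+\<omega>. ennreal ((norm x)\<^sup>2) \<partial>M)"
    using start by (intro nn_integral_cong_AE) auto
  then have st: "(\<integral>\<^sup>+\<omega>. ennreal ((norm (- U 0 \<omega>))\<^sup>2) \<partial>M) \<le> ennreal ((norm x)\<^sup>2)"
    by (simp add: emeasure_space_1)
  have "(\<integral>\<^sup>+\<omega>. ennreal ((norm ((U v \<omega> - U 0 \<omega>) - - U 0 \<omega>))\<^sup>2) \<partial>M)
    \<le> ennreal (2 * (16 * real CARD('m) * S\<^sup>2 * real L + 2 * S\<^sup>2 * (real L)\<^sup>2) + 2 * (norm x)\<^sup>2)"
    by (intro nn_integral_norm_square_diff_le inc st borel_measurable_diff borel_measurable_uminus UM v0) auto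
  then show ?thesis by (simp add: moment_bound_def noise_dim_def)
qed

lemma X_second_moment:
  assumes "v \<in> dyadics" "v \<le> real L"
  shows "(\<integral>\<^sup>+\<omega>. ennreal ((norm (X v \<omega>))\<^sup>2) \<partial>M) \<le> ennreal (moment_bound L)"
  by (rule second_moment[OF X_ito sde_solution_start[OF sol] \<sigma>_bound b_bound assms])

lemma Y_second_moment:
  assumes "v \<in> dyadics" "v \<le> real L"
  shows "(\<integral>\<^sup>+\<omega>. ennreal ((norm (Y n v \<omega>))\<^sup>2) \<partial>M) \<le> ennreal (moment_bound L)"
  by (rule second_moment[OF Y_ito _ \<sigma>_bound b_bound assms]) (simp add: euler_def)

lemma floor_node:
  fixes n :: nat and v :: real
  assumes "0 \<le> v"
  defines "j \<equiv> nat \<lfloor>v * 2 ^ n\<rfloor>"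
  shows "real j / 2 ^ n \<le> v" "v \<le> real (Suc j) / 2 ^ n"
proof -
  have "real j \<le> v * 2 ^ n" "v * 2 ^ n \<le> real j + 1"
    using assms by (auto simp: j_def)
  then show "real j / 2 ^ n \<le> v" "v \<le> real (Suc j) / 2 ^ n"
    by (simp_all add: field_simps)
qed

lemma Z_second_moment:
  assumes "v \<in> dyadics" "v \<le> real L"
  shows "(\<integral>\<^sup>+\<omega>. ennreal ((norm (Z n v \<omega>))\<^sup>2) \<partial>M) \<le> ennreal (moment_bound L)"
  unfolding Z_eq_Y using floor_node(1)[OF dyadics_nonneg[OF assms(1)], of n] assms(2)
  by (intro Y_second_moment dyadicsI) linarith

text \<open>Constant of the crude increment bound on one cell: as its length
  \<open>1 / 2 ^ n\<close> is at most 1, the quadratic drift term is dominated by a linear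
  one.\<close>

definition node_error :: real where
  "node_error = (16 * noise_dim W + 2) * S\<^sup>2"

lemma node_error_nonneg: "0 \<le> node_error"
  by (simp add: node_error_def noise_dim_def)

lemma Z_close_to_Y:
  assumes "v \<in> dyadics"
  shows "(\<integral>\<^sup>+\<omega>. ennreal ((norm (Z n v \<omega> - Y n v \<omega>))\<^sup>2) \<partial>M) \<le> ennreal (node_error / 2 ^ n)"
proof -
  define j where "j = nat \<lfloor>v * 2 ^ n\<rfloor>"
  note j = floor_node[OF dyadics_nonneg[OF assms], of n, folded j_def]
  have "(\<integral>\<^sup>+\<omega>. ennreal ((norm (Z n v \<omega> - Y n v \<omega>))\<^sup>2) \<partial>M)
     \<le> (\<integral>\<^sup>+\<omega>. (\<Squnion>u\<in>dyadics \<inter> {real j / 2 ^ n..real (Suc j) / 2 ^ n}.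
      ennreal ((norm (Y n u \<omega> - Y n (real j / 2 ^ n) \<omega>))\<^sup>2)) \<partial>M)"
    using assms j unfolding Z_eq_Y j_def[symmetric]
    by (intro nn_integral_mono SUP_upper2[of v]) (auto simp: norm_minus_commute)
  also have "\<dots> \<le> ennreal (16 * real CARD('m) * S\<^sup>2 * ((real (Suc j) - real j) / 2 ^ n) + 2 * S\<^sup>2 * ((real (Suc j) - real j) / 2 ^ n)\<^sup>2)"
    by (rule bounded_coefficients_increment[OF Y_ito _ \<sigma>_bound b_bound]) simp
  also have "\<dots> \<le> ennreal (node_error / 2 ^ n)"
  proof (rule ennreal_leI)
    have "((1::real) / 2 ^ n)\<^sup>2 \<le> 1 / 2 ^ n"
      using power_decreasing[of 1 2 "1 / 2 ^ n :: real"] by (simp add: divide_simps)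
    then have "2 * S\<^sup>2 * (1 / 2 ^ n)\<^sup>2 \<le> 2 * S\<^sup>2 * (1 / 2 ^ n)"
      by (intro mult_left_mono) auto
    then show "16 * real CARD('m) * S\<^sup>2 * ((real (Suc j) - real j) / 2 ^ n) + 2 * S\<^sup>2 * ((real (Suc j) - real j) / 2 ^ n)\<^sup>2 \<le> node_error / 2 ^ n"
      by (simp add: node_error_def noise_dim_def algebra_simps add_divide_distrib)
  qed
  finally show ?thesis .
qed

text \<open>The part of the squared coefficient differences that does not shrink with the distance
  of the arguments: the additive term of the moduli and the contribution outside the ball. Only a
  larger \<open>N\<close> makes it small.\<close>

definition coefficient_error :: "nat \<Rightarrow> nat \<Rightarrow> real" where
  "coefficient_error L N = 2 * (C * ln (real N) / real N powr \<mu>)\<^sup>2 + 8 * S\<^sup>2 * moment_bound L / (real N)\<^sup>2"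

lemma coefficient_error_nonneg: "0 \<le> coefficient_error L N"
  using moment_bound_nonneg[of L] by (simp add: coefficient_error_def)

text \<open>The scheme evaluates its coefficients at the node \<open>Z\<close> and not at
  \<open>Y\<close>, whence \<open>d\<close>: the distance is split as
  \<open>X - Z = D - (Z - Y)\<close>.\<close>

lemma coefficient_gap:
  assumes v: "v \<in> dyadics" "v \<le> real L" and N: "real N > exp 1"
    and p: "0 \<le> p" "(\<integral>\<^sup>+\<omega>. ennreal ((norm (D n v \<omega>))\<^sup>2) \<partial>M) \<le> ennreal p"
  defines "d \<equiv> 2 * p + 2 * (node_error / 2 ^ n)"
  shows "(\<integral>\<^sup>+\<omega>. ennreal ((norm (\<sigma> (X v \<omega>) - \<sigma> (Z n v \<omega>)))\<^sup>2) \<partial>M)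
      \<le> ennreal (2 * (C\<^sup>2 * ln (real N)) * d + coefficient_error L N)"
    and "(\<integral>\<^sup>+\<omega>. ennreal ((norm (b (X v \<omega>) - b (Z n v \<omega>)))\<^sup>2) \<partial>M)
      \<le> ennreal (2 * (C\<^sup>2 * (ln (real N))\<^sup>2) * d + coefficient_error L N)"
proof -
  note v0 = dyadics_nonneg[OF v(1)]
  have ZM: "Z n v \<in> borel_measurable M"
    by (rule measurable_F[OF euler_node_adapted[OF \<sigma>_cont b_cont v0]])
  have N0: "0 < real N" using N exp_gt_zero[of "1 :: real"] by linarith
  have lnN: "0 \<le> ln (real N)"
    using N N0 ln_ge_iff[of "real N" 1] by linarith
  have \<gamma>: "0 \<le> C * ln (real N) / real N powr \<mu>" using C_pos lnN by simp
  have d0: "0 \<le> d" using p node_error_nonneg by (simp add: d_def)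
  have "(\<integral>\<^sup>+\<omega>. ennreal ((norm (D n v \<omega> - (Z n v \<omega> - Y n v \<omega>)))\<^sup>2) \<partial>M) \<le> ennreal d"
    unfolding d_def using node_error_nonneg p
    by (intro nn_integral_norm_square_diff_le D_measurable borel_measurable_diff ZM Y_measurable v0 Z_close_to_Y v) auto
  then have dist: "(\<integral>\<^sup>+\<omega>. ennreal ((norm (X v \<omega> - Z n v \<omega>))\<^sup>2) \<partial>M) \<le> ennreal d" by simp
  note modulus = modulus_expectation[OF _ N0 _ \<gamma> _ X_measurable[OF v0] ZM d0 dist moment_bound_nonneg
      X_second_moment[OF v] Z_second_moment[OF v]]
  have sq: "(C * sqrt (ln (real N)))\<^sup>2 = C\<^sup>2 * ln (real N)" "(C * ln (real N))\<^sup>2 = C\<^sup>2 * (ln (real N))\<^sup>2"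
    using lnN by (simp_all add: power_mult_distrib)
  have \<alpha>: "0 \<le> C * sqrt (ln (real N))" "0 \<le> C * ln (real N)" using C_pos lnN by auto
  show "(\<integral>\<^sup>+\<omega>. ennreal ((norm (\<sigma> (X v \<omega>) - \<sigma> (Z n v \<omega>)))\<^sup>2) \<partial>M)
      \<le> ennreal (2 * (C\<^sup>2 * ln (real N)) * d + coefficient_error L N)"
    unfolding coefficient_error_def sq(1)[symmetric] by (rule modulus[OF \<sigma>_bound \<alpha>(1) \<sigma>_reg[OF N]])
  show "(\<integral>\<^sup>+\<omega>. ennreal ((norm (b (X v \<omega>) - b (Z n v \<omega>)))\<^sup>2) \<partial>M)
      \<le> ennreal (2 * (C\<^sup>2 * (ln (real N))\<^sup>2) * d + coefficient_error L N)"
    unfolding coefficient_error_def sq(2)[symmetric] by (rule modulus[OF b_bound \<alpha>(2) b_reg[OF N]])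
qed

section \<open>The error functionals and their growth over small steps\<close>

definition sup_error :: "nat \<Rightarrow> real \<Rightarrow> real \<Rightarrow> ennreal" where
  "sup_error n s e = (\<integral>\<^sup>+\<omega>. (\<Squnion>u\<in>dyadics \<inter> {s..e}. ennreal ((norm (D n u \<omega>))\<^sup>2)) \<partial>M)"

definition point_error :: "nat \<Rightarrow> real \<Rightarrow> ennreal" where
  "point_error n s = (\<integral>\<^sup>+\<omega>. ennreal ((norm (D n s \<omega>))\<^sup>2) \<partial>M)"

lemma point_error_le_sup_error:
  "v \<in> dyadics \<Longrightarrow> s \<le> v \<Longrightarrow> v \<le> e \<Longrightarrow> point_error n v \<le> sup_error n s e"
  unfolding point_error_def sup_error_def by (intro nn_integral_mono SUP_upper2[of v]) auto

lemma sup_error_point: "s \<in> dyadics \<Longrightarrow> sup_error n s s = point_error n s"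
  unfolding point_error_def sup_error_def by simp

lemma sup_error_combine:
  assumes "s \<le> u" "u \<le> e"
  shows "sup_error n s e \<le> sup_error n s u + sup_error n u e"
proof -
  have eq: "dyadics \<inter> {s..e} = (dyadics \<inter> {s..u}) \<union> (dyadics \<inter> {u..e})"
    using assms by auto
  show ?thesis unfolding sup_error_def eq
  proof (rule nn_integral_SUP_Un_le)
    fix v assume "v \<in> dyadics \<inter> {s..u} \<union> dyadics \<inter> {u..e}"
    then show "(\<lambda>\<omega>. ennreal ((norm (D n v \<omega>))\<^sup>2)) \<in> borel_measurable M"
      by (intro D_square_measurable dyadics_nonneg) auto
  qed (auto intro: countable_subset[OF _ countable_dyadics])
qed

text \<open>Far from sharp; it supplies the finiteness required for absorption in
  \<open>one_step\<close>.\<close>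

lemma point_error_le:
  assumes "v \<in> dyadics" "v \<le> real L"
  shows "point_error n v \<le> ennreal (2 * moment_bound L + 2 * moment_bound L)"
  unfolding point_error_def
  by (intro nn_integral_norm_square_diff_le X_measurable Y_measurable X_second_moment Y_second_moment
      dyadics_nonneg moment_bound_nonneg assms)

lemma sup_error_le_increment:
  assumes s: "s \<in> dyadics"
    and Q: "(\<integral>\<^sup>+\<omega>. (\<Squnion>u\<in>dyadics \<inter> {s..e}. ennreal ((norm (D n u \<omega> - D n s \<omega>))\<^sup>2)) \<partial>M) \<le> ennreal Q"
  shows "sup_error n s e \<le> 2 * point_error n s + 2 * ennreal Q"
proof -
  let ?I = "dyadics \<inter> {s..e}"
  have "sup_error n s e \<le> (\<integral>\<^sup>+\<omega>. 2 * ennreal ((norm (D n s \<omega>))\<^sup>2)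
      + 2 * (\<Squnion>u\<in>?I. ennreal ((norm (D n u \<omega> - D n s \<omega>))\<^sup>2)) \<partial>M)"
    unfolding sup_error_def
  proof (intro nn_integral_mono SUP_least)
    fix \<omega> u assume u: "u \<in> ?I"
    have "(norm (D n u \<omega>))\<^sup>2 \<le> (norm (D n s \<omega>) + norm (D n u \<omega> - D n s \<omega>))\<^sup>2"
      by (intro power_mono norm_triangle_sub) auto
    also have "\<dots> \<le> 2 * (norm (D n s \<omega>))\<^sup>2 + 2 * (norm (D n u \<omega> - D n s \<omega>))\<^sup>2"
      using sum_squares_bound[of "norm (D n s \<omega>)" "norm (D n u \<omega> - D n s \<omega>)"] by (simp add: power2_sum)
    finally have "ennreal ((norm (D n u \<omega>))\<^sup>2)
        \<le> ennreal (2 * (norm (D n s \<omega>))\<^sup>2 + 2 * (norm (D n u \<omega> - D n s \<omega>))\<^sup>2)"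
      by (rule ennreal_leI)
    also have "\<dots> = 2 * ennreal ((norm (D n s \<omega>))\<^sup>2) + 2 * ennreal ((norm (D n u \<omega> - D n s \<omega>))\<^sup>2)"
      by (simp add: ennreal_mult)
    also have "\<dots> \<le> 2 * ennreal ((norm (D n s \<omega>))\<^sup>2) + 2 * (\<Squnion>u\<in>?I. ennreal ((norm (D n u \<omega> - D n s \<omega>))\<^sup>2))"
      by (intro add_left_mono mult_left_mono SUP_upper[OF u]) auto
    finally show "ennreal ((norm (D n u \<omega>))\<^sup>2) \<le> \<dots>" .
  qed
  also have "\<dots> = 2 * point_error n s + 2 * (\<integral>\<^sup>+\<omega>. (\<Squnion>u\<in>?I. ennreal ((norm (D n u \<omega> - D n s \<omega>))\<^sup>2)) \<partial>M)"
  proof -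
    have sq: "(\<lambda>z :: real ^ 'd. ennreal ((norm z)\<^sup>2)) \<in> borel_measurable borel" by measurable
    have 1: "(\<lambda>\<omega>. \<Squnion>u\<in>?I. ennreal ((norm (D n u \<omega> - D n s \<omega>))\<^sup>2)) \<in> borel_measurable M"
      by (intro borel_measurable_SUP measurable_compose[OF _ sq] borel_measurable_diff[OF D_measurable D_measurable])
         (auto intro: countable_subset[OF _ countable_dyadics] dyadics_nonneg s)
    note 2 = D_square_measurable[OF dyadics_nonneg[OF s], of n]
    show ?thesis unfolding point_error_def
      by (simp only: nn_integral_add[OF borel_measurable_times_ennreal[OF borel_measurable_const 2]
            borel_measurable_times_ennreal[OF borel_measurable_const 1]]
          nn_integral_cmult[OF 1] nn_integral_cmult[OF 2])
  qed
  also have "\<dots> \<le> 2 * point_error n s + 2 * ennreal Q"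
    by (intro add_left_mono mult_left_mono Q) auto
  finally show ?thesis .
qed

lemmas D_ito = ito_process_diff[OF X_ito Y_ito]

text \<open>What \<open>one_step\<close> leaves besides the initial error. With \<open>p\<close> the
  supremum, \<open>e\<close> the initial error, \<open>v = node_error / 2 ^ n\<close>,
  \<open>m\<close> the noise dimension and \<open>G\<close> the coefficient error, it shows
  \<open>p <= 2 e + (2 p + 2 v) / 4 + (32 m + 4) G\<close>; absorbing \<open>p / 2\<close> and
  doubling gives these constants.\<close>

definition step_error :: "nat \<Rightarrow> nat \<Rightarrow> nat \<Rightarrow> real" where
  "step_error L N n = node_error / 2 ^ n + (64 * noise_dim W + 8) * coefficient_error L N"

lemma step_error_nonneg: "0 \<le> step_error L N n"
  using node_error_nonneg coefficient_error_nonneg by (simp add: step_error_def noise_dim_def)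

text \<open>The supremum over the step bounds the error at every time of it and so occurs on both
  sides. Its coefficient on the right is the left-hand side of the condition on
  \<open>\<theta>\<close>, with \<open>\<theta>\<close> in place of step length times
  \<open>ln N\<close>, hence at most 1/2. Absorbing it doubles the 2 of
  \<open>sup_error_le_increment\<close> to 4.\<close>

lemma one_step:
  assumes N: "real N > exp 1" and L: "real (Suc a) / 2 ^ q \<le> real L"
    and \<theta>: "ln (real N) / 2 ^ q \<le> \<theta>" "128 * noise_dim W * C\<^sup>2 * \<theta> + 16 * C\<^sup>2 * \<theta>\<^sup>2 \<le> 1 / 2"
  shows "sup_error n (real a / 2 ^ q) (real (Suc a) / 2 ^ q)
    \<le> 4 * point_error n (real a / 2 ^ q) + ennreal (step_error L N n)"
proof -
  let ?m = "real CARD('m)"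
  let ?s = "real a / 2 ^ q" and ?e = "real (Suc a) / 2 ^ q"
  let ?P = "sup_error n ?s ?e" and ?E = "point_error n ?s"
  define h where "h = (real (Suc a) - real a) / 2 ^ q"
  have h: "h = 1 / 2 ^ q" "0 < h" "h \<le> 1" by (simp_all add: h_def divide_simps)
  define l where "l = ln (real N)"
  have N0: "0 < real N" using N exp_gt_zero[of "1 :: real"] by linarith
  have l0: "0 \<le> l"
    unfolding l_def using N N0 ln_ge_iff[of "real N" 1] by linarith
  have le: "?s \<le> ?e" by (simp add: divide_right_mono)
  have sd: "?s \<in> dyadics" by (rule dyadicsI)
  have sL: "?s \<le> real L" using le L by linarith
  have b2: "norm (\<sigma> y - \<sigma> z) \<le> 2 * S" "norm (b y' - b z') \<le> 2 * S" for y z y' z'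
    using \<sigma>_bound[of y] \<sigma>_bound[of z] b_bound[of y'] b_bound[of z']
      norm_triangle_ineq4[of "\<sigma> y" "\<sigma> z"] norm_triangle_ineq4[of "b y'" "b z'"] by linarith+
  \<comment> \<open>Absorption is legitimate only for a finite supremum, which the trivial bound
    \<open>2 * S\<close> on the coefficient differences ensures.\<close>
  have "?P \<le> 2 * ?E + 2 * ennreal (16 * ?m * (2 * S)\<^sup>2 * h + 2 * (2 * S)\<^sup>2 * h\<^sup>2)"
    unfolding h_def by (intro sup_error_le_increment sd bounded_coefficients_increment[OF D_ito] b2) simp
  moreover have Etop: "?E < top"
    using point_error_le[OF sd sL, of n] by (rule le_less_trans) simp
  ultimately have "?P < top"
    by (auto simp: ennreal_mult_less_top elim!: le_less_trans)
  then obtain p where p: "0 \<le> p" "?P = ennreal p" by (cases ?P) auto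
  obtain e0 where e0: "0 \<le> e0" "?E = ennreal e0" using Etop by (cases ?E) auto
  define d where "d = 2 * p + 2 * (node_error / 2 ^ n)"
  define G where "G = coefficient_error L N"
  define A where "A = 2 * (C\<^sup>2 * l) * d + G"
  define B where "B = 2 * (C\<^sup>2 * l\<^sup>2) * d + G"
  have d0: "0 \<le> d" using p node_error_nonneg by (simp add: d_def)
  have G0: "0 \<le> G" by (simp add: G_def coefficient_error_nonneg)
  have A0: "0 \<le> A" "0 \<le> B" using d0 G0 l0 by (auto simp: A_def B_def)
  have PQ: "?P \<le> 2 * ?E + 2 * ennreal (16 * ?m * A * h + 2 * B * h\<^sup>2)"
    unfolding h_def
  proof (intro sup_error_le_increment sd ito_process_maximal_inequality[OF D_ito])
    fix v assume v: "v \<in> dyadics" "?s \<le> v" "v < ?e"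
    have "point_error n v \<le> ennreal p"
      unfolding p(2)[symmetric] using v by (intro point_error_le_sup_error) auto
    note gap = coefficient_gap[OF v(1) _ N p(1) this[unfolded point_error_def], of L, folded d_def G_def l_def]
    show "(\<integral>\<^sup>+\<omega>. ennreal ((norm (\<sigma> (X v \<omega>) - \<sigma> (Z n v \<omega>)))\<^sup>2) \<partial>M) \<le> ennreal A"
      "(\<integral>\<^sup>+\<omega>. ennreal ((norm (b (X v \<omega>) - b (Z n v \<omega>)))\<^sup>2) \<partial>M) \<le> ennreal B"
      unfolding A_def B_def using v L by (intro gap; linarith)+
  qed (use A0 in auto)
  have "p \<le> 2 * e0 + 2 * Q" if "0 \<le> Q" "?P \<le> 2 * ?E + 2 * ennreal Q" for Q
  proof -
    have "2 * ?E + 2 * ennreal Q = ennreal (2 * e0 + 2 * Q)"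
      unfolding e0(2) using e0(1) that by (simp add: ennreal_mult)
    then show ?thesis using that p e0 by (simp del: ennreal_plus)
  qed
  from this[OF _ PQ] have "p \<le> 2 * e0 + 2 * (16 * ?m * A * h + 2 * B * h\<^sup>2)"
    using A0 h by simp
  \<comment> \<open>In the coefficient of \<open>d\<close>, the step length and \<open>ln N\<close>
    now occur only through their product.\<close>
  also have "2 * (16 * ?m * A * h + 2 * B * h\<^sup>2)
      = (64 * ?m * C\<^sup>2 * (h * l) + 8 * C\<^sup>2 * (h * l)\<^sup>2) * d + (32 * ?m * h + 4 * h\<^sup>2) * G"
    by (simp add: A_def B_def algebra_simps power2_eq_square)
  also have "\<dots> \<le> 1 / 4 * d + (32 * ?m + 4) * G"
  proof (intro add_mono mult_right_mono d0 G0)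
    have hl: "0 \<le> h * l" "h * l \<le> \<theta>" using h l0 \<theta>(1) by (auto simp: l_def)
    have "64 * ?m * C\<^sup>2 * (h * l) \<le> 64 * ?m * C\<^sup>2 * \<theta>"
      using hl by (intro mult_left_mono) auto
    moreover have "8 * C\<^sup>2 * (h * l)\<^sup>2 \<le> 8 * C\<^sup>2 * \<theta>\<^sup>2"
      using hl by (intro mult_left_mono power_mono) auto
    ultimately show "64 * ?m * C\<^sup>2 * (h * l) + 8 * C\<^sup>2 * (h * l)\<^sup>2 \<le> 1 / 4"
      using \<theta>(2)[unfolded noise_dim_def] by linarith
    show "32 * ?m * h \<le> 32 * ?m" using mult_left_mono[of h 1 "32 * ?m"] h(3) by simp
    show "4 * h\<^sup>2 \<le> 4" using h by (simp add: power_le_one)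
  qed
  finally have "p \<le> 4 * e0 + step_error L N n"
    by (simp add: d_def step_error_def noise_dim_def G_def algebra_simps)
  then have "?P \<le> ennreal (4 * e0 + step_error L N n)"
    unfolding p(2) by (rule ennreal_leI)
  also have "\<dots> = 4 * ?E + ennreal (step_error L N n)"
    unfolding e0(2) using e0(1) step_error_nonneg by (simp add: ennreal_mult)
  finally show ?thesis .
qed

text \<open>A further step adds at most 4 times the supremum so far, which with the old supremum
  makes 5. Carrying the step error on both sides turns the recursion into a homogeneous one, since
  \<open>5 V + 2 e <= 5 (V + e)\<close>.\<close>

lemma several_steps:
  assumes N: "real N > exp 1" and L: "real (a + r) / 2 ^ q \<le> real L"
    and \<theta>: "ln (real N) / 2 ^ q \<le> \<theta>" "128 * noise_dim W * C\<^sup>2 * \<theta> + 16 * C\<^sup>2 * \<theta>\<^sup>2 \<le> 1 / 2"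
  shows "sup_error n (real a / 2 ^ q) (real (a + r) / 2 ^ q) + ennreal (step_error L N n)
    \<le> 5 ^ r * (point_error n (real a / 2 ^ q) + ennreal (step_error L N n))"
  using L
proof (induction r)
  case 0
  then show ?case by (simp add: sup_error_point dyadicsI)
next
  case (Suc r)
  let ?t = "\<lambda>i. real (a + i) / 2 ^ q"
  let ?V = "sup_error n (?t 0) (?t r)" and ?e = "ennreal (step_error L N n)"
  have mono: "?t i \<le> ?t j" if "i \<le> j" for i j
    using that by (intro divide_right_mono) auto
  have L': "?t r \<le> real L" "real (Suc (a + r)) / 2 ^ q \<le> real L"
    using Suc.prems mono[of r "Suc r"] by auto
  have "sup_error n (?t 0) (?t (Suc r)) \<le> ?V + sup_error n (?t r) (?t (Suc r))"
    by (rule sup_error_combine; rule mono; simp)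
  also have "sup_error n (?t r) (?t (Suc r)) \<le> 4 * point_error n (?t r) + ?e"
    using one_step[OF N L'(2) \<theta>] by simp
  also have "point_error n (?t r) \<le> ?V"
    by (rule point_error_le_sup_error[OF dyadicsI]; rule mono; simp)
  finally have "sup_error n (?t 0) (?t (Suc r)) + ?e \<le> ?V + (4 * ?V + ?e) + ?e"
    by (simp add: mult_left_mono add_mono)
  also have "\<dots> = 5 * ?V + 2 * ?e"
  proof -
    have "?V + 4 * ?V = 5 * ?V" using distrib_right[of 1 4 ?V] by simp
    moreover have "?V + (4 * ?V + ?e) + ?e = (?V + 4 * ?V) + (?e + ?e)" by (simp only: add.assoc)
    ultimately show ?thesis by (simp only: mult_2)
  qed
  also have "\<dots> \<le> 5 * (?V + ?e)"
    unfolding distrib_left by (intro add_left_mono mult_right_mono) auto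
  also have "\<dots> \<le> 5 * (5 ^ r * (point_error n (?t 0) + ?e))"
    using Suc.IH[OF L'(1)] by (intro mult_left_mono) auto
  finally show ?case by (simp add: mult.assoc)
qed

section \<open>Convergence\<close>

text \<open>The choice \<open>\<theta> <= 1\<close> reduces the quadratic condition to a linear
  one.\<close>

lemma step_size_exists:
  obtains \<theta> where "0 < \<theta>" "128 * noise_dim W * C\<^sup>2 * \<theta> + 16 * C\<^sup>2 * \<theta>\<^sup>2 \<le> 1 / 2"
proof
  define k where "k = 128 * noise_dim W * C\<^sup>2 + 16 * C\<^sup>2"
  define \<theta> where "\<theta> = min 1 (1 / (2 * k))"
  have k: "0 < k" using C_pos by (auto simp: k_def noise_dim_def intro!: add_nonneg_pos)
  then show \<theta>: "0 < \<theta>" by (simp add: \<theta>_def)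
  have "\<theta> \<le> 1" by (simp add: \<theta>_def)
  then have "\<theta>\<^sup>2 \<le> \<theta>" using \<theta> by (simp add: power2_eq_square mult_left_le)
  then have "16 * C\<^sup>2 * \<theta>\<^sup>2 \<le> 16 * C\<^sup>2 * \<theta>" by (intro mult_left_mono) auto
  then have "128 * noise_dim W * C\<^sup>2 * \<theta> + 16 * C\<^sup>2 * \<theta>\<^sup>2 \<le> k * \<theta>"
    by (simp add: k_def algebra_simps)
  also have "\<dots> \<le> k * (1 / (2 * k))" using k by (intro mult_left_mono) (auto simp: \<theta>_def)
  also have "\<dots> = 1 / 2" using k by simp
  finally show "128 * noise_dim W * C\<^sup>2 * \<theta> + 16 * C\<^sup>2 * \<theta>\<^sup>2 \<le> 1 / 2" .
qed

lemma floor_exp_bounds: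
  fixes t :: real
  assumes "1 \<le> t"
  shows "exp t / 2 \<le> real (nat \<lfloor>exp t\<rfloor>)" "real (nat \<lfloor>exp t\<rfloor>) \<le> exp t"
    "0 \<le> ln (real (nat \<lfloor>exp t\<rfloor>))" "ln (real (nat \<lfloor>exp t\<rfloor>)) \<le> t"
proof -
  have "2 \<le> exp t" using exp_ge_add_one_self[of t] assms by linarith
  then show 1: "exp t / 2 \<le> real (nat \<lfloor>exp t\<rfloor>)" by linarith
  show 2: "real (nat \<lfloor>exp t\<rfloor>) \<le> exp t" by simp
  have 3: "1 \<le> real (nat \<lfloor>exp t\<rfloor>)" using 1 \<open>2 \<le> exp t\<close> by linarith
  then show "0 \<le> ln (real (nat \<lfloor>exp t\<rfloor>))" by simp
  have "ln (real (nat \<lfloor>exp t\<rfloor>)) \<le> ln (exp t)" using 2 3 by (subst ln_le_cancel_iff) auto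
  then show "ln (real (nat \<lfloor>exp t\<rfloor>)) \<le> t" by simp
qed

text \<open>The radius \<open>\<lfloor>exp t\<rfloor>\<close> is essentially the largest one admissible in \<open>one_step\<close> for steps of length
  \<open>\<theta> / t\<close>; the factor \<open>exp (\<rho> * t)\<close> is the amplification over one block.\<close>

lemma coefficient_error_decay:
  assumes \<rho>: "\<rho> < 2 * \<mu>" "\<rho> < 2"
  shows "((\<lambda>t. exp (\<rho> * t) * coefficient_error L (nat \<lfloor>exp t\<rfloor>)) \<longlongrightarrow> 0) at_top"
proof -
  let ?c = "moment_bound L"
  \<comment> \<open>Obtained from \<open>exp t / 2 <= N\<close> and \<open>ln N <= t\<close>:
    halving the radius costs the squared factor \<open>2 powr \<mu>\<close> in the first term and
    turns 8 into 32 in the second.\<close>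
  let ?g = "\<lambda>t. 2 * C\<^sup>2 * (2 powr \<mu>)\<^sup>2 * (t\<^sup>2 * exp (- (2 * \<mu> - \<rho>) * t)) + 32 * S\<^sup>2 * ?c * exp (- (2 - \<rho>) * t)"
  have "((\<lambda>t :: real. t\<^sup>2 * exp (- k * t)) \<longlongrightarrow> 0) at_top" "((\<lambda>t :: real. exp (- k * t)) \<longlongrightarrow> 0) at_top"
    if "0 < k" for k :: real
    using that by real_asymp+
  note lim = this(1)[of "2 * \<mu> - \<rho>"] this(2)[of "2 - \<rho>"]
  have "(?g \<longlongrightarrow> 2 * C\<^sup>2 * (2 powr \<mu>)\<^sup>2 * 0 + 32 * S\<^sup>2 * ?c * 0) at_top"
    using \<rho> by (intro tendsto_add tendsto_mult tendsto_const lim) auto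
  then have g: "(?g \<longlongrightarrow> 0) at_top" by simp
  have le: "\<forall>\<^sub>F t in at_top. exp (\<rho> * t) * coefficient_error L (nat \<lfloor>exp t\<rfloor>) \<le> ?g t"
    using eventually_ge_at_top[of "1 :: real"]
  proof eventually_elim
    fix t :: real assume t: "1 \<le> t"
    let ?N = "real (nat \<lfloor>exp t\<rfloor>)"
    note N = floor_exp_bounds[OF t]
    have half: "0 < exp t / 2" by simp
    then have N0: "0 < ?N" using N(1) by linarith
    have "C * ln ?N / ?N powr \<mu> \<le> C * t / (exp t / 2) powr \<mu>"
      using C_pos N t half \<mu>_pos by (intro frac_le mult_left_mono powr_mono2) auto
    moreover have "0 \<le> C * ln ?N / ?N powr \<mu>" using C_pos N by simp
    ultimately have "(C * ln ?N / ?N powr \<mu>)\<^sup>2 \<le> (C * t / (exp t / 2) powr \<mu>)\<^sup>2"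
      by (rule power_mono)
    also have "(exp t / 2) powr \<mu> = exp (\<mu> * t) / 2 powr \<mu>"
      by (simp add: powr_divide exp_powr_real mult.commute)
    also have "(C * t / (exp (\<mu> * t) / 2 powr \<mu>))\<^sup>2 = C\<^sup>2 * (2 powr \<mu>)\<^sup>2 * (t\<^sup>2 * exp (- (2 * \<mu> * t)))"
    proof -
      have "(exp (\<mu> * t))\<^sup>2 = exp (2 * \<mu> * t)"
        using exp_double[of "\<mu> * t"] by (simp add: mult.assoc)
      then show ?thesis by (simp add: power_divide power_mult_distrib exp_minus divide_inverse power_inverse)
    qed
    finally have 1: "(C * ln ?N / ?N powr \<mu>)\<^sup>2 \<le> C\<^sup>2 * (2 powr \<mu>)\<^sup>2 * (t\<^sup>2 * exp (- (2 * \<mu> * t)))" .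
    have "8 * S\<^sup>2 * ?c / ?N\<^sup>2 \<le> 8 * S\<^sup>2 * ?c / (exp t / 2)\<^sup>2"
    proof (rule frac_le)
      show "(exp t / 2)\<^sup>2 \<le> ?N\<^sup>2" using N(1) half by (intro power_mono) linarith+
      show "0 \<le> 8 * S\<^sup>2 * ?c" using moment_bound_nonneg[of L] by simp
    qed simp_all
    also have "\<dots> = 32 * S\<^sup>2 * ?c * exp (- (2 * t))"
    proof -
      have "(exp t / 2)\<^sup>2 = exp (2 * t) / 4" by (simp add: power_divide exp_double)
      then show ?thesis by (simp only:) (simp add: exp_minus field_simps)
    qed
    finally have "coefficient_error L (nat \<lfloor>exp t\<rfloor>)
        \<le> 2 * (C\<^sup>2 * (2 powr \<mu>)\<^sup>2 * (t\<^sup>2 * exp (- (2 * \<mu> * t)))) + 32 * S\<^sup>2 * ?c * exp (- (2 * t))"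
      unfolding coefficient_error_def using 1 by linarith
    then have "exp (\<rho> * t) * coefficient_error L (nat \<lfloor>exp t\<rfloor>)
        \<le> exp (\<rho> * t) * (2 * (C\<^sup>2 * (2 powr \<mu>)\<^sup>2 * (t\<^sup>2 * exp (- (2 * \<mu> * t)))) + 32 * S\<^sup>2 * ?c * exp (- (2 * t)))"
      by (rule mult_left_mono) simp
    also have "\<dots> = ?g t"
    proof -
      have "exp (- (2 * \<mu> - \<rho>) * t) = exp (\<rho> * t) * exp (- (2 * \<mu> * t))"
        "exp (- (2 - \<rho>) * t) = exp (\<rho> * t) * exp (- (2 * t))"
        by (simp_all add: algebra_simps flip: exp_add)
      then show ?thesis by (simp only: distrib_left mult_ac)
    qed
    finally show "exp (\<rho> * t) * coefficient_error L (nat \<lfloor>exp t\<rfloor>) \<le> ?g t" .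
  qed
  show ?thesis
    by (rule tendsto_sandwich[OF _ le tendsto_const g]) (simp add: coefficient_error_nonneg)
qed

text \<open>Given \<open>e\<close>, the refinement \<open>i\<close> and with it the radius are fixed
  first, so that the amplified coefficient error is below \<open>e\<close>. Only then does
  \<open>n\<close> grow: the start error and the node error vanish despite the now constant factor
  \<open>5 ^ (2 ^ i)\<close>. The conditions on \<open>p\<close> make the block so short that the
  decay in the radius beats the amplification.\<close>

lemma sup_error_block_tendsto:
  assumes \<theta>: "0 < \<theta>" "128 * noise_dim W * C\<^sup>2 * \<theta> + 16 * C\<^sup>2 * \<theta>\<^sup>2 \<le> 1 / 2"
    and p: "ln 5 / (\<theta> * 2 ^ p) < 2 * \<mu>" "ln 5 / (\<theta> * 2 ^ p) < 2"
    and L: "real (Suc j) / 2 ^ p \<le> real L"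
    and start: "(\<lambda>n. point_error n (real j / 2 ^ p)) \<longlonglongrightarrow> 0"
  shows "(\<lambda>n. sup_error n (real j / 2 ^ p) (real (Suc j) / 2 ^ p)) \<longlonglongrightarrow> 0"
proof (rule order_tendstoI)
  fix e :: ennreal assume e: "0 < e"
  \<comment> \<open>The logarithm of the radius that matches steps of length
    \<open>1 / 2 ^ (p + i)\<close>: its product with this length is exactly
    \<open>\<theta>\<close>.\<close>
  let ?t = "\<lambda>i. \<theta> * 2 ^ (p + i) :: real"
  let ?N = "\<lambda>i. nat \<lfloor>exp (?t i)\<rfloor>"
  define c where "c = 64 * noise_dim W + 8"
  have c: "0 \<le> c" by (simp add: c_def noise_dim_def)
  have t: "filterlim ?t at_top sequentially"
    using \<theta>(1) by real_asymp
  \<comment> \<open>A block consists of \<open>2 ^ i\<close> steps, a number proportional to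
    \<open>?t i\<close>, so its amplification has the exponential form of
    \<open>coefficient_error_decay\<close>.\<close>
  have pow: "(5::real) ^ (2 ^ i) = exp (ln 5 / (\<theta> * 2 ^ p) * ?t i)" for i
  proof -
    have "exp (real (2 ^ i) * ln 5) = (5::real) ^ (2 ^ i)" by (subst exp_of_nat_mult) simp
    moreover have "ln 5 / (\<theta> * 2 ^ p) * ?t i = real (2 ^ i) * ln 5"
      using \<theta>(1) by (simp add: power_add)
    ultimately show ?thesis by (simp only:)
  qed
  have "(\<lambda>i. exp (ln 5 / (\<theta> * 2 ^ p) * ?t i) * coefficient_error L (?N i)) \<longlonglongrightarrow> 0"
    by (rule filterlim_compose[OF coefficient_error_decay[OF p] t])
  then have "(\<lambda>i. c * (5 ^ (2 ^ i) * coefficient_error L (?N i))) \<longlonglongrightarrow> c * 0"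
    unfolding pow by (intro tendsto_mult tendsto_const)
  then have "(\<lambda>i. ennreal (c * (5 ^ (2 ^ i) * coefficient_error L (?N i)))) \<longlonglongrightarrow> ennreal (c * 0)"
    by (rule tendsto_ennrealI)
  then have small: "\<forall>\<^sub>F i in sequentially. ennreal (c * (5 ^ (2 ^ i) * coefficient_error L (?N i))) < e"
    using e by (intro order_tendstoD(2)) auto
  \<comment> \<open>Ensures a radius above \<open>exp 1\<close>: it is at least
    \<open>exp (?t i) / 2\<close>, and \<open>exp 3 > 2 * exp 1\<close>.\<close>
  have large: "\<forall>\<^sub>F i in sequentially. 4 \<le> ?t i"
    using t by (auto simp: filterlim_at_top)
  from eventually_happens[OF eventually_conj[OF small large]]
  obtain i where i: "ennreal (c * (5 ^ (2 ^ i) * coefficient_error L (?N i))) < e" "4 \<le> ?t i"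
    by auto
  have t1: "1 \<le> ?t i" using i(2) by linarith
  note N = floor_exp_bounds[OF t1]
  have "2 \<le> exp (1 :: real)" using exp_ge_add_one_self[of "1 :: real"] by simp
  then have "2 * exp 1 < exp 1 * exp (1 :: real) * exp 1" 
    using mult_strict_mono[of 2 "exp 1 * exp (1::real)" "exp 1" "exp (1::real)"] mult_mono[of 2 "exp 1" 2 "exp (1::real)"] by simp
  also have "\<dots> = exp (3 :: real)" by (simp flip: exp_add)
  also have "\<dots> \<le> exp (?t i)" using i(2) by (subst exp_le_cancel_iff) linarith
  finally have N1: "real (?N i) > exp 1" using N(1) by linarith
  have \<theta>i: "ln (real (?N i)) / 2 ^ (p + i) \<le> \<theta>"
    using N(4) by (simp add: pos_divide_le_eq)
  have eq: "real (j * 2 ^ i) / 2 ^ (p + i) = real j / 2 ^ p"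
      "real (j * 2 ^ i + 2 ^ i) / 2 ^ (p + i) = real (Suc j) / 2 ^ p"
    by (simp_all add: power_add field_simps)
  let ?s = "real j / 2 ^ p" and ?e = "real (Suc j) / 2 ^ p"
  let ?r = "\<lambda>n. 5 ^ (2 ^ i) * (point_error n ?s + ennreal (step_error L (?N i) n))"
  have le: "sup_error n ?s ?e \<le> ?r n" for n
  proof -
    have "sup_error n ?s ?e \<le> sup_error n ?s ?e + ennreal (step_error L (?N i) n)" by simp
    also have "\<dots> \<le> ?r n"
      using several_steps[of "?N i" "j * 2 ^ i" "2 ^ i" "p + i" L \<theta> n, unfolded eq, OF N1 L \<theta>i \<theta>(2)] .
    finally show ?thesis .
  qed
  \<comment> \<open>From here on \<open>i\<close> is fixed and \<open>n\<close> tends to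
    infinity.\<close>
  have "(\<lambda>n. node_error / 2 ^ n) \<longlonglongrightarrow> 0"
    by (rule LIMSEQ_divide_realpow_zero) simp
  then have "(\<lambda>n. step_error L (?N i) n) \<longlonglongrightarrow> 0 + c * coefficient_error L (?N i)"
    unfolding step_error_def c_def by (intro tendsto_add tendsto_const)
  then have "(\<lambda>n. point_error n ?s + ennreal (step_error L (?N i) n)) \<longlonglongrightarrow> 0 + ennreal (0 + c * coefficient_error L (?N i))"
    by (intro tendsto_add start tendsto_ennrealI)
  then have "?r \<longlonglongrightarrow> 5 ^ (2 ^ i) * (0 + ennreal (0 + c * coefficient_error L (?N i)))"
    by (intro ennreal_tendsto_cmult) (auto simp: power_less_top_ennreal)
  also have "5 ^ (2 ^ i) * (0 + ennreal (0 + c * coefficient_error L (?N i)))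
      = ennreal (c * (5 ^ (2 ^ i) * coefficient_error L (?N i)))"
  proof -
    have "(5 :: ennreal) ^ (2 ^ i) = ennreal (5 ^ (2 ^ i))" by (simp add: ennreal_power[symmetric])
    then show ?thesis
      using c coefficient_error_nonneg[of L "?N i"] by (simp add: mult.left_commute flip: ennreal_mult)
  qed
  finally have "\<forall>\<^sub>F n in sequentially. ?r n < e" using i(1) by (rule order_tendstoD(2))
  then show "\<forall>\<^sub>F n in sequentially. sup_error n ?s ?e < e"
    by eventually_elim (rule le_less_trans[OF le])
qed simp

text \<open>The supremum up to the start of a block dominates the error at that point, which is the
  input of the next block. The block length is chosen from \<open>\<theta>\<close> and
  \<open>\<mu>\<close> alone, independently of \<open>n\<close> and of the radius, so the number
  \<open>L * 2 ^ p\<close> of blocks is fixed.\<close>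

lemma sup_error_tendsto: "(\<lambda>n. sup_error n 0 (real L)) \<longlonglongrightarrow> 0"
proof -
  obtain \<theta> where \<theta>: "0 < \<theta>" "128 * noise_dim W * C\<^sup>2 * \<theta> + 16 * C\<^sup>2 * \<theta>\<^sup>2 \<le> 1 / 2"
    by (rule step_size_exists)
  have "(\<lambda>p. ln 5 / (\<theta> * 2 ^ p)) \<longlonglongrightarrow> 0" using \<theta>(1) by real_asymp
  then have "\<forall>\<^sub>F p in sequentially. ln 5 / (\<theta> * 2 ^ p) < min (2 * \<mu>) 2"
    using \<mu>_pos by (intro order_tendstoD(2)) auto
  then obtain p where p: "ln 5 / (\<theta> * 2 ^ p) < 2 * \<mu>" "ln 5 / (\<theta> * 2 ^ p) < 2"
    using eventually_happens[of _ sequentially] by auto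
  have "(\<lambda>n. sup_error n 0 (real j / 2 ^ p)) \<longlonglongrightarrow> 0" if "real j / 2 ^ p \<le> real L" for j
    using that
  proof (induction j)
    case 0
    have "point_error n 0 = 0" for n
    proof -
      have "AE \<omega> in M. ennreal ((norm (D n 0 \<omega>))\<^sup>2) = 0"
        using sde_solution_start[OF sol] by eventually_elim (simp add: euler_def)
      then show ?thesis
        unfolding point_error_def using nn_integral_0_iff_AE[OF D_square_measurable, of 0 n] by simp
    qed
    then have "sup_error n 0 0 = 0" for n
      using sup_error_point[of 0 n] dyadicsI[of 0 0] by simp
    then show ?case by simp
  next
    case (Suc j)
    let ?s = "real j / 2 ^ p" and ?e = "real (Suc j) / 2 ^ p"
    have le: "0 \<le> ?s" "?s \<le> ?e" by (auto intro: divide_right_mono)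
    then have IH: "(\<lambda>n. sup_error n 0 ?s) \<longlonglongrightarrow> 0" using Suc by linarith
    have "(\<lambda>n. point_error n ?s) \<longlonglongrightarrow> 0"
      by (rule tendsto_sandwich[OF _ _ tendsto_const IH]) (auto intro!: always_eventually point_error_le_sup_error dyadicsI)
    then have "(\<lambda>n. sup_error n ?s ?e) \<longlonglongrightarrow> 0"
      by (rule sup_error_block_tendsto[OF \<theta> p Suc.prems])
    from tendsto_add[OF IH this] have "(\<lambda>n. sup_error n 0 ?s + sup_error n ?s ?e) \<longlonglongrightarrow> 0" by simp
    note lim = this
    show ?case
      by (rule tendsto_sandwich[OF _ _ tendsto_const lim]) (use sup_error_combine[OF le] in auto)
  qed
  from this[of "L * 2 ^ p"] show ?thesis by simp
qed

section \<open>Passage from dyadic times to all times\<close>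

lemma D_right_limit:
  assumes t: "0 \<le> t" and \<omega>: "\<omega> \<in> space M"
  defines "u \<equiv> \<lambda>i. real (Suc (nat \<lfloor>t * 2 ^ i\<rfloor>)) / 2 ^ i"
  shows "u \<longlonglongrightarrow> t" "(\<lambda>i. D n (u i) \<omega>) \<longlonglongrightarrow> D n t \<omega>"
proof -
  have u: "t < u i" "u i \<le> t + (1 / 2) ^ i" for i
  proof -
    have "t * 2 ^ i < real (Suc (nat \<lfloor>t * 2 ^ i\<rfloor>))" "real (Suc (nat \<lfloor>t * 2 ^ i\<rfloor>)) \<le> t * 2 ^ i + 1"
      using t by (simp_all, linarith+)
    then show "t < u i" "u i \<le> t + (1 / 2) ^ i"
      by (simp_all add: u_def field_simps power_divide)
  qed
  have lim: "(\<lambda>i. t + (1 / 2) ^ i) \<longlonglongrightarrow> t" by real_asymp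
  show ut: "u \<longlonglongrightarrow> t"
    by (rule tendsto_sandwich[OF _ _ tendsto_const lim]) (use u(1)[THEN less_imp_le] u(2) in auto)
  have path: "(\<lambda>i. f (u i)) \<longlonglongrightarrow> f t" if "continuous_on {0..} f" for f :: "real \<Rightarrow> 'c::topological_space"
  proof (rule continuous_on_tendsto_compose[OF that ut])
    show "t \<in> {0..}" using t by simp
    show "\<forall>\<^sub>F i in sequentially. u i \<in> {0..}" using order.trans[OF t less_imp_le[OF u(1)]] by auto
  qed
  have X: "(\<lambda>i. X (u i) \<omega>) \<longlonglongrightarrow> X t \<omega>" and W: "(\<lambda>i. W (u i) \<omega>) \<longlonglongrightarrow> W t \<omega>"
    using sol BM \<omega> by (auto intro!: path simp: sde_solution_def std_brownian_motion_def)
  define j where "j = nat \<lfloor>t * 2 ^ n\<rfloor>"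
  let ?y = "\<lambda>s. euler_grid \<sigma> b W x n j \<omega> + \<sigma> (euler_grid \<sigma> b W x n j \<omega>) *v (W s \<omega> - W (real j / 2 ^ n) \<omega>)
      + (s - real j / 2 ^ n) *\<^sub>R b (euler_grid \<sigma> b W x n j \<omega>)"
  have j: "real j / 2 ^ n \<le> t" "t < real (Suc j) / 2 ^ n"
  proof -
    have "real j \<le> t * 2 ^ n" "t * 2 ^ n < real (Suc j)"
      unfolding j_def using t by (simp_all, linarith+)
    then show "real j / 2 ^ n \<le> t" "t < real (Suc j) / 2 ^ n" by (simp_all add: field_simps)
  qed
  have "\<forall>\<^sub>F i in sequentially. u i < real (Suc j) / 2 ^ n"
    by (rule order_tendstoD(2)[OF ut j(2)])
  \<comment> \<open>Approaching \<open>t\<close> from the right, \<open>u i\<close> finally stays in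
    the cell of the scheme that contains \<open>t\<close>, where \<open>Y\<close> is a single
    expression continuous in time.\<close>
  then have ev: "\<forall>\<^sub>F i in sequentially. ?y (u i) = Y n (u i) \<omega>"
  proof eventually_elim
    fix i assume "u i < real (Suc j) / 2 ^ n"
    with j u(1)[of i] show "?y (u i) = Y n (u i) \<omega>"
      by (intro euler_cell[symmetric]) linarith+
  qed
  have "(\<lambda>i. ?y (u i)) \<longlonglongrightarrow> ?y t"
    by (intro tendsto_intros W ut matrix_vector_mul_bounded_linear[THEN bounded_linear.tendsto])
  moreover have "?y t = Y n t \<omega>" using j by (intro euler_cell[symmetric]) linarith+
  ultimately have "(\<lambda>i. Y n (u i) \<omega>) \<longlonglongrightarrow> Y n t \<omega>"
    using tendsto_cong[OF ev] by simp
  with X show "(\<lambda>i. D n (u i) \<omega>) \<longlonglongrightarrow> D n t \<omega>" by (rule tendsto_diff)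
qed

text \<open>The dyadic approximants lie strictly to the right of \<open>t\<close>; the room between
  \<open>T\<close> and \<open>L\<close> keeps them in the larger interval even for
  \<open>t = T\<close>.\<close>

lemma SUP_le_dyadic_SUP:
  assumes T: "T < real L" and \<omega>: "\<omega> \<in> space M"
  shows "(\<Squnion>t\<in>{0..T}. ennreal ((norm (D n t \<omega>))\<^sup>2)) \<le> (\<Squnion>u\<in>dyadics \<inter> {0..real L}. ennreal ((norm (D n u \<omega>))\<^sup>2))"
proof (rule SUP_least)
  fix t assume t: "t \<in> {0..T}"
  let ?u = "\<lambda>i. real (Suc (nat \<lfloor>t * 2 ^ i\<rfloor>)) / 2 ^ i"
  have t0: "0 \<le> t" using t by simp
  have lim: "(\<lambda>i. ennreal ((norm (D n (?u i) \<omega>))\<^sup>2)) \<longlonglongrightarrow> ennreal ((norm (D n t \<omega>))\<^sup>2)"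
    by (intro tendsto_ennrealI tendsto_power tendsto_norm D_right_limit(2)[OF t0 \<omega>])
  have "\<forall>\<^sub>F i in sequentially. ?u i < real L"
    using t T by (intro order_tendstoD(2)[OF D_right_limit(1)[OF t0 \<omega>]]) auto
  then have "\<forall>\<^sub>F i in sequentially. ennreal ((norm (D n (?u i) \<omega>))\<^sup>2) \<le> (\<Squnion>u\<in>dyadics \<inter> {0..real L}. ennreal ((norm (D n u \<omega>))\<^sup>2))"
  proof eventually_elim
    fix i assume "?u i < real L"
    moreover have "0 \<le> ?u i" by simp
    ultimately have "?u i \<in> dyadics \<inter> {0..real L}" using dyadicsI by (simp only: Int_iff atLeastAtMost_iff) simp
    then show "ennreal ((norm (D n (?u i) \<omega>))\<^sup>2) \<le> (\<Squnion>u\<in>dyadics \<inter> {0..real L}. ennreal ((norm (D n u \<omega>))\<^sup>2))"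
      by (rule SUP_upper)
  qed
  then show "ennreal ((norm (D n t \<omega>))\<^sup>2) \<le> (\<Squnion>u\<in>dyadics \<inter> {0..real L}. ennreal ((norm (D n u \<omega>))\<^sup>2))"
    by (rule tendsto_upperbound[OF lim]) simp
qed

text \<open>Pointwise domination by the countable supremum is enough: monotonicity of
  \<open>nn_integral\<close> applies to the uncountable supremum without a discussion of its
  measurability.\<close>

lemma euler_scheme_converges:
  "(\<lambda>n. \<integral>\<^sup>+ \<omega>. (\<Squnion>t\<in>{0..T}. ennreal ((norm (D n t \<omega>))\<^sup>2)) \<partial>M) \<longlonglongrightarrow> 0"
proof -
  obtain L :: nat where L: "T < real L" using reals_Archimedean2 by blast
  have "(\<integral>\<^sup>+ \<omega>. (\<Squnion>t\<in>{0..T}. ennreal ((norm (D n t \<omega>))\<^sup>2)) \<partial>M) \<le> sup_error n 0 (real L)" for n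
    unfolding sup_error_def by (intro nn_integral_mono SUP_le_dyadic_SUP L)
  then show ?thesis
    by (intro tendsto_sandwich[OF _ _ tendsto_const sup_error_tendsto[of L]]) auto
qed

end

theorem theorem3p2:
  fixes M :: "'a measure" and F :: "real \<Rightarrow> 'a measure"
    and W :: "real \<Rightarrow> 'a \<Rightarrow> real ^ 'm"
    and \<sigma> :: "real ^ 'd \<Rightarrow> real ^ 'm ^ 'd" and b :: "real ^ 'd \<Rightarrow> real ^ 'd"
    and x :: "real ^ 'd" and X :: "real \<Rightarrow> 'a \<Rightarrow> real ^ 'd"
    and C \<mu> T :: real
  assumes filt: "usual_filtration M F"
    and BM: "std_brownian_motion M F W"
    and \<sigma>_bdd: "bounded (range \<sigma>)" and \<sigma>_cont: "continuous_on UNIV \<sigma>"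
    and b_bdd: "bounded (range b)" and b_cont: "continuous_on UNIV b"
    and C_pos: "C > 0" and \<mu>_pos: "\<mu> > 0"
    and \<sigma>_reg: "\<And>(N::nat) y z. real N > exp 1 \<Longrightarrow> norm y \<le> real N \<Longrightarrow> norm z \<le> real N \<Longrightarrow>
        norm (\<sigma> y - \<sigma> z) \<le> C * sqrt (ln (real N)) * norm (y - z) + C * ln (real N) / real N powr \<mu>"
    and b_reg: "\<And>(N::nat) y z. real N > exp 1 \<Longrightarrow> norm y \<le> real N \<Longrightarrow> norm z \<le> real N \<Longrightarrow>
        norm (b y - b z) \<le> C * ln (real N) * norm (y - z) + C * ln (real N) / real N powr \<mu>"
    and sol: "sde_solution M F W \<sigma> b x X"
    and T_pos: "T > 0"
  shows "(\<lambda>n. \<integral>\<^sup>+ \<omega>. (\<Squnion>t\<in>{0..T}. ennreal ((norm (X t \<omega> - euler \<sigma> b W x n t \<omega>))\<^sup>2)) \<partial>M)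
           \<longlonglongrightarrow> 0"
proof -
  obtain S\<^sub>1 S\<^sub>2 where S: "\<And>y. norm (\<sigma> y) \<le> S\<^sub>1" "\<And>y. norm (b y) \<le> S\<^sub>2"
    using \<sigma>_bdd b_bdd by (auto simp: bounded_iff)
  interpret euler_scheme M F W \<sigma> b x X "max S\<^sub>1 S\<^sub>2" C \<mu>
    by unfold_locales (use assms S in \<open>auto simp: le_max_iff_disj\<close>)
  show ?thesis by (rule euler_scheme_converges)
qed

end
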